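(* Fix $0<q\le 1$. There is an absolute constant $c_1'>0$, and for all $C_1,C_2>0$ there is a constant $C'>0$ depending only on $C_1$ and $C_2$ ($q$ being fixed), such that the following holds. Let $\bar\epsilon>0$, let $a\in\mathbb R^d$ be a row vector with $\|a\|_{\ell_2^d}=1$ and $\left(\sum_{j=1}^d|a_j|^q\right)^{1/q}\le C_1$, let $g\in C^2([-1-\bar\epsilon,1+\bar\epsilon])$ satisfy $\max_{0\le \ell\le 2}\|g^{(\ell)}\|_\infty\le C_2$, put $f(x)=g(a\cdot x)$ for $x\in B_{\mathbb R^d}(1+\bar\epsilon)$, and let $\alpha>0$ be such that $\int_{\mathbb S^{d-1}}|g'(a\cdot x)|^2\,d\mu_{\mathbb S^{d-1}}(x)\ge\alpha$. Let $0<s<1$, let $m_{\mathcal X},m_\Phi\in\mathbb N$ with $\log d\le m_\Phi\le[\log 6]^{-2}d$, let $\epsilon>0$ with $\epsilon\sqrt{d/m_\Phi}\le\bar\epsilon$, and set $$\nu_1=C'\left(\left[\frac{m_\Phi}{\log(d/m_\Phi)}\right]^{1/2-1/q}+\frac{\epsilon}{\sqrt{m_\Phi}}\right).$$ Assume $\nu_1<\sqrt{\alpha(1-s)}$. Then Algorithm 1 (described in the context), which uses $m_{\mathcal X}\cdot(m_\Phi+1)$ function evaluations of $f$ to compute the vector $\hat a$, defines a function $\hat f:B_{\mathbb R^d}(1+\bar\epsilon)\to\mathbb R$ that, with probability at least $$1-\left(e^{-c_1'm_\Phi}+e^{-\sqrt{m_\Phi d}}+2e^{-\frac{2m_{\mathcal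 X}s^2\alpha^2}{C_2^4}}\right),$$ satisfies $$\|f-\hat f\|_\infty\le 2C_2(1+\bar\epsilon)\frac{\nu_1}{\sqrt{\alpha(1-s)}-\nu_1},$$ where $\|\cdot\|_\infty$ is the supremum norm on $B_{\mathbb R^d}(1+\bar\epsilon)$.
   Context: $B_{\mathbb R^n}(r)$ is the Euclidean ball of radius $r$ in $\mathbb R^n$, $\mathbb S^{d-1}$ is the unit sphere of $\mathbb R^d$, and $\mu_{\mathbb S^{d-1}}$ is the uniform (rotation invariant) probability measure on it. $\|x\|_{\ell_p^d}=(\sum_i|x_i|^p)^{1/p}$. The vector $a$ is a row vector ($1\times d$ matrix), and $a\cdot x$ is its product with the column vector $x$. Algorithm 1 (inputs: $m_\Phi,m_{\mathcal X}$, step size $\epsilon$, point evaluations of $f$): 1. Draw independently $\xi_1,\dots,\xi_{m_{\mathcal X}}\in\mathbb S^{d-1}$ according to $\mu_{\mathbb S^{d-1}}$, and (independently of these) an $m_\Phi\times d$ matrix $\Phi$ with independent entries equal to $+1/\sqrt{m_\Phi}$ or $-1/\sqrt{m_\Phi}$, each with probability $1/2$. Let $\varphi_1,\dots,\varphi_{m_\Phi}\in\mathbb R^d$ be the rows of $\Phi$ regarded as column vectors. Set $y_{ij}=\frac{f(\xi_j+\epsilon\varphi_i)-f(\xi_j)}{\epsilon}$ for $i=1,\dots,m_\Phi$, $j=1,\dots,m_{\mathcal X}$, and $y_j=(y_{1j},\dots,y_{m_\Phi j})^T$. 2. For each $j$ let $\hat x_j=\Delta(y_j)$ be a minimizer of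 $\|z\|_{\ell_1^d}$ over all $z\in\mathbb R^d$ with $\Phi z=y_j$. 3. Let $j_0$ be an index maximizing $\|\hat x_j\|_{\ell_2^d}$ over $j=1,\dots,m_{\mathcal X}$, and set $\hat a=\hat x_{j_0}^T/\|\hat x_{j_0}\|_{\ell_2^d}$ (a row vector). 4. Define $\hat g(y)=f(\hat a^Ty)$ and $\hat f(x)=\hat g(\hat a\cdot x)$, i.e. $\hat f(x)=f(\hat a^T\hat a\,x)$. The probability is with respect to the random draw of $\Phi$ and $\xi_1,\dots,\xi_{m_{\mathcal X}}$. (If the algorithm cannot be carried out because the constraint set in step 2 is empty or all $\hat x_j$ vanish, the outcome counts as a failure.) *)

theory Defs
  imports "HOL-Probability.Probability"
begin

text \<open>
  All constants of the theorem are chosen before the dimension d, so d has to be a bound variable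
  of type nat: a vector of R^d is an extensional function on \<open>{..<d}\<close>, and an m x d matrix
  is a function on pairs of indices.
\<close>

definition vectors :: "nat \<Rightarrow> (nat \<Rightarrow> real) set" where
  "vectors d = {..<d} \<rightarrow>\<^sub>E UNIV"

definition dot :: "nat \<Rightarrow> (nat \<Rightarrow> real) \<Rightarrow> (nat \<Rightarrow> real) \<Rightarrow> real" where
  "dot d x y = (\<Sum>i<d. x i * y i)"

definition lp_norm :: "nat \<Rightarrow> real \<Rightarrow> (nat \<Rightarrow> real) \<Rightarrow> real" where
  "lp_norm d p x = (\<Sum>i<d. \<bar>x i\<bar> powr p) powr (1 / p)"

definition euclidean_ball :: "nat \<Rightarrow> real \<Rightarrow> (nat \<Rightarrow> real) set" where
  "euclidean_ball d r = {x \<in> vectors d. lp_norm d 2 x \<le> r}"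

definition unit_sphere :: "nat \<Rightarrow> (nat \<Rightarrow> real) set" where
  "unit_sphere d = {x \<in> vectors d. lp_norm d 2 x = 1}"

text \<open>Extended-real valued, so that a bound on it really entails boundedness.\<close>

definition sup_norm :: "'a set \<Rightarrow> ('a \<Rightarrow> real) \<Rightarrow> ereal" where
  "sup_norm S h = (SUP x\<in>S. ereal \<bar>h x\<bar>)"

definition orthogonal_mat :: "nat \<Rightarrow> (nat \<times> nat \<Rightarrow> real) \<Rightarrow> bool" where
  "orthogonal_mat d U \<longleftrightarrow>
     (\<forall>i<d. \<forall>j<d. (\<Sum>k<d. U (i, k) * U (j, k)) = (if i = j then 1 else 0))"

text \<open>
  The rotation invariant Borel probability measure on the unit sphere of R^d.  Invariance is
  required under the full orthogonal group, which determines the measure for d = 1 as well.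
\<close>

definition uniform_sphere_measure :: "nat \<Rightarrow> (nat \<Rightarrow> real) measure \<Rightarrow> bool" where
  "uniform_sphere_measure d \<mu> \<longleftrightarrow>
     prob_space \<mu> \<and>
     sets \<mu> = sets (restrict_space (Pi\<^sub>M {..<d} (\<lambda>_. borel)) (unit_sphere d)) \<and>
     (\<forall>U. orthogonal_mat d U \<longrightarrow>
        distr \<mu> \<mu> (\<lambda>x. \<lambda>i\<in>{..<d}. \<Sum>k<d. U (i, k) * x k) = \<mu>)"

definition sign_matrix_pmf :: "nat \<Rightarrow> nat \<Rightarrow> (nat \<times> nat \<Rightarrow> real) pmf" where
  "sign_matrix_pmf m d =
     Pi_pmf ({..<m} \<times> {..<d}) 0 (\<lambda>_. pmf_of_set {1 / sqrt (real m), - 1 / sqrt (real m)})"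

definition draw_measure ::
  "nat \<Rightarrow> nat \<Rightarrow> nat \<Rightarrow> (nat \<Rightarrow> real) measure
     \<Rightarrow> ((nat \<times> nat \<Rightarrow> real) \<times> (nat \<Rightarrow> nat \<Rightarrow> real)) measure" where
  "draw_measure d m\<^sub>\<Phi> m\<^sub>X \<mu> =
     measure_pmf (sign_matrix_pmf m\<^sub>\<Phi> d) \<Otimes>\<^sub>M Pi\<^sub>M {..<m\<^sub>X} (\<lambda>_. \<mu>)"

text \<open>The point \<open>\<xi> + \<epsilon> \<phi>\<^sub>i\<close>, where \<open>\<phi>\<^sub>i\<close> is the i-th row of \<open>\<Phi>\<close>.\<close>

definition shifted_point ::
  "nat \<Rightarrow> real \<Rightarrow> (nat \<times> nat \<Rightarrow> real) \<Rightarrow> (nat \<Rightarrow> real) \<Rightarrow> nat \<Rightarrow> (nat \<Rightarrow> real)" where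
  "shifted_point d \<epsilon> \<Phi> x i = (\<lambda>k\<in>{..<d}. x k + \<epsilon> * \<Phi> (i, k))"

definition eval_points ::
  "nat \<Rightarrow> nat \<Rightarrow> nat \<Rightarrow> real \<Rightarrow> (nat \<times> nat \<Rightarrow> real) \<Rightarrow> (nat \<Rightarrow> nat \<Rightarrow> real)
     \<Rightarrow> (nat \<Rightarrow> real) list" where
  "eval_points d m\<^sub>\<Phi> m\<^sub>X \<epsilon> \<Phi> \<xi> =
     concat (map (\<lambda>j. \<xi> j # map (shifted_point d \<epsilon> \<Phi> (\<xi> j)) [0..<m\<^sub>\<Phi>]) [0..<m\<^sub>X])"

definition difference_quotient ::
  "nat \<Rightarrow> real \<Rightarrow> ((nat \<Rightarrow> real) \<Rightarrow> real) \<Rightarrow> (nat \<times> nat \<Rightarrow> real) \<Rightarrow> (nat \<Rightarrow> real) \<Rightarrow> nat \<Rightarrow> real"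
  where
  "difference_quotient d \<epsilon> f \<Phi> x i = (f (shifted_point d \<epsilon> \<Phi> x i) - f x) / \<epsilon>"

definition l1_minimizers ::
  "nat \<Rightarrow> nat \<Rightarrow> (nat \<times> nat \<Rightarrow> real) \<Rightarrow> (nat \<Rightarrow> real) \<Rightarrow> (nat \<Rightarrow> real) set" where
  "l1_minimizers d m \<Phi> y =
     (let F = {z \<in> vectors d. \<forall>i<m. (\<Sum>k<d. \<Phi> (i, k) * z k) = y i}
      in {z \<in> F. \<forall>w\<in>F. lp_norm d 1 z \<le> lp_norm d 1 w})"

text \<open>
  All vectors \<open>\<hat>a\<close> the algorithm may output on a given draw: the minimizers and the
  maximizing index need not be unique, and every choice is admitted.  A run that cannot be carried
  out contributes no vector.  All minimizers of one problem have the same l1-norm, so all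
  \<open>\<hat>x\<^sub>j\<close> vanish either for every choice or for none; hence the set is empty exactly
  if the algorithm fails on this draw.
\<close>

definition alg_directions ::
  "nat \<Rightarrow> nat \<Rightarrow> nat \<Rightarrow> real \<Rightarrow> ((nat \<Rightarrow> real) \<Rightarrow> real)
     \<Rightarrow> (nat \<times> nat \<Rightarrow> real) \<Rightarrow> (nat \<Rightarrow> nat \<Rightarrow> real) \<Rightarrow> (nat \<Rightarrow> real) set" where
  "alg_directions d m\<^sub>\<Phi> m\<^sub>X \<epsilon> f \<Phi> \<xi> =
     {ahat. \<exists>xhat j\<^sub>0.
        (\<forall>j<m\<^sub>X. xhat j \<in> l1_minimizers d m\<^sub>\<Phi> \<Phi> (difference_quotient d \<epsilon> f \<Phi> (\<xi> j))) \<and>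
        j\<^sub>0 < m\<^sub>X \<and> (\<forall>j<m\<^sub>X. lp_norm d 2 (xhat j) \<le> lp_norm d 2 (xhat j\<^sub>0)) \<and>
        lp_norm d 2 (xhat j\<^sub>0) \<noteq> 0 \<and>
        ahat = (\<lambda>i\<in>{..<d}. xhat j\<^sub>0 i / lp_norm d 2 (xhat j\<^sub>0))}"

definition ghat :: "nat \<Rightarrow> ((nat \<Rightarrow> real) \<Rightarrow> real) \<Rightarrow> (nat \<Rightarrow> real) \<Rightarrow> real \<Rightarrow> real" where
  "ghat d f ahat y = f (\<lambda>i\<in>{..<d}. ahat i * y)"

definition fhat ::
  "nat \<Rightarrow> ((nat \<Rightarrow> real) \<Rightarrow> real) \<Rightarrow> (nat \<Rightarrow> real) \<Rightarrow> (nat \<Rightarrow> real) \<Rightarrow> real" where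
  "fhat d f ahat x = ghat d f ahat (dot d ahat x)"

definition nu1 :: "real \<Rightarrow> real \<Rightarrow> nat \<Rightarrow> nat \<Rightarrow> real \<Rightarrow> real" where
  "nu1 C' q d m\<^sub>\<Phi> \<epsilon> =
     C' * ((real m\<^sub>\<Phi> / ln (real d / real m\<^sub>\<Phi>)) powr (1 / 2 - 1 / q) + \<epsilon> / sqrt (real m\<^sub>\<Phi>))"

end

theory Submission
  imports Defs "HOL-Real_Asymp.Real_Asymp"
begin

text \<open>
  By Taylor's formula the difference quotients at \<open>\<xi>\<close> are noisy measurements of the gradient
  $g'(a\cdot\xi)\,a$, with noise of size $O(\epsilon/m)$ in each coordinate.  Hoeffding's inequality
  gives a sample point with $|g'(a\cdot\xi)|^2\ge\alpha(1-s)$, and the angle between the recovered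
  gradient there and $a$ controls the error of $\hat f$; so everything rests on the stability of
  l1-minimization.  Two properties of the random matrix are needed for that.  The restricted
  isometry property bounds the Euclidean norm of a vector by that of its image and its l1-norm.
  The quotient property represents the noise as the image of a vector with l1-norm
  $O(\epsilon/\sqrt{\log(d/m)})$, which turns noisy minimization into exact minimization.

  For a noise vector r the quotient property is proved by weighting the columns X of the matrix with
  truncated Riesz products $\prod_i(1+\tau r_iX_i)$, $\tau^2$ a small multiple of $\log(d/m)/m$: they
  have mean 1 and reproduce \<open>\<tau> r\<close>, while their fourth moment is a small power of $d/m$, so that
  the empirical average concentrates uniformly over a net of r.  The remaining Euclidean error is
  absorbed by the smallest singular value of the transposed matrix.

  Both failure probabilities are $e^{-cm}$ for m beyond an absolute constant.  Bounded m need no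
  argument: a large \<open>C'\<close> makes the assumption $\nu_1<\sqrt{\alpha(1-s)}$ fail for them.
\<close>

subsection \<open>Averages over sign vectors\<close>

text \<open>Exact minimization must reproduce the noise, and the l1-norm of a noise representation
  enters the error divided by the square root of the sparsity level, which is of order m/ln(d/m).
  The smallest singular value alone gives a representation of l1-norm O(\<epsilon>); this would cost
  a factor sqrt(ln(d/m)) in the second term of \<open>nu1\<close>, which no constant absorbs. The
  Riesz products remove this factor. The condition ln d \<le> m keeps \<tau> at most 1, so that
  their factors are nonnegative; truncation keeps the weights below a small power of d/m, which the
  tail bounds need.

  The ratio d/m \<ge> 2, a consequence of (ln 6)^2 \<ge> 2, decides the smallest singular value: a
  net of (99/\<gamma>)^m vectors meets small ball probabilities (2403 \<gamma>)^d, so a factor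
  \<gamma>^m is left over.

  The random matrix is uniform on a finite set. Its probabilities are therefore counts, and each
  tail bound is a power of an average over one sign vector. The same matrix is read as m rows of
  length d for the isometry and as d columns of length m for the quotient property.\<close>

definition sign_vectors :: "nat \<Rightarrow> (nat \<Rightarrow> real) set" where
  "sign_vectors n = {..<n} \<rightarrow>\<^sub>E {1, -1}"

text \<open>The codomain is a general field because the averages of cosines are computed through
  complex exponentials.\<close>

definition sign_average :: "nat \<Rightarrow> ((nat \<Rightarrow> real) \<Rightarrow> 'a::real_normed_field) \<Rightarrow> 'a" where
  "sign_average n F = (\<Sum>x\<in>sign_vectors n. F x) / 2 ^ n"

lemma finite_sign_vectors [simp, intro]: "finite (sign_vectors n)"
  unfolding sign_vectors_def by (intro finite_PiE) auto

lemma card_sign_vectors: "card (sign_vectors n) = 2 ^ n"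
  unfolding sign_vectors_def by (subst card_PiE) (auto simp: numeral_2_eq_2)

lemma sign_vector_cases: "x \<in> sign_vectors n \<Longrightarrow> i < n \<Longrightarrow> x i = 1 \<or> x i = -1"
  unfolding sign_vectors_def by auto

lemma abs_sign_vector: "x \<in> sign_vectors n \<Longrightarrow> i < n \<Longrightarrow> \<bar>x i\<bar> = 1"
  using sign_vector_cases[of x n i] by auto

text \<open>Independence of the coordinates: a sum over a product set of a product of one-variable
  functions factorises.\<close>

lemma sign_average_prod:
  "sign_average n (\<lambda>x. \<Prod>i<n. F i (x i)) = (\<Prod>i<n. (F i 1 + F i (-1)) / 2)"
proof -
  have "(\<Sum>x\<in>sign_vectors n. \<Prod>i<n. F i (x i)) = (\<Prod>i<n. \<Sum>y\<in>{1,-1}. F i y)"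
    unfolding sign_vectors_def by (rule prod_sum_PiE[symmetric]) auto
  also have "\<dots> = (\<Prod>i<n. F i 1 + F i (-1))"
    by (intro prod.cong refl) simp
  finally show ?thesis
    unfolding sign_average_def by (simp add: prod_dividef)
qed

lemma sign_average_const [simp]: "sign_average n (\<lambda>x. c) = c"
  unfolding sign_average_def by (simp add: card_sign_vectors)

lemma sign_average_add: "sign_average n (\<lambda>x. F x + G x) = sign_average n F + sign_average n G"
  unfolding sign_average_def by (simp add: sum.distrib add_divide_distrib)

lemma sign_average_diff: "sign_average n (\<lambda>x. F x - G x) = sign_average n F - sign_average n G"
  unfolding sign_average_def by (simp add: sum_subtractf diff_divide_distrib)

lemma sign_average_cmult: "sign_average n (\<lambda>x. c * F x) = c * sign_average n F"
  unfolding sign_average_def by (simp add: sum_distrib_left)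

lemma sign_average_sum: "sign_average n (\<lambda>x. \<Sum>i\<in>A. F i x) = (\<Sum>i\<in>A. sign_average n (F i))"
  unfolding sign_average_def by (subst sum.swap) (simp add: sum_divide_distrib)

lemma sign_average_mono:
  fixes F G :: "(nat \<Rightarrow> real) \<Rightarrow> real"
  assumes "\<And>x. x \<in> sign_vectors n \<Longrightarrow> F x \<le> G x"
  shows "sign_average n F \<le> sign_average n G"
  unfolding sign_average_def using assms by (intro divide_right_mono sum_mono) auto

lemma sign_average_nonneg:
  fixes F :: "(nat \<Rightarrow> real) \<Rightarrow> real"
  assumes "\<And>x. x \<in> sign_vectors n \<Longrightarrow> 0 \<le> F x"
  shows "0 \<le> sign_average n F"
  using sign_average_mono[of n "\<lambda>_. 0" F] assms by simp

lemma sign_average_cong: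
  "(\<And>x. x \<in> sign_vectors n \<Longrightarrow> F x = G x) \<Longrightarrow> sign_average n F = sign_average n G"
  unfolding sign_average_def by simp

text \<open>Factorisation needs a multiplicative function, so \<open>cis\<close> is averaged in
  place of the cosine; the imaginary parts of \<open>cis t\<close> and \<open>cis (- t)\<close>
  cancel in every factor.\<close>

lemma sign_average_cos:
  fixes t :: "nat \<Rightarrow> real"
  shows "sign_average n (\<lambda>x. cos (\<Sum>i<n. t i * x i)) = (\<Prod>i<n. cos (t i))"
proof -
  have c: "cis (\<Sum>i\<in>I. u i) = (\<Prod>i\<in>I. cis (u i))" if "finite I" for u :: "nat \<Rightarrow> real" and I
    using that by (induction I rule: finite_induct) (auto simp: cis_mult[symmetric])
  have "sign_average n (\<lambda>x. cis (\<Sum>i<n. t i * x i)) = sign_average n (\<lambda>x. \<Prod>i<n. cis (t i * x i))"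
    by (intro sign_average_cong c) simp
  also have "\<dots> = (\<Prod>i<n. (cis (t i * 1) + cis (t i * (-1))) / 2)"
    by (rule sign_average_prod)
  also have "\<dots> = (\<Prod>i<n. complex_of_real (cos (t i)))"
    by (intro prod.cong refl) (simp add: complex_eq_iff)
  finally have "Re (sign_average n (\<lambda>x. cis (\<Sum>i<n. t i * x i))) = Re (complex_of_real (\<Prod>i<n. cos (t i)))"
    by simp
  moreover have "sign_average n (\<lambda>x. cis (\<Sum>i<n. t i * x i)) =
      (\<Sum>x\<in>sign_vectors n. cis (\<Sum>i<n. t i * x i)) / complex_of_real (2 ^ n)"
    unfolding sign_average_def by simp
  ultimately show ?thesis
    unfolding sign_average_def by (simp only: Re_divide_of_real Re_sum cis.sel Re_complex_of_real)
qed

text \<open>Subgaussian moment bound. It reduces to cosh u \<le> exp(u^2/2), which holds coefficient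
  by coefficient because 2^k k! \<le> (2k)!.\<close>

lemma sign_average_exp_le:
  fixes t :: "nat \<Rightarrow> real"
  shows "sign_average n (\<lambda>x. exp (\<Sum>i<n. t i * x i)) \<le> exp ((\<Sum>i<n. (t i)\<^sup>2) / 2)"
proof -
  have cosh_le: "(exp u + exp (- u)) / 2 \<le> exp (u\<^sup>2 / 2)" for u :: real
  proof -
    have s1: "(\<lambda>k. u ^ (2*k) / fact (2*k)) sums cosh u"
    proof -
      have "(\<lambda>k. (\<lambda>n. if even n then u ^ n /\<^sub>R fact n else 0) (2 * k)) sums cosh u"
        using cosh_converges[of u]
        by (subst sums_mono_reindex[of "\<lambda>k. 2 * k"]) (auto simp: strict_mono_def elim!: evenE)
      thus ?thesis by (simp add: field_simps)
    qed
    have s2: "(\<lambda>k. (u\<^sup>2/2) ^ k / fact k) sums exp (u\<^sup>2/2)"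
      using exp_converges[of "u\<^sup>2/2"] by (simp add: field_simps)
    have "u ^ (2*k) / fact (2*k) \<le> (u\<^sup>2/2) ^ k / fact k" for k
    proof -
      have "(2::real) ^ k * fact k \<le> fact (2 * k)"
      proof (induction k)
        case (Suc k)
        have "(2::real) ^ Suc k * fact (Suc k) = (2 * (real k + 1)) * (2 ^ k * fact k)"
          by (simp add: algebra_simps)
        also have "\<dots> \<le> (2 * (real k + 1)) * fact (2 * k)"
          using Suc by (intro mult_left_mono) auto
        also have "\<dots> \<le> (2 * (real k + 1)) * ((2 * real k + 1) * fact (2 * k))"
          by (intro mult_left_mono) (simp_all add: algebra_simps)
        also have "\<dots> = fact (2 * Suc k)"
          by (simp add: algebra_simps)
        finally show ?case .
      qed simp
      hence "(u\<^sup>2) ^ k / fact (2 * k) \<le> (u\<^sup>2) ^ k / (2 ^ k * fact k)"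
        by (intro divide_left_mono) auto
      thus ?thesis by (simp add: power_mult power_divide)
    qed
    from sums_le[OF this s1 s2] show ?thesis by (simp add: cosh_field_def)
  qed
  have "sign_average n (\<lambda>x. exp (\<Sum>i<n. t i * x i)) = sign_average n (\<lambda>x. \<Prod>i<n. exp (t i * x i))"
    by (simp add: exp_sum)
  also have "\<dots> = (\<Prod>i<n. (exp (t i * 1) + exp (t i * (-1))) / 2)"
    by (rule sign_average_prod)
  also have "\<dots> \<le> (\<Prod>i<n. exp ((t i)\<^sup>2 / 2))"
    using cosh_le by (intro prod_mono) (auto intro!: add_nonneg_nonneg)
  also have "\<dots> = exp ((\<Sum>i<n. (t i)\<^sup>2) / 2)"
    by (simp add: exp_sum[symmetric] sum_divide_distrib)
  finally show ?thesis .
qed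

section \<open>Gaussian integrals and the linearisation of squares\<close>

abbreviation std_gauss :: "real measure" where
  "std_gauss \<equiv> std_normal_distribution"

lemma gauss_integralI:
  assumes "has_bochner_integral lborel (\<lambda>g. std_normal_density g * F g) r" "F \<in> borel_measurable borel"
  shows "has_bochner_integral std_gauss F r"
  using assms by (intro has_bochner_integral_density) (auto simp: normal_density_nonneg)

text \<open>The integrand against the standard density is a multiple of the normal density with
  variance 1/(1 - b), so the value is its standard deviation.\<close>

lemma gauss_square_exp:
  fixes b :: real
  assumes "b < 1"
  shows "has_bochner_integral std_gauss (\<lambda>g. exp (b * g\<^sup>2 / 2)) (1 / sqrt (1 - b))"
proof (rule gauss_integralI)
  define \<sigma> where "\<sigma> = 1 / sqrt (1 - b)"
  have \<sigma>: "\<sigma> > 0" using assms by (simp add: \<sigma>_def)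
  have s2: "\<sigma>\<^sup>2 = 1 / (1 - b)" using assms by (simp add: \<sigma>_def power_divide)
  have "std_normal_density g * exp (b * g\<^sup>2 / 2) = \<sigma> * normal_density 0 \<sigma> g" for g
  proof -
    have "sqrt (2 * pi * \<sigma>\<^sup>2) = sqrt (2 * pi) * \<sigma>"
      using \<sigma> by (simp add: real_sqrt_mult)
    moreover have "- g\<^sup>2 / (2 * \<sigma>\<^sup>2) = - g\<^sup>2/2 + b * g\<^sup>2 / 2"
      unfolding s2 using assms by (simp add: field_simps)
    ultimately show ?thesis
      using \<sigma> by (simp add: normal_density_def exp_add[symmetric] mult.assoc field_simps del: exp_add)
  qed
  moreover have "has_bochner_integral lborel (\<lambda>g. \<sigma> * normal_density 0 \<sigma> g) (\<sigma> * 1)"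
    using \<sigma> by (intro has_bochner_integral_mult_right)
       (auto simp: has_bochner_integral_iff integral_normal_density)
  ultimately show "has_bochner_integral lborel (\<lambda>g. std_normal_density g * exp (b * g\<^sup>2 / 2)) (1 / sqrt (1 - b))"
    by (simp add: \<sigma>_def)
qed auto

lemma gauss_exp: "has_bochner_integral std_gauss (\<lambda>g. exp (t * g)) (exp (t\<^sup>2 / 2))"
proof (rule gauss_integralI)
  have "std_normal_density g * exp (t * g) = exp (t\<^sup>2/2) * normal_density t 1 g" for g
  proof -
    have "- g\<^sup>2 / 2 + t * g = t\<^sup>2/2 + - (g - t)\<^sup>2 / 2"
      by (simp add: power2_eq_square field_simps)
    hence "exp (- g\<^sup>2 / 2) * exp (t * g) = exp (t\<^sup>2/2) * exp (- (g - t)\<^sup>2 / 2)"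
      by (simp add: exp_add[symmetric] del: exp_add)
    thus ?thesis by (simp add: normal_density_def)
  qed
  moreover have "has_bochner_integral lborel (\<lambda>g. exp (t\<^sup>2/2) * normal_density t 1 g) (exp (t\<^sup>2/2) * 1)"
    by (intro has_bochner_integral_mult_right)
       (auto simp: has_bochner_integral_iff integral_normal_density)
  ultimately show "has_bochner_integral lborel (\<lambda>g. std_normal_density g * exp (t * g)) (exp (t\<^sup>2 / 2))"
    by simp
qed auto

lemma gauss_cos: "has_bochner_integral std_gauss (\<lambda>g. cos (t * g)) (exp (- t\<^sup>2 / 2))"
proof -
  interpret G: real_distribution std_gauss by (rule real_dist_normal_dist)
  have i: "complex_integrable std_gauss (\<lambda>x. iexp (t * x))"
    by (rule G.integrable_iexp) auto
  have "(\<integral>x. Re (iexp (t * x)) \<partial>std_gauss) = Re (char std_gauss t)"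
    unfolding char_def by (rule integral_Re[OF i])
  moreover have "integrable std_gauss (\<lambda>x. Re (iexp (t * x)))"
    using i by (rule integrable_Re)
  ultimately show ?thesis
    by (simp add: has_bochner_integral_iff char_std_normal_distribution Re_exp)
qed

lemma gauss_fourth: "has_bochner_integral std_gauss (\<lambda>g. g ^ 4) 3"
  using std_normal_distribution_even_moments[of 2]
  by (simp add: has_bochner_integral_iff fact_numeral)

lemma has_bochner_integral_sign_average:
  fixes F :: "(nat \<Rightarrow> real) \<Rightarrow> 'a \<Rightarrow> real"
  assumes "\<And>x. x \<in> sign_vectors n \<Longrightarrow> has_bochner_integral M (F x) (I x)"
  shows "has_bochner_integral M (\<lambda>g. sign_average n (\<lambda>x. F x g)) (sign_average n I)"
  unfolding sign_average_def
  using assms by (intro has_bochner_integral_divide has_bochner_integral_sum) auto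

lemma bochner_le:
  fixes F G :: "'a \<Rightarrow> real"
  assumes "has_bochner_integral M F a" "has_bochner_integral M G b" "\<And>x. F x \<le> G x"
  shows "a \<le> b"
  using assms integral_mono[of M F G] by (auto simp: has_bochner_integral_iff)

text \<open>With Z the linear form, exp(Z^2/4) is the Gaussian average of exp(g Z / sqrt 2). Inside
  that average the exponent is linear in the signs and the subgaussian bound applies; the remaining
  Gaussian integral equals sqrt 2.\<close>

lemma sign_average_exp_square_le:
  assumes "(\<Sum>i<n. (\<theta> i)\<^sup>2) \<le> 1"
  shows "sign_average n (\<lambda>x. exp ((\<Sum>i<n. \<theta> i * x i)\<^sup>2 / 4)) \<le> sqrt 2"
proof (rule bochner_le)
  let ?Z = "\<lambda>x. \<Sum>i<n. \<theta> i * x i"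
  have "has_bochner_integral std_gauss (\<lambda>g. exp ((?Z x / sqrt 2) * g)) (exp ((?Z x)\<^sup>2 / 4))" for x
    using gauss_exp[of "?Z x / sqrt 2"] by (simp add: power_divide)
  thus "has_bochner_integral std_gauss (\<lambda>g. sign_average n (\<lambda>x. exp ((?Z x / sqrt 2) * g)))
         (sign_average n (\<lambda>x. exp ((?Z x)\<^sup>2 / 4)))"
    by (intro has_bochner_integral_sign_average)
  show "has_bochner_integral std_gauss (\<lambda>g. exp ((1/2) * g\<^sup>2 / 2)) (sqrt 2)"
    using gauss_square_exp[of "1/2"] by (simp add: real_sqrt_divide)
  fix g :: real
  have "sign_average n (\<lambda>x. exp ((?Z x / sqrt 2) * g))
      = sign_average n (\<lambda>x. exp (\<Sum>i<n. (\<theta> i * g / sqrt 2) * x i))"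
    by (intro sign_average_cong arg_cong[where f = exp])
       (simp add: sum_distrib_left sum_distrib_right sum_divide_distrib mult_ac)
  also have "\<dots> \<le> exp ((\<Sum>i<n. (\<theta> i * g / sqrt 2)\<^sup>2) / 2)"
    by (rule sign_average_exp_le)
  also have "(\<Sum>i<n. (\<theta> i * g / sqrt 2)\<^sup>2) = (\<Sum>i<n. (\<theta> i)\<^sup>2) * (g\<^sup>2/2)"
    by (simp add: power_mult_distrib power_divide sum_distrib_right)
  also have "exp (\<dots> / 2) \<le> exp ((1/2) * g\<^sup>2 / 2)"
    using mult_right_mono[OF assms, of "g\<^sup>2/2"] by simp
  finally show "sign_average n (\<lambda>x. exp ((?Z x / sqrt 2) * g)) \<le> exp ((1/2) * g\<^sup>2 / 2)" .
qed

lemma abs_cos_le_exp: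
  assumes "\<bar>x\<bar> \<le> 1"
  shows "\<bar>cos x\<bar> \<le> exp (- x\<^sup>2 / 4 :: real)"
proof -
  have "pi / 2 > 1" using pi_gt3 by simp
  hence "0 \<le> cos x" using assms by (intro cos_ge_zero) auto
  moreover have "cos x \<le> 1 - x\<^sup>2 / 4"
  proof -
    obtain t where "cos x = (\<Sum>m<4. cos_coeff m * x ^ m) + (cos (t + 1/2 * real 4 * pi) / fact 4) * x ^ 4"
      using Maclaurin_cos_expansion[of x 4] by blast
    moreover have "(\<Sum>m<4. cos_coeff m * x ^ m) = 1 - x\<^sup>2 / 2"
    proof -
      have "{..<4} = {0, 1, 2, 3::nat}" by auto
      thus ?thesis by (simp add: cos_coeff_def fact_numeral)
    qed
    moreover have "(cos (t + 1/2 * real 4 * pi) / fact 4) * x ^ 4 \<le> (1 / fact 4) * x ^ 4"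
      by (intro mult_right_mono divide_right_mono) auto
    moreover have "x ^ 4 \<le> x\<^sup>2"
    proof -
      have "\<bar>x\<bar> ^ 4 \<le> \<bar>x\<bar>\<^sup>2"
        using assms by (intro power_decreasing) auto
      thus ?thesis by (simp add: power_even_abs)
    qed
    ultimately have "cos x \<le> 1 - x\<^sup>2 / 2 + x\<^sup>2 / 24" by (simp add: fact_numeral)
    thus ?thesis using zero_le_power2[of x] by linarith
  qed
  moreover have "1 - x\<^sup>2/4 \<le> exp (- x\<^sup>2 / 4)"
    using exp_ge_add_one_self[of "- x\<^sup>2/4"] by simp
  ultimately show ?thesis by linarith
qed

text \<open>
  Writing $e^{-\mu z^2}$ as a Gaussian average of cosines turns the sign average into a product;
  every cosine with a small coefficient contributes Gaussian decay, the others are dropped.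
\<close>

lemma sign_average_exp_neg_square_le:
  fixes \<theta> :: "nat \<Rightarrow> real"
  assumes "\<mu> > 0" "\<kappa> > 0" "\<rho> \<ge> 0" "\<rho>\<^sup>2 \<le> (\<Sum>i | i < n \<and> \<bar>\<theta> i\<bar> \<le> \<kappa>. (\<theta> i)\<^sup>2)"
  shows "sign_average n (\<lambda>x. exp (- \<mu> * (\<Sum>i<n. \<theta> i * x i)\<^sup>2))
           \<le> 1 / sqrt (1 + \<mu> * \<rho>\<^sup>2) + 12 * \<mu>\<^sup>2 * \<kappa> ^ 4"
proof (rule bochner_le)
  let ?Z = "\<lambda>x. \<Sum>i<n. \<theta> i * x i"
  \<comment> \<open>With this c the Gaussian average of cos(c Z g) is exp(- \<mu> Z^2).\<close>
  define c where "c = sqrt (2 * \<mu>)"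
  have c: "c > 0" "c\<^sup>2 = 2 * \<mu>" using assms by (auto simp: c_def)
  have c4: "c ^ 4 = 4 * \<mu>\<^sup>2"
    using arg_cong[OF c(2), of "\<lambda>x. x\<^sup>2"] by (simp add: power_mult_distrib)
  have "has_bochner_integral std_gauss (\<lambda>g. cos ((c * ?Z x) * g)) (exp (- \<mu> * (?Z x)\<^sup>2))" for x
    using gauss_cos[of "c * ?Z x"] by (simp add: power_mult_distrib c)
  thus "has_bochner_integral std_gauss (\<lambda>g. sign_average n (\<lambda>x. cos ((c * ?Z x) * g)))
         (sign_average n (\<lambda>x. exp (- \<mu> * (?Z x)\<^sup>2)))"
    by (intro has_bochner_integral_sign_average)
  have "has_bochner_integral std_gauss (\<lambda>g. exp ((- \<mu> * \<rho>\<^sup>2) * g\<^sup>2 / 2) + (c ^ 4 * \<kappa> ^ 4) * g ^ 4)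
          (1 / sqrt (1 - (- \<mu> * \<rho>\<^sup>2)) + (c ^ 4 * \<kappa> ^ 4) * 3)"
    using assms by (intro has_bochner_integral_add gauss_square_exp has_bochner_integral_mult_right gauss_fourth)
       (auto intro!: less_le_trans[of "- 1" 0 "\<mu> * \<rho>\<^sup>2"])
  thus "has_bochner_integral std_gauss (\<lambda>g. exp ((- \<mu> * \<rho>\<^sup>2) * g\<^sup>2 / 2) + (c ^ 4 * \<kappa> ^ 4) * g ^ 4)
      (1 / sqrt (1 + \<mu> * \<rho>\<^sup>2) + 12 * \<mu>\<^sup>2 * \<kappa> ^ 4)"
    by (simp add: c4 mult_ac)
  fix g :: real
  let ?S = "{i. i < n \<and> \<bar>\<theta> i\<bar> \<le> \<kappa>}"
  have "sign_average n (\<lambda>x. cos ((c * ?Z x) * g)) = sign_average n (\<lambda>x. cos (\<Sum>i<n. (c * g * \<theta> i) * x i))"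
    by (intro sign_average_cong arg_cong[where f = cos])
       (simp add: sum_distrib_left sum_distrib_right mult_ac)
  also have "\<dots> = (\<Prod>i<n. cos (c * g * \<theta> i))"
    by (rule sign_average_cos)
  also have "\<dots> \<le> (\<Prod>i<n. \<bar>cos (c * g * \<theta> i)\<bar>)"
    using abs_ge_self[of "\<Prod>i<n. cos (c * g * \<theta> i)"] by (simp add: abs_prod)
  finally have *: "sign_average n (\<lambda>x. cos ((c * ?Z x) * g)) \<le> (\<Prod>i<n. \<bar>cos (c * g * \<theta> i)\<bar>)" .
  show "sign_average n (\<lambda>x. cos ((c * ?Z x) * g)) \<le> exp ((- \<mu> * \<rho>\<^sup>2) * g\<^sup>2 / 2) + (c ^ 4 * \<kappa> ^ 4) * g ^ 4"
  \<comment> \<open>For large g the arguments of the cosines are no longer controlled. There the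
    product is bounded by 1 \<le> (c \<kappa> g)^4, and the fourth Gaussian moment 3 turns this into
    the term 12 \<mu>^2 \<kappa>^4.\<close>
  proof (cases "\<bar>c * \<kappa> * g\<bar> \<le> 1")
    case False
    have "(\<Prod>i<n. \<bar>cos (c * g * \<theta> i)\<bar>) \<le> 1"
      by (intro prod_le_1) auto
    also have "1 \<le> \<bar>c * \<kappa> * g\<bar> ^ 4"
      using False by (intro one_le_power) auto
    also have "\<dots> = (c ^ 4 * \<kappa> ^ 4) * g ^ 4"
      by (simp add: power_mult_distrib abs_mult power_even_abs)
    finally show ?thesis
      using * by (smt (verit) exp_ge_zero)
  next
    case True
    have "(\<Prod>i<n. \<bar>cos (c * g * \<theta> i)\<bar>) = (\<Prod>i\<in>?S. \<bar>cos (c * g * \<theta> i)\<bar>) * (\<Prod>i\<in>{..<n} - ?S. \<bar>cos (c * g * \<theta> i)\<bar>)"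
      by (subst prod.subset_diff[of ?S "{..<n}"]) (auto simp: mult.commute)
    also have "\<dots> \<le> (\<Prod>i\<in>?S. \<bar>cos (c * g * \<theta> i)\<bar>) * 1"
      by (intro mult_left_mono prod_le_1 prod_nonneg) auto
    also have "\<dots> \<le> (\<Prod>i\<in>?S. exp (- (c * g * \<theta> i)\<^sup>2 / 4))"
    proof -
      have "\<bar>c * g * \<theta> i\<bar> \<le> 1" if "i \<in> ?S" for i
      proof -
        have "\<bar>c * g * \<theta> i\<bar> = \<bar>c * g\<bar> * \<bar>\<theta> i\<bar>" by (simp add: abs_mult)
        also have "\<dots> \<le> \<bar>c * g\<bar> * \<kappa>" using that by (intro mult_left_mono) auto
        also have "\<dots> = \<bar>c * \<kappa> * g\<bar>" using assms(2) by (simp add: abs_mult)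
        finally show ?thesis using True by simp
      qed
      thus ?thesis unfolding mult_1_right by (intro prod_mono conjI abs_cos_le_exp) auto
    qed
    also have "\<dots> = exp (- (\<mu> * g\<^sup>2 / 2) * (\<Sum>i\<in>?S. (\<theta> i)\<^sup>2))"
      by (subst exp_sum[symmetric]) (auto simp: power_mult_distrib c sum_distrib_left intro!: sum.cong)
    also have "\<dots> \<le> exp (- (\<mu> * g\<^sup>2 / 2) * \<rho>\<^sup>2)"
      using assms by (auto intro!: mult_left_mono mult_nonneg_nonneg)
    also have "\<dots> = exp ((- \<mu> * \<rho>\<^sup>2) * g\<^sup>2 / 2)"
      by (simp add: mult_ac)
    finally show ?thesis using * by (smt (verit) zero_le_even_power even_numeral mult_nonneg_nonneg)
  qed
qed

section \<open>Counting probabilities for families of independent sign vectors\<close>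

definition sign_families :: "nat \<Rightarrow> nat \<Rightarrow> (nat \<Rightarrow> nat \<Rightarrow> real) set" where
  "sign_families N n = {..<N} \<rightarrow>\<^sub>E sign_vectors n"

text \<open>The denominator is the cardinality of \<open>sign_families N n\<close>, so this is the
  probability under the uniform distribution.\<close>

definition sign_prob :: "nat \<Rightarrow> nat \<Rightarrow> ((nat \<Rightarrow> nat \<Rightarrow> real) \<Rightarrow> bool) \<Rightarrow> real" where
  "sign_prob N n Q = real (card {\<omega> \<in> sign_families N n. Q \<omega>}) / 2 ^ (n * N)"

lemma finite_sign_families [simp, intro]: "finite (sign_families N n)"
  unfolding sign_families_def by (intro finite_PiE) auto

lemma sign_families_nth: "\<omega> \<in> sign_families N n \<Longrightarrow> j < N \<Longrightarrow> \<omega> j \<in> sign_vectors n"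
  unfolding sign_families_def by auto

lemma sign_prob_nonneg [simp]: "0 \<le> sign_prob N n Q"
  by (simp add: sign_prob_def)

lemma sign_prob_mono:
  assumes "\<And>\<omega>. \<omega> \<in> sign_families N n \<Longrightarrow> P \<omega> \<Longrightarrow> Q \<omega>"
  shows "sign_prob N n P \<le> sign_prob N n Q"
  unfolding sign_prob_def using assms
  by (intro divide_right_mono of_nat_mono card_mono) auto

lemma sign_prob_disj: "sign_prob N n (\<lambda>\<omega>. P \<omega> \<or> Q \<omega>) \<le> sign_prob N n P + sign_prob N n Q"
proof -
  have "{\<omega> \<in> sign_families N n. P \<omega> \<or> Q \<omega>} = {\<omega> \<in> sign_families N n. P \<omega>} \<union> {\<omega> \<in> sign_families N n. Q \<omega>}"
    by auto
  hence "card {\<omega> \<in> sign_families N n. P \<omega> \<or> Q \<omega>} \<le> card {\<omega> \<in> sign_families N n. P \<omega>} + card {\<omega> \<in> sign_families N n. Q \<omega>}"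
    by (simp add: card_Un_le)
  thus ?thesis
    unfolding sign_prob_def add_divide_distrib[symmetric] of_nat_add[symmetric]
    by (intro divide_right_mono of_nat_mono) auto
qed

lemma sign_prob_union:
  assumes "finite A" "\<And>z. z \<in> A \<Longrightarrow> sign_prob N n (Q z) \<le> b"
  shows "sign_prob N n (\<lambda>\<omega>. \<exists>z\<in>A. Q z \<omega>) \<le> real (card A) * b"
  using assms
proof (induction A rule: finite_induct)
  case empty
  show ?case by (simp add: sign_prob_def)
next
  case (insert z A)
  have "sign_prob N n (\<lambda>\<omega>. \<exists>z\<in>insert z A. Q z \<omega>) = sign_prob N n (\<lambda>\<omega>. Q z \<omega> \<or> (\<exists>z\<in>A. Q z \<omega>))"
    by simp
  also have "\<dots> \<le> sign_prob N n (Q z) + sign_prob N n (\<lambda>\<omega>. \<exists>z\<in>A. Q z \<omega>)"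
    by (rule sign_prob_disj)
  also have "\<dots> \<le> b + real (card A) * b"
    using insert by (intro add_mono) auto
  finally show ?case using insert by (simp add: algebra_simps)
qed

text \<open>The tail bounds hold only for net points of controlled norm. The filter \<open>P\<close>
  exempts the other points while the full net is still counted.\<close>

lemma sign_prob_union_if:
  assumes "finite A" "0 \<le> b" "\<And>z. z \<in> A \<Longrightarrow> P z \<Longrightarrow> sign_prob N n (Q z) \<le> b"
  shows "sign_prob N n (\<lambda>\<omega>. \<exists>z\<in>A. P z \<and> Q z \<omega>) \<le> real (card A) * b"
proof (rule sign_prob_union[OF assms(1)])
  fix z assume "z \<in> A"
  thus "sign_prob N n (\<lambda>\<omega>. P z \<and> Q z \<omega>) \<le> b"
    using assms(2,3) by (cases "P z") (simp_all add: sign_prob_def)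
qed

text \<open>Exponential Markov inequality: the product dominates the indicator of \<open>Q\<close>,
  and its average over independent vectors is a power.\<close>

lemma sign_prob_le_power:
  assumes "\<And>x. x \<in> sign_vectors n \<Longrightarrow> 0 \<le> F x"
  assumes "\<And>\<omega>. \<omega> \<in> sign_families N n \<Longrightarrow> Q \<omega> \<Longrightarrow> 1 \<le> (\<Prod>j<N. F (\<omega> j))"
  shows "sign_prob N n Q \<le> sign_average n F ^ N"
proof -
  have "real (card {\<omega> \<in> sign_families N n. Q \<omega>}) = (\<Sum>\<omega> | \<omega> \<in> sign_families N n \<and> Q \<omega>. 1)"
    by simp
  also have "\<dots> \<le> (\<Sum>\<omega> | \<omega> \<in> sign_families N n \<and> Q \<omega>. \<Prod>j<N. F (\<omega> j))"
    using assms(2) by (intro sum_mono) auto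
  also have "\<dots> \<le> (\<Sum>\<omega>\<in>sign_families N n. \<Prod>j<N. F (\<omega> j))"
    using assms(1) by (intro sum_mono2) (auto intro!: prod_nonneg dest: sign_families_nth)
  also have "\<dots> = (\<Prod>j<N. \<Sum>x\<in>sign_vectors n. F x)"
    unfolding sign_families_def by (rule prod_sum_PiE[symmetric]) auto
  also have "\<dots> = (\<Sum>x\<in>sign_vectors n. F x) ^ N"
    by simp
  finally have "sign_prob N n Q \<le> (\<Sum>x\<in>sign_vectors n. F x) ^ N / 2 ^ (n * N)"
    unfolding sign_prob_def by (intro divide_right_mono) auto
  also have "\<dots> = sign_average n F ^ N"
    by (simp add: sign_average_def power_divide power_mult)
  finally show ?thesis .
qed

subsection \<open>Integer points in cross-polytopes\<close>

text \<open>Scaled copies of these sets are the nets. A k-sparse vector in the Euclidean unit ball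
  has l1-norm at most sqrt k, so a single l1 constraint covers all supports at once.\<close>

definition int_vectors :: "nat \<Rightarrow> real \<Rightarrow> (nat \<Rightarrow> int) set" where
  "int_vectors n L = {z \<in> {..<n} \<rightarrow>\<^sub>E UNIV. (\<Sum>i<n. \<bar>real_of_int (z i)\<bar>) \<le> L}"

lemma sum_geometric_int:
  fixes q :: real
  assumes "0 < q" "q < 1"
  shows "(\<Sum>k\<in>{- int M..int M}. q ^ nat \<bar>k\<bar>) \<le> (1 + q) / (1 - q)"
proof -
  have "(\<Sum>k\<in>{- int M..int M}. q ^ nat \<bar>k\<bar>) = (1 + q - 2 * q ^ Suc M) / (1 - q)"
  proof (induction M)
    case (Suc M)
    define a where "a = int M"
    have a: "a \<ge> 0" "int (Suc M) = a + 1" "int M = a" by (simp_all add: a_def)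
    have "{- (a + 1)..a + 1} = insert (- (a + 1)) (insert (a + 1) {- a..a})"
      using a(1) by auto
    moreover have "- (a + 1) \<notin> insert (a + 1) {- a..a}" "a + 1 \<notin> {- a..a}"
      using a(1) by auto
    ultimately have "(\<Sum>k\<in>{- (a + 1)..a + 1}. q ^ nat \<bar>k\<bar>) =
        q ^ nat \<bar>- (a + 1)\<bar> + (q ^ nat \<bar>a + 1\<bar> + (\<Sum>k\<in>{- a..a}. q ^ nat \<bar>k\<bar>))"
      by (simp only: sum.insert finite_insert finite_atLeastAtMost_int not_False_eq_True)
    hence "(\<Sum>k\<in>{- int (Suc M)..int (Suc M)}. q ^ nat \<bar>k\<bar>)
        = q ^ nat \<bar>- int (Suc M)\<bar> + (q ^ nat \<bar>int (Suc M)\<bar> + (\<Sum>k\<in>{- int M..int M}. q ^ nat \<bar>k\<bar>))"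
      unfolding a .
    also have "\<dots> = 2 * q ^ Suc M + (1 + q - 2 * q ^ Suc M) / (1 - q)"
      unfolding Suc by (simp only: abs_minus_cancel abs_of_nat nat_int)
    also have "\<dots> = (2 * q ^ Suc M * (1 - q) + (1 + q - 2 * q ^ Suc M)) / (1 - q)"
      using assms by (simp add: add_divide_distrib)
    also have "2 * q ^ Suc M * (1 - q) + (1 + q - 2 * q ^ Suc M) = 1 + q - 2 * q ^ Suc (Suc M)"
      by (simp add: algebra_simps)
    finally show ?case .
  qed (use assms in simp)
  also have "\<dots> \<le> (1 + q) / (1 - q)"
    using assms by (intro divide_right_mono) auto
  finally show ?thesis .
qed

lemma int_vectors_subset: "int_vectors n L \<subseteq> {..<n} \<rightarrow>\<^sub>E {- int (nat \<lfloor>L\<rfloor>)..int (nat \<lfloor>L\<rfloor>)}"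
proof
  fix z assume z: "z \<in> int_vectors n L"
  have "\<bar>z i\<bar> \<le> int (nat \<lfloor>L\<rfloor>)" if "i < n" for i
  proof -
    have "\<bar>real_of_int (z i)\<bar> \<le> (\<Sum>i<n. \<bar>real_of_int (z i)\<bar>)"
      using that by (intro member_le_sum) auto
    hence "\<bar>real_of_int (z i)\<bar> \<le> L" using z by (simp add: int_vectors_def)
    hence "\<bar>z i\<bar> \<le> \<lfloor>L\<rfloor>" by linarith
    thus ?thesis by linarith
  qed
  thus "z \<in> {..<n} \<rightarrow>\<^sub>E {- int (nat \<lfloor>L\<rfloor>)..int (nat \<lfloor>L\<rfloor>)}"
  proof (intro PiE_I)
    show "z i = undefined" if "i \<notin> {..<n}" for i
      using z that by (auto simp: int_vectors_def PiE_def extensional_def)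
    show "z i \<in> {- int (nat \<lfloor>L\<rfloor>)..int (nat \<lfloor>L\<rfloor>)}" if "i \<in> {..<n}" for i
      using \<open>\<And>i. i < n \<Longrightarrow> \<bar>z i\<bar> \<le> int (nat \<lfloor>L\<rfloor>)\<close>[of i] that
      unfolding lessThan_iff abs_le_iff atLeastAtMost_iff by linarith
  qed
qed

lemma finite_int_vectors [simp, intro]: "finite (int_vectors n L)"
  by (rule finite_subset[OF int_vectors_subset]) (auto intro!: finite_PiE)

text \<open>Each point is given the weight exp(s (L - |z|)) \<ge> 1, with |z| its l1-norm; the total
  weight is a product of geometric series. The parameter s is free, and callers choose it to balance
  the two factors.\<close>

lemma card_int_vectors:
  assumes "s > 0"
  shows "real (card (int_vectors n L)) \<le> exp (s * L) * (1 + 2 / (exp s - 1)) ^ n"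
proof -
  define q where "q = exp (- s)"
  have q: "0 < q" "q < 1" using assms by (auto simp: q_def)
  let ?B = "{- int (nat \<lfloor>L\<rfloor>)..int (nat \<lfloor>L\<rfloor>)}"
  have "real (card (int_vectors n L)) = (\<Sum>z\<in>int_vectors n L. 1)" by simp
  also have "\<dots> \<le> (\<Sum>z\<in>int_vectors n L. exp (s * L) * (\<Prod>i<n. q ^ nat \<bar>z i\<bar>))"
  proof (intro sum_mono)
    fix z assume "z \<in> int_vectors n L"
    hence "(\<Sum>i<n. \<bar>real_of_int (z i)\<bar>) \<le> L" by (simp add: int_vectors_def)
    hence "s * (\<Sum>i<n. \<bar>real_of_int (z i)\<bar>) \<le> s * L" using assms by (intro mult_left_mono) auto
    hence "1 \<le> exp (s * L + (\<Sum>i<n. - s * \<bar>real_of_int (z i)\<bar>))"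
      by (simp add: sum_distrib_left sum_negf)
    also have "\<dots> = exp (s * L) * (\<Prod>i<n. q ^ nat \<bar>z i\<bar>)"
      unfolding exp_add by (simp add: exp_sum q_def exp_of_nat_mult[symmetric] mult.commute)
    finally show "1 \<le> exp (s * L) * (\<Prod>i<n. q ^ nat \<bar>z i\<bar>)" .
  qed
  also have "\<dots> \<le> (\<Sum>z\<in>{..<n} \<rightarrow>\<^sub>E ?B. exp (s * L) * (\<Prod>i<n. q ^ nat \<bar>z i\<bar>))"
    using q by (intro sum_mono2 int_vectors_subset finite_PiE mult_nonneg_nonneg prod_nonneg) auto
  also have "\<dots> = exp (s * L) * (\<Prod>i<n. \<Sum>k\<in>?B. q ^ nat \<bar>k\<bar>)"
    by (subst prod_sum_PiE) (auto simp: sum_distrib_left)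
  also have "\<dots> \<le> exp (s * L) * (\<Prod>i<n. 1 + 2 / (exp s - 1))"
  proof (intro mult_left_mono prod_mono conjI)
    have "(\<Sum>k\<in>?B. q ^ nat \<bar>k\<bar>) \<le> (1 + q) / (1 - q)"
      by (rule sum_geometric_int) (use q in auto)
    also have "\<dots> = 1 + 2 / (exp s - 1)"
      using assms by (simp add: q_def exp_minus field_simps)
    finally show "(\<Sum>k\<in>?B. q ^ nat \<bar>k\<bar>) \<le> 1 + 2 / (exp s - 1)" .
  qed (use q in \<open>auto intro!: sum_nonneg\<close>)
  finally show ?thesis by simp
qed

lemma card_int_vectors_exp:
  assumes "s > 0"
  shows "real (card (int_vectors n L)) \<le> exp (s * L + 2 * real n / (exp s - 1))"
proof -
  have "real (card (int_vectors n L)) \<le> exp (s * L) * (1 + 2 / (exp s - 1)) ^ n"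
    by (rule card_int_vectors[OF assms])
  also have "\<dots> \<le> exp (s * L) * exp (2 / (exp s - 1)) ^ n"
    using assms by (intro mult_left_mono power_mono exp_ge_add_one_self) (auto intro!: add_nonneg_nonneg)
  also have "\<dots> = exp (s * L + 2 * real n / (exp s - 1))"
    unfolding exp_add by (simp add: exp_of_nat_mult[symmetric] mult_ac)
  finally show ?thesis .
qed

lemma card_int_vectors_double: "real (card (int_vectors m (2 * real m))) \<le> exp (4 * real m)"
proof -
  have e: "exp 1 - 1 \<ge> (1 :: real)" using exp_ge_add_one_self[of "1::real"] by linarith
  have "real (card (int_vectors m (2 * real m))) \<le> exp (1 * (2 * real m) + 2 * real m / (exp 1 - 1))"
    by (rule card_int_vectors_exp) simp
  also have "2 * real m / (exp 1 - 1) \<le> 2 * real m / 1"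
    using e by (intro divide_left_mono) auto
  finally show ?thesis by simp
qed

section \<open>Rounding sparse vectors to lattice points\<close>

lemma sum_abs_le_L2_set:
  assumes "finite A"
  shows "(\<Sum>i\<in>A. \<bar>x i\<bar>) \<le> sqrt (real (card A)) * L2_set x A"
  using L2_set_mult_ineq[of x "\<lambda>_. 1" A] by (simp add: L2_set_def mult.commute)

definition sparse :: "nat \<Rightarrow> nat \<Rightarrow> (nat \<Rightarrow> real) \<Rightarrow> bool" where
  "sparse n k x \<longleftrightarrow> card {i. i < n \<and> x i \<noteq> 0} \<le> k"

lemma sparse_self: "sparse n n x"
  unfolding sparse_def using card_mono[of "{..<n}" "{i. i < n \<and> x i \<noteq> 0}"] by auto

lemma sparse_subset:
  assumes "sparse n k x" "\<And>i. i < n \<Longrightarrow> x i = 0 \<Longrightarrow> y i = 0"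
  shows "sparse n k y"
  unfolding sparse_def
  by (rule order_trans[OF card_mono assms(1)[unfolded sparse_def]]) (use assms(2) in auto)

text \<open>Coordinates are rounded towards zero, so neither the support nor any absolute value
  grows. The mesh \<delta> / sqrt k makes k coordinate errors of at most one mesh add up to \<delta>
  in Euclidean norm.\<close>

lemma rounding_net:
  assumes "sparse n k x" "1 \<le> k" "\<delta> > 0" "L2_set x {..<n} \<le> 1"
  obtains z where "z \<in> int_vectors n (real k / \<delta>)"
    "\<And>i. i < n \<Longrightarrow> \<bar>\<delta> / sqrt (real k) * z i\<bar> \<le> \<bar>x i\<bar>"
    "\<And>i. i < n \<Longrightarrow> x i = 0 \<Longrightarrow> z i = 0"
    "L2_set (\<lambda>i. x i - \<delta> / sqrt (real k) * z i) {..<n} \<le> \<delta>"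
proof -
  define c where "c = \<delta> / sqrt (real k)"
  have c: "c > 0" using assms by (simp add: c_def)
  let ?S = "{i. i < n \<and> x i \<noteq> 0}"
  define z where "z = (\<lambda>i\<in>{..<n}. if x i \<ge> 0 then \<lfloor>x i / c\<rfloor> else \<lceil>x i / c\<rceil>)"
  have z1: "\<bar>real_of_int (z i)\<bar> \<le> \<bar>x i\<bar> / c" if "i < n" for i
  proof (cases "x i \<ge> 0")
    case True
    hence "0 \<le> x i / c" using c by simp
    moreover have "z i = \<lfloor>x i / c\<rfloor>" using True that by (simp add: z_def)
    ultimately show ?thesis using True by simp
  next
    case False
    hence "x i / c \<le> 0" using c by (simp add: divide_le_0_iff)
    moreover have "z i = \<lceil>x i / c\<rceil>" using False that by (simp add: z_def)
    moreover have "\<lceil>x i / c\<rceil> \<le> 0" using \<open>x i / c \<le> 0\<close> by simp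
    hence "\<bar>real_of_int \<lceil>x i / c\<rceil>\<bar> = - real_of_int \<lceil>x i / c\<rceil>" by simp
    moreover have "- real_of_int \<lceil>x i / c\<rceil> \<le> - (x i / c)" by simp
    moreover have "\<bar>x i\<bar> / c = - (x i / c)" using False by simp
    ultimately show ?thesis by linarith
  qed
  have z2: "\<bar>x i - c * z i\<bar> \<le> c" if "i < n" for i
  proof -
    have "\<bar>x i / c - z i\<bar> \<le> 1"
      using that by (auto simp: z_def) linarith+
    hence "c * \<bar>x i / c - z i\<bar> \<le> c * 1" using c by (intro mult_left_mono) auto
    also have "c * \<bar>x i / c - z i\<bar> = \<bar>x i - c * z i\<bar>"
      using c by (subst abs_of_pos[OF c, symmetric], subst abs_mult[symmetric]) (simp add: right_diff_distrib)
    finally show ?thesis by simp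
  qed
  have z0: "z i = 0" if "i < n" "x i = 0" for i
    using that by (simp add: z_def)
  have cS: "real (card ?S) \<le> real k" using assms(1) by (simp add: sparse_def)
  have "(\<Sum>i<n. \<bar>real_of_int (z i)\<bar>) \<le> (\<Sum>i<n. \<bar>x i\<bar> / c)"
    using z1 by (intro sum_mono) auto
  also have "\<dots> = (\<Sum>i\<in>?S. \<bar>x i\<bar>) / c"
    unfolding sum_divide_distrib by (intro sum.mono_neutral_right) auto
  also have "(\<Sum>i\<in>?S. \<bar>x i\<bar>) \<le> sqrt (real (card ?S)) * L2_set x ?S"
    by (rule sum_abs_le_L2_set) auto
  also have "\<dots> \<le> sqrt (real k) * 1"
  proof (intro mult_mono)
    have "L2_set x ?S \<le> L2_set x {..<n}"
      unfolding L2_set_def by (intro real_sqrt_le_mono sum_mono2) auto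
    thus "L2_set x ?S \<le> 1" using assms by simp
  qed (use cS in auto)
  finally have "(\<Sum>i<n. \<bar>real_of_int (z i)\<bar>) \<le> sqrt (real k) * 1 / c"
    using c by (auto simp: divide_right_mono)
  also have "\<dots> = real k / \<delta>"
    using assms by (simp add: c_def field_simps)
  finally have "z \<in> int_vectors n (real k / \<delta>)"
    by (simp add: int_vectors_def z_def)
  moreover have "\<bar>\<delta> / sqrt (real k) * z i\<bar> \<le> \<bar>x i\<bar>" if "i < n" for i
    using z1[OF that] c unfolding c_def[symmetric] by (simp add: abs_mult field_simps)
  moreover have "L2_set (\<lambda>i. x i - \<delta> / sqrt (real k) * z i) {..<n} \<le> \<delta>"
  proof -
    have "(\<Sum>i<n. (x i - c * z i)\<^sup>2) = (\<Sum>i\<in>?S. (x i - c * z i)\<^sup>2)"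
      by (intro sum.mono_neutral_right) (auto simp: z0)
    also have "\<dots> \<le> (\<Sum>i\<in>?S. c\<^sup>2)"
    proof (intro sum_mono)
      fix i assume "i \<in> ?S"
      hence "\<bar>x i - c * z i\<bar> \<le> \<bar>c\<bar>" using z2[of i] c by auto
      thus "(x i - c * z i)\<^sup>2 \<le> c\<^sup>2" by (simp add: abs_le_square_iff)
    qed
    also have "\<dots> \<le> real k * c\<^sup>2" using cS by (simp add: mult_right_mono)
    also have "\<dots> = \<delta>\<^sup>2" using assms by (simp add: c_def power_divide)
    finally show ?thesis
      unfolding L2_set_def c_def[symmetric] using assms by (simp add: real_le_lsqrt)
  qed
  ultimately show ?thesis using that z0 by blast
qed

subsection \<open>Sign families acting on sparse vectors\<close>

definition action_norm :: "nat \<Rightarrow> nat \<Rightarrow> (nat \<Rightarrow> nat \<Rightarrow> real) \<Rightarrow> (nat \<Rightarrow> real) \<Rightarrow> real" where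
  "action_norm N n \<omega> x = L2_set (\<lambda>j. dot n (\<omega> j) x) {..<N}"

lemma dot_add_right: "dot n w (\<lambda>i. x i + y i) = dot n w x + dot n w y"
  by (simp add: dot_def algebra_simps sum.distrib)

lemma dot_diff_right: "dot n w (\<lambda>i. x i - y i) = dot n w x - dot n w y"
  by (simp add: dot_def algebra_simps sum_subtractf)

lemma dot_scale_right: "dot n w (\<lambda>i. c * x i) = c * dot n w x"
  by (simp add: dot_def sum_distrib_left mult_ac)

lemma dot_commute: "dot n x y = dot n y x"
  by (simp add: dot_def mult.commute)

lemma dot_cong: "(\<And>i. i < n \<Longrightarrow> x i = x' i) \<Longrightarrow> (\<And>i. i < n \<Longrightarrow> y i = y' i) \<Longrightarrow> dot n x y = dot n x' y'"
  by (simp add: dot_def)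

lemma abs_dot_le: "\<bar>dot n x y\<bar> \<le> L2_set x {..<n} * L2_set y {..<n}"
proof -
  have "\<bar>dot n x y\<bar> \<le> (\<Sum>i<n. \<bar>x i\<bar> * \<bar>y i\<bar>)"
    unfolding dot_def using sum_abs[of "\<lambda>i. x i * y i" "{..<n}"] by (simp add: abs_mult)
  also have "\<dots> \<le> L2_set x {..<n} * L2_set y {..<n}" by (rule L2_set_mult_ineq)
  finally show ?thesis .
qed

lemma L2_set_scale: "L2_set (\<lambda>i. c * x i) A = \<bar>c\<bar> * L2_set x A"
  by (simp add: L2_set_def power_mult_distrib sum_distrib_left[symmetric] real_sqrt_mult)

lemma L2_set_le_abs:
  assumes "\<And>i. i \<in> A \<Longrightarrow> \<bar>x i\<bar> \<le> \<bar>y i\<bar>"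
  shows "L2_set x A \<le> L2_set y A"
  unfolding L2_set_def using assms by (intro real_sqrt_le_mono sum_mono) (simp add: abs_le_square_iff)

lemma L2_set_sign_vector: "x \<in> sign_vectors n \<Longrightarrow> L2_set x {..<n} = sqrt (real n)"
proof -
  assume x: "x \<in> sign_vectors n"
  have "(\<Sum>i<n. (x i)\<^sup>2) = (\<Sum>i<n. 1)"
    using sign_vector_cases[OF x] by (intro sum.cong refl) force
  thus ?thesis by (simp add: L2_set_def)
qed

lemma action_norm_nonneg [simp]: "0 \<le> action_norm N n \<omega> x"
  by (simp add: action_norm_def)

lemma action_norm_triangle:
  "action_norm N n \<omega> (\<lambda>i. x i + y i) \<le> action_norm N n \<omega> x + action_norm N n \<omega> y"
  unfolding action_norm_def dot_add_right by (rule L2_set_triangle_ineq)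

lemma action_norm_scale: "action_norm N n \<omega> (\<lambda>i. c * x i) = \<bar>c\<bar> * action_norm N n \<omega> x"
  unfolding action_norm_def dot_scale_right by (rule L2_set_scale)

lemma action_norm_cong: "(\<And>i. i < n \<Longrightarrow> x i = y i) \<Longrightarrow> action_norm N n \<omega> x = action_norm N n \<omega> y"
  unfolding action_norm_def dot_def by simp

lemma action_norm_minus: "action_norm N n \<omega> (\<lambda>i. x i - y i) = action_norm N n \<omega> (\<lambda>i. y i - x i)"
  using action_norm_scale[of N n \<omega> "-1" "\<lambda>i. x i - y i"] by (simp add: algebra_simps)

lemma action_norm_split:
  "action_norm N n \<omega> x \<le> action_norm N n \<omega> y + action_norm N n \<omega> (\<lambda>i. x i - y i)"
  using action_norm_triangle[of N n \<omega> y "\<lambda>i. x i - y i"] by simp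

text \<open>Valid for every family, without any probability. It serves to make the remainder of an
  iteration tend to zero.\<close>

lemma action_norm_crude:
  assumes "\<omega> \<in> sign_families N n"
  shows "action_norm N n \<omega> x \<le> sqrt (real N) * (sqrt (real n) * L2_set x {..<n})"
proof -
  have "action_norm N n \<omega> x = sqrt (\<Sum>j<N. (dot n (\<omega> j) x)\<^sup>2)"
    by (simp add: action_norm_def L2_set_def)
  also have "\<dots> \<le> sqrt (\<Sum>j<N. (sqrt (real n) * L2_set x {..<n})\<^sup>2)"
  proof (intro real_sqrt_le_mono sum_mono)
    fix j assume "j \<in> {..<N}"
    hence "L2_set (\<omega> j) {..<n} = sqrt (real n)"
      using assms by (auto intro!: L2_set_sign_vector dest: sign_families_nth)
    hence "\<bar>dot n (\<omega> j) x\<bar> \<le> sqrt (real n) * L2_set x {..<n}"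
      using abs_dot_le[of n "\<omega> j" x] by simp
    thus "(dot n (\<omega> j) x)\<^sup>2 \<le> (sqrt (real n) * L2_set x {..<n})\<^sup>2"
      by (intro power2_le_iff_abs_le[THEN iffD2]) auto
  qed
  also have "\<dots> = sqrt (real N) * (sqrt (real n) * L2_set x {..<n})"
    by (simp add: real_sqrt_mult real_sqrt_abs abs_mult)
  finally show ?thesis .
qed

text \<open>Exponential moment of the squares at rate 1/4: the threshold 16 N contributes exp(-4)
  per row, and sqrt 2 \<le> e leaves exp(-3).\<close>

lemma action_upper_fixed:
  assumes "L2_set y {..<n} \<le> 1"
  shows "sign_prob N n (\<lambda>\<omega>. action_norm N n \<omega> y > 4 * sqrt (real N)) \<le> exp (- 3 * real N)"
proof -
  have y: "(\<Sum>i<n. (y i)\<^sup>2) \<le> 1" using assms by (simp add: L2_set_def)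
  let ?F = "\<lambda>x. exp (- 4) * exp ((\<Sum>i<n. y i * x i)\<^sup>2 / 4)"
  have "sign_prob N n (\<lambda>\<omega>. action_norm N n \<omega> y > 4 * sqrt (real N)) \<le> sign_average n ?F ^ N"
  proof (rule sign_prob_le_power)
    fix \<omega> assume "action_norm N n \<omega> y > 4 * sqrt (real N)"
    hence "(4 * sqrt (real N))\<^sup>2 < (action_norm N n \<omega> y)\<^sup>2"
      by (intro power_strict_mono) auto
    also have "(action_norm N n \<omega> y)\<^sup>2 = (\<Sum>j<N. (\<Sum>i<n. y i * \<omega> j i)\<^sup>2)"
      unfolding action_norm_def L2_set_def by (simp add: sum_nonneg dot_def mult.commute)
    finally have "0 \<le> (\<Sum>j<N. - 4 + (\<Sum>i<n. y i * \<omega> j i)\<^sup>2 / 4)"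
      by (simp add: power_mult_distrib sum_subtractf sum_divide_distrib[symmetric])
    hence "1 \<le> exp (\<Sum>j<N. - 4 + (\<Sum>i<n. y i * \<omega> j i)\<^sup>2 / 4)" by simp
    thus "1 \<le> (\<Prod>j<N. ?F (\<omega> j))"
      unfolding exp_sum[OF finite_lessThan] exp_add .
  qed auto
  also have "\<dots> \<le> (exp (- 4) * exp 1) ^ N"
  proof (intro power_mono)
    have "sign_average n (\<lambda>x. exp ((\<Sum>i<n. y i * x i)\<^sup>2 / 4)) \<le> sqrt 2"
      by (rule sign_average_exp_square_le[OF y])
    also have "\<dots> \<le> 2" by (rule real_le_lsqrt) auto
    also have "\<dots> \<le> exp 1" using exp_ge_add_one_self[of 1] by simp
    finally show "sign_average n ?F \<le> exp (- 4) * exp 1"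
      by (subst sign_average_cmult) auto
  qed (auto intro!: sign_average_nonneg)
  also have "\<dots> = exp (- 3 * real N)"
    by (simp add: exp_add[symmetric] exp_of_nat_mult[symmetric] mult.commute del: exp_add)
  finally show ?thesis .
qed

text \<open>Laplace transform at \<mu> = 1/200. All coordinates are at most \<kappa> = 1, so no
  cosine is dropped. The gain of the first term is about \<mu>/8 and has to outweigh the error 12
  \<mu>^2, which forces \<mu> to be small. The threshold costs the factor exp(\<mu>/100) =
  exp(1/20000).\<close>

lemma action_lower_fixed:
  assumes "L2_set y {..<n} \<le> 1" "L2_set y {..<n} \<ge> 1 / 2"
  shows "sign_prob N n (\<lambda>\<omega>. action_norm N n \<omega> y < sqrt (real N) / 10) \<le> exp (- real N / 5000)"
proof -
  have y: "(\<Sum>i<n. (y i)\<^sup>2) \<le> 1" using assms by (simp add: L2_set_def)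
  have y2: "(1 / 2)\<^sup>2 \<le> (\<Sum>i<n. (y i)\<^sup>2)"
    using power_mono[OF assms(2), of 2] unfolding L2_set_def by (simp add: sum_nonneg)
  have yi: "\<bar>y i\<bar> \<le> 1" if "i < n" for i
  proof -
    have "(y i)\<^sup>2 \<le> (\<Sum>i<n. (y i)\<^sup>2)" using that by (intro member_le_sum) auto
    hence "(y i)\<^sup>2 \<le> 1" using y by simp
    thus ?thesis by (simp add: abs_square_le_1)
  qed
  let ?F = "\<lambda>x. exp (1 / 20000) * exp (- (1 / 200) * (\<Sum>i<n. y i * x i)\<^sup>2)"
  have "sign_prob N n (\<lambda>\<omega>. action_norm N n \<omega> y < sqrt (real N) / 10) \<le> sign_average n ?F ^ N"
  proof (rule sign_prob_le_power)
    fix \<omega> assume "action_norm N n \<omega> y < sqrt (real N) / 10"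
    hence "(action_norm N n \<omega> y)\<^sup>2 < (sqrt (real N) / 10)\<^sup>2"
      by (intro power_strict_mono) auto
    also have "(action_norm N n \<omega> y)\<^sup>2 = (\<Sum>j<N. (\<Sum>i<n. y i * \<omega> j i)\<^sup>2)"
      unfolding action_norm_def L2_set_def by (simp add: sum_nonneg dot_def mult.commute)
    finally have "0 \<le> (\<Sum>j<N. 1 / 20000 - (1/200) * (\<Sum>i<n. y i * \<omega> j i)\<^sup>2)"
      by (simp add: power_divide sum_subtractf sum_divide_distrib[symmetric])
    hence "1 \<le> exp (\<Sum>j<N. 1 / 20000 + - (1/200) * (\<Sum>i<n. y i * \<omega> j i)\<^sup>2)" by simp
    thus "1 \<le> (\<Prod>j<N. ?F (\<omega> j))"
      unfolding exp_sum[OF finite_lessThan] exp_add .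
  qed auto
  also have "\<dots> \<le> exp (- 1 / 5000) ^ N"
  proof (intro power_mono)
    have S: "{i. i < n \<and> \<bar>y i\<bar> \<le> 1} = {..<n}" using yi by auto
    have "sign_average n (\<lambda>x. exp (- (1 / 200) * (\<Sum>i<n. y i * x i)\<^sup>2))
        \<le> 1 / sqrt (1 + (1 / 200) * (1 / 2)\<^sup>2) + 12 * (1 / 200)\<^sup>2 * 1 ^ 4"
      by (rule sign_average_exp_neg_square_le) (use y2 S in auto)
    also have "1 / sqrt (1 + (1 / 200) * (1 / 2)\<^sup>2) \<le> 9994 / 10000"
    proof -
      have "10000 / 9994 \<le> sqrt (1 + (1 / 200) * (1 / 2)\<^sup>2)"
        by (rule real_le_rsqrt) (simp add: power2_eq_square)
      thus ?thesis by (simp add: field_simps)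
    qed
    finally have "sign_average n (\<lambda>x. exp (- (1 / 200) * (\<Sum>i<n. y i * x i)\<^sup>2)) \<le> 9997 / 10000"
      by (simp add: power2_eq_square)
    moreover have "exp (1 / 20000) \<le> (1 + 1 / 10000 :: real)"
      using exp_bound_half[of "1 / 20000 :: real"] exp_bound[of "1/20000::real"] by (simp add: power2_eq_square)
    ultimately have "sign_average n ?F \<le> (1 + 1 / 10000) * (9997 / 10000)"
      unfolding sign_average_cmult by (intro mult_mono) (auto intro!: sign_average_nonneg)
    also have "\<dots> \<le> 1 + (- 1 / 5000)" by simp
    also have "\<dots> \<le> exp (- 1 / 5000 :: real)" by (rule exp_ge_add_one_self)
    finally show "sign_average n ?F \<le> exp (- 1 / 5000)" .
  qed (auto intro!: sign_average_nonneg)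
  also have "\<dots> = exp (- real N / 5000)"
    by (simp add: exp_of_nat_mult[symmetric])
  finally show ?thesis .
qed

text \<open>Successive approximation: rounding splits off a net point and leaves a remainder of half
  the norm with no larger support, hence again sparse. The contributions B, B/2, B/4, ... sum to 2
  B.\<close>

lemma action_upper_from_net:
  assumes \<omega>: "\<omega> \<in> sign_families N n" and k: "1 \<le> k" and B: "B \<ge> 0"
    and net: "\<And>z. z \<in> int_vectors n (2 * real k) \<Longrightarrow> L2_set (\<lambda>i. 1 / 2 / sqrt (real k) * z i) {..<n} \<le> 1
           \<Longrightarrow> action_norm N n \<omega> (\<lambda>i. 1 / 2 / sqrt (real k) * z i) \<le> B"
    and x: "sparse n k x"
  shows "action_norm N n \<omega> x \<le> 2 * B * L2_set x {..<n}"
proof -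
  \<comment> \<open>The crude operator bound controls what is left after p roundings; its factor
    (1/2)^p sends it to zero.\<close>
  define D where "D = sqrt (real N) * sqrt (real n)"
  have iter: "action_norm N n \<omega> x \<le> 2 * B + (1 / 2) ^ p * D"
    if "sparse n k x" "L2_set x {..<n} \<le> 1" for p x
    using that
  proof (induction p arbitrary: x)
    case 0
    have "action_norm N n \<omega> x \<le> D * L2_set x {..<n}"
      using action_norm_crude[OF \<omega>, of x] by (simp add: D_def mult_ac)
    also have "\<dots> \<le> D * 1" using 0 by (intro mult_left_mono) (auto simp: D_def)
    finally show ?case using B by simp
  next
    case (Suc p)
    obtain z where z: "z \<in> int_vectors n (real k / (1/2))"
      "\<And>i. i < n \<Longrightarrow> \<bar>1 / 2 / sqrt (real k) * z i\<bar> \<le> \<bar>x i\<bar>"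
      "\<And>i. i < n \<Longrightarrow> x i = 0 \<Longrightarrow> z i = 0"
      "L2_set (\<lambda>i. x i - 1 / 2 / sqrt (real k) * z i) {..<n} \<le> 1 / 2"
      using rounding_net[OF Suc.prems(1) k, of "1/2"] Suc.prems(2) by auto
    let ?y = "\<lambda>i. 1 / 2 / sqrt (real k) * z i"
    let ?r = "\<lambda>i. 2 * (x i - ?y i)"
    have "L2_set ?y {..<n} \<le> L2_set x {..<n}"
      by (rule L2_set_le_abs) (rule z(2), simp)
    hence "action_norm N n \<omega> ?y \<le> B"
      using net[of z] z(1) Suc.prems by (simp add: mult.commute)
    moreover have "action_norm N n \<omega> ?r \<le> 2 * B + (1 / 2) ^ p * D"
    proof (rule Suc.IH)
      show "sparse n k ?r" by (rule sparse_subset[OF Suc.prems(1)]) (simp add: z(3))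
      show "L2_set ?r {..<n} \<le> 1" using z(4) by (subst L2_set_scale) simp
    qed
    hence "action_norm N n \<omega> (\<lambda>i. x i - ?y i) \<le> B + (1 / 2) ^ Suc p * D"
      unfolding action_norm_scale by simp
    ultimately show ?case
      using action_norm_split[of N n \<omega> x ?y] by simp
  qed
  have unit: "action_norm N n \<omega> x \<le> 2 * B" if "sparse n k x" "L2_set x {..<n} \<le> 1" for x
  proof (rule LIMSEQ_le_const)
    have "(\<lambda>p. 2 * B + (1 / 2) ^ p * D) \<longlonglongrightarrow> 2 * B + 0 * D"
      by (intro tendsto_intros LIMSEQ_power_zero) auto
    thus "(\<lambda>p. 2 * B + (1 / 2) ^ p * D) \<longlonglongrightarrow> 2 * B" by simp
    show "\<exists>p0. \<forall>p\<ge>p0. action_norm N n \<omega> x \<le> 2 * B + (1 / 2) ^ p * D"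
      using iter[OF that] by blast
  qed
  show ?thesis
  proof (cases "L2_set x {..<n} = 0")
    case True
    thus ?thesis using action_norm_crude[OF \<omega>, of x] by simp
  next
    case False
    hence pos: "L2_set x {..<n} > 0" using L2_set_nonneg[of x "{..<n}"] by linarith
    have "action_norm N n \<omega> (\<lambda>i. inverse (L2_set x {..<n}) * x i) \<le> 2 * B"
      using pos by (intro unit sparse_subset[OF x]) (auto simp: L2_set_scale)
    thus ?thesis unfolding action_norm_scale using pos by (simp add: field_simps)
  qed
qed

lemma action_upper_sparse:
  assumes k: "1 \<le> k"
  shows "sign_prob N n (\<lambda>\<omega>. \<exists>x. sparse n k x \<and> action_norm N n \<omega> x > 8 * sqrt (real N) * L2_set x {..<n})
           \<le> real (card (int_vectors n (2 * real k))) * exp (- 3 * real N)"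
proof -
  let ?y = "\<lambda>z i. 1 / 2 / sqrt (real k) * real_of_int (z i)"
  let ?Q = "\<lambda>z \<omega>. L2_set (?y z) {..<n} \<le> 1 \<and> action_norm N n \<omega> (?y z) > 4 * sqrt (real N)"
  have "sign_prob N n (\<lambda>\<omega>. \<exists>x. sparse n k x \<and> action_norm N n \<omega> x > 8 * sqrt (real N) * L2_set x {..<n})
      \<le> sign_prob N n (\<lambda>\<omega>. \<exists>z\<in>int_vectors n (2 * real k). ?Q z \<omega>)"
  proof (rule sign_prob_mono, rule ccontr)
    fix \<omega> assume \<omega>: "\<omega> \<in> sign_families N n"
      and "\<exists>x. sparse n k x \<and> action_norm N n \<omega> x > 8 * sqrt (real N) * L2_set x {..<n}"
      and no: "\<not> (\<exists>z\<in>int_vectors n (2 * real k). ?Q z \<omega>)"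
    then obtain x where x: "sparse n k x" "action_norm N n \<omega> x > 8 * sqrt (real N) * L2_set x {..<n}"
      by blast
    have "action_norm N n \<omega> x \<le> 2 * (4 * sqrt (real N)) * L2_set x {..<n}"
      by (rule action_upper_from_net[OF \<omega> k _ _ x(1)]) (use no in \<open>auto simp: not_less\<close>)
    thus False using x(2) by simp
  qed
  also have "\<dots> \<le> real (card (int_vectors n (2 * real k))) * exp (- 3 * real N)"
    by (rule sign_prob_union_if[OF _ _ action_upper_fixed]) simp_all
  finally show ?thesis .
qed

text \<open>The lower bound passes from the net to all sparse vectors by means of the upper bound: a
  rounding error of 1/160 is amplified by at most 8, and 8/160 = 1/20 is half of the 1/10 that holds
  on the net.\<close>

lemma action_sparse:
  assumes k: "1 \<le> k"
  shows "sign_prob N n (\<lambda>\<omega>. \<exists>x. sparse n k x \<and>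
              (action_norm N n \<omega> x > 8 * sqrt (real N) * L2_set x {..<n} \<or>
               action_norm N n \<omega> x < sqrt (real N) / 20 * L2_set x {..<n}))
           \<le> 2 * real (card (int_vectors n (160 * real k))) * exp (- real N / 5000)"
proof -
  let ?y = "\<lambda>z i. 1 / 160 / sqrt (real k) * real_of_int (z i)"
  let ?U = "\<lambda>\<omega>. \<exists>x. sparse n k x \<and> action_norm N n \<omega> x > 8 * sqrt (real N) * L2_set x {..<n}"
  let ?Q = "\<lambda>z \<omega>. (L2_set (?y z) {..<n} \<le> 1 \<and> L2_set (?y z) {..<n} \<ge> 1/2) \<and> action_norm N n \<omega> (?y z) < sqrt (real N) / 10"
  have "sign_prob N n (\<lambda>\<omega>. \<exists>x. sparse n k x \<and>
              (action_norm N n \<omega> x > 8 * sqrt (real N) * L2_set x {..<n} \<or>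
               action_norm N n \<omega> x < sqrt (real N) / 20 * L2_set x {..<n}))
     \<le> sign_prob N n (\<lambda>\<omega>. ?U \<omega> \<or> (\<exists>z\<in>int_vectors n (160 * real k). ?Q z \<omega>))"
  proof (rule sign_prob_mono, rule ccontr)
    fix \<omega> assume \<omega>: "\<omega> \<in> sign_families N n"
      and "\<exists>x. sparse n k x \<and>
              (action_norm N n \<omega> x > 8 * sqrt (real N) * L2_set x {..<n} \<or>
               action_norm N n \<omega> x < sqrt (real N) / 20 * L2_set x {..<n})"
      and no: "\<not> (?U \<omega> \<or> (\<exists>z\<in>int_vectors n (160 * real k). ?Q z \<omega>))"
    then obtain x where x: "sparse n k x" "action_norm N n \<omega> x < sqrt (real N) / 20 * L2_set x {..<n}"
      by blast
    have up: "action_norm N n \<omega> x \<le> 8 * sqrt (real N) * L2_set x {..<n}" if "sparse n k x" for x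
      using no that by (meson not_less)
    define l where "l = L2_set x {..<n}"
    have l: "l > 0"
    proof -
      have "0 < sqrt (real N) / 20 * l"
        using x(2) action_norm_nonneg[of N n \<omega> x] unfolding l_def by linarith
      moreover have "l \<ge> 0" by (simp add: l_def)
      ultimately show ?thesis by (cases "l = 0") auto
    qed
    define x' where "x' = (\<lambda>i. inverse l * x i)"
    have x': "sparse n k x'" "L2_set x' {..<n} = 1"
      using l by (auto simp: x'_def L2_set_scale l_def[symmetric] intro!: sparse_subset[OF x(1)])
    have x'l: "action_norm N n \<omega> x' < sqrt (real N) / 20"
      unfolding x'_def action_norm_scale using x(2) l by (simp add: l_def[symmetric] field_simps)
    obtain z where z: "z \<in> int_vectors n (real k / (1/160))"
      "\<And>i. i < n \<Longrightarrow> \<bar>?y z i\<bar> \<le> \<bar>x' i\<bar>"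
      "\<And>i. i < n \<Longrightarrow> x' i = 0 \<Longrightarrow> z i = 0"
      "L2_set (\<lambda>i. x' i - ?y z i) {..<n} \<le> 1 / 160"
      using rounding_net[OF x'(1) k, of "1/160"] x'(2) by auto
    have "L2_set (?y z) {..<n} \<le> L2_set x' {..<n}"
      by (rule L2_set_le_abs) (rule z(2), simp)
    hence y1: "L2_set (?y z) {..<n} \<le> 1" using x' by simp
    have "L2_set x' {..<n} \<le> L2_set (?y z) {..<n} + L2_set (\<lambda>i. x' i - ?y z i) {..<n}"
      using L2_set_triangle_ineq[of "?y z" "\<lambda>i. x' i - ?y z i" "{..<n}"] by simp
    hence y2: "L2_set (?y z) {..<n} \<ge> 1/2" using x' z(4) by simp
    have "action_norm N n \<omega> (\<lambda>i. x' i - ?y z i) \<le> 8 * sqrt (real N) * L2_set (\<lambda>i. x' i - ?y z i) {..<n}"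
      by (rule up) (rule sparse_subset[OF x'(1)], simp add: z(3))
    also have "\<dots> \<le> 8 * sqrt (real N) * (1 / 160)"
      using z(4) by (intro mult_left_mono) auto
    finally have r: "action_norm N n \<omega> (\<lambda>i. ?y z i - x' i) \<le> sqrt (real N) / 20"
      unfolding action_norm_minus[of N n \<omega> "?y z"] by simp
    have "action_norm N n \<omega> (?y z) < sqrt (real N) / 10"
      using action_norm_split[of N n \<omega> "?y z" x'] r x'l by simp
    moreover have "z \<in> int_vectors n (160 * real k)" using z(1) by (simp add: mult.commute)
    ultimately show False using no y1 y2 by blast
  qed
  also have "\<dots> \<le> sign_prob N n ?U + sign_prob N n (\<lambda>\<omega>. \<exists>z\<in>int_vectors n (160 * real k). ?Q z \<omega>)"
    by (rule sign_prob_disj)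
  also have "sign_prob N n ?U \<le> real (card (int_vectors n (2 * real k))) * exp (- 3 * real N)"
    by (rule action_upper_sparse[OF k])
  also have "\<dots> \<le> real (card (int_vectors n (160 * real k))) * exp (- real N / 5000)"
  proof (intro mult_mono of_nat_mono card_mono)
    show "int_vectors n (2 * real k) \<subseteq> int_vectors n (160 * real k)"
    proof
      fix z assume "z \<in> int_vectors n (2 * real k)"
      moreover have "2 * real k \<le> 160 * real k" by simp
      ultimately show "z \<in> int_vectors n (160 * real k)"
        unfolding int_vectors_def mem_Collect_eq by linarith
    qed
  qed simp_all
  also have "sign_prob N n (\<lambda>\<omega>. \<exists>z\<in>int_vectors n (160 * real k). ?Q z \<omega>)
      \<le> real (card (int_vectors n (160 * real k))) * exp (- real N / 5000)"
    by (rule sign_prob_union_if[OF _ _ action_lower_fixed]) simp_all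
  finally show ?thesis by simp
qed

subsection \<open>Attained minima and linear systems\<close>

text \<open>The vectors are functions on all natural numbers, so compactness comes from Tychonoff's
  theorem: intervals in the first n coordinates and the singleton of \<open>undefined\<close> in all
  others.\<close>

lemma attains_min_vectors:
  fixes J :: "(nat \<Rightarrow> real) \<Rightarrow> real"
  assumes G: "closed G" and x0: "x0 \<in> vectors n \<inter> G" and J: "continuous_on UNIV J"
    and coercive: "\<And>x i. x \<in> vectors n \<inter> G \<Longrightarrow> J x \<le> J x0 \<Longrightarrow> i < n \<Longrightarrow> \<bar>x i\<bar> \<le> r"
  shows "\<exists>x\<in>vectors n \<inter> G. \<forall>y\<in>vectors n \<inter> G. J x \<le> J y"
proof -
  define K :: "(nat \<Rightarrow> real) set" where "K = PiE UNIV (\<lambda>i. if i < n then {-r..r} else {undefined})"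
  have "compactin (product_topology (\<lambda>_. euclidean) UNIV) K"
    unfolding K_def compactin_PiE by (auto simp: compactin_euclidean_iff)
  hence "compact K"
    by (simp add: euclidean_product_topology compactin_euclidean_iff)
  hence KG: "compact (K \<inter> G)" using G by (rule compact_Int_closed)
  have in_K: "x \<in> K" if "x \<in> vectors n \<inter> G" "J x \<le> J x0" for x
    using that coercive[OF that] by (auto simp: K_def vectors_def PiE_def Pi_def extensional_def abs_le_iff minus_le_iff)
  have K_vec: "x \<in> vectors n" if "x \<in> K" for x
    unfolding vectors_def
  proof (intro PiE_I)
    fix i assume "i \<notin> {..<n}"
    moreover have "x i \<in> (if i < n then {-r..r} else {undefined})"
      using that by (auto simp: K_def PiE_def Pi_def)
    ultimately show "x i = undefined" by simp
  qed simp
  have "x0 \<in> K \<inter> G" using x0 in_K[OF x0] by simp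
  then obtain x where x: "x \<in> K \<inter> G" "\<forall>y\<in>K \<inter> G. J x \<le> J y"
    using continuous_attains_inf[OF KG, of J] J continuous_on_subset by blast
  have "J x \<le> J y" if "y \<in> vectors n \<inter> G" for y
  proof (cases "J y \<le> J x0")
    case True
    thus ?thesis using x(2) in_K[OF that] that by blast
  next
    case False
    moreover have "J x \<le> J x0" using x(2) \<open>x0 \<in> K \<inter> G\<close> by blast
    ultimately show ?thesis by simp
  qed
  thus ?thesis using x(1) K_vec by blast
qed

lemma continuous_on_dot [continuous_intros]: "continuous_on S (\<lambda>x. dot n w x)"
  unfolding dot_def
  by (intro continuous_intros continuous_on_subset[OF continuous_on_product_coordinates]) auto

text \<open>The normal equations are the stationarity conditions of a coercive quadratic functional.\<close>

lemma normal_equations_solvable: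
  assumes c: "c > 0" and low: "\<And>x. c * L2_set x {..<m} \<le> action_norm N m \<omega> x"
  shows "\<exists>\<theta>. \<forall>i<m. (\<Sum>j<N. dot m (\<omega> j) \<theta> * \<omega> j i) = y i"
proof -
  define J where "J = (\<lambda>\<theta>. (\<Sum>j<N. (dot m (\<omega> j) \<theta>)\<^sup>2) / 2 - dot m y \<theta>)"
  have act: "(\<Sum>j<N. (dot m (\<omega> j) \<theta>)\<^sup>2) = (action_norm N m \<omega> \<theta>)\<^sup>2" for \<theta>
    by (simp add: action_norm_def L2_set_def sum_nonneg)
  define x0 :: "nat \<Rightarrow> real" where "x0 = (\<lambda>i\<in>{..<m}. 0)"
  have x0: "x0 \<in> vectors m \<inter> UNIV" by (simp add: x0_def vectors_def)
  have Jx0: "J x0 = 0" by (simp add: J_def x0_def dot_def)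
  have "\<exists>x\<in>vectors m \<inter> UNIV. \<forall>y\<in>vectors m \<inter> UNIV. J x \<le> J y"
  proof (rule attains_min_vectors[OF _ x0, where r = "2 * L2_set y {..<m} / c\<^sup>2"])
    show "continuous_on UNIV J" unfolding J_def by (intro continuous_intros) auto
    fix x i assume "J x \<le> J x0" "i < m"
    let ?l = "L2_set x {..<m}"
    have "(c * ?l)\<^sup>2 \<le> (action_norm N m \<omega> x)\<^sup>2"
      using low[of x] c by (intro power_mono) auto
    moreover have "dot m y x \<le> L2_set y {..<m} * ?l"
      using abs_dot_le[of m y x] by simp
    moreover have "J x \<le> 0" using \<open>J x \<le> J x0\<close> Jx0 by simp
    ultimately have le: "c\<^sup>2 * ?l * ?l \<le> 2 * L2_set y {..<m} * ?l"
      unfolding J_def act by (simp add: power_mult_distrib power2_eq_square mult_ac)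
    have "?l \<le> 2 * L2_set y {..<m} / c\<^sup>2"
    proof (cases "?l = 0")
      case False
      hence "c\<^sup>2 * ?l \<le> 2 * L2_set y {..<m}"
        using le L2_set_nonneg[of x "{..<m}"] by (simp add: mult_le_cancel_right)
      thus ?thesis using c by (simp add: field_simps)
    qed simp
    moreover have "\<bar>x i\<bar> \<le> ?l"
      using member_le_L2_set[of "{..<m}" i "\<lambda>i. \<bar>x i\<bar>"] \<open>i < m\<close> by (simp add: L2_set_def)
    ultimately show "\<bar>x i\<bar> \<le> 2 * L2_set y {..<m} / c\<^sup>2" by simp
  qed auto
  then obtain \<theta> where \<theta>: "\<theta> \<in> vectors m" "\<And>x. x \<in> vectors m \<Longrightarrow> J \<theta> \<le> J x" by auto
  have "(\<Sum>j<N. dot m (\<omega> j) \<theta> * \<omega> j i) = y i" if i: "i < m" for i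
  proof (rule ccontr)
    define A where "A = (\<Sum>j<N. dot m (\<omega> j) \<theta> * \<omega> j i) - y i"
    define B where "B = (\<Sum>j<N. (\<omega> j i)\<^sup>2)"
    assume "(\<Sum>j<N. dot m (\<omega> j) \<theta> * \<omega> j i) \<noteq> y i"
    hence A: "A \<noteq> 0" by (simp add: A_def)
    have B: "B \<ge> 0" by (simp add: B_def sum_nonneg)
    have e: "dot m w (\<theta>(i := \<theta> i + t)) = dot m w \<theta> + t * w i" for w t
    proof -
      have "dot m w (\<theta>(i := \<theta> i + t)) = (\<Sum>l<m. w l * \<theta> l + (if l = i then t * w i else 0))"
        unfolding dot_def by (intro sum.cong) (auto simp: algebra_simps)
      also have "\<dots> = dot m w \<theta> + t * w i"
        using i by (simp add: sum.distrib dot_def)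
      finally show ?thesis .
    qed
    \<comment> \<open>Moving the single coordinate i by t changes the functional by this quadratic
      polynomial; minimality makes it nonnegative for all t.\<close>
    have quad: "t * A + t\<^sup>2 * B / 2 \<ge> 0" for t
    proof -
      have "\<theta>(i := \<theta> i + t) \<in> vectors m"
        using \<theta>(1) i by (auto simp: vectors_def PiE_def extensional_def)
      hence "J \<theta> \<le> J (\<theta>(i := \<theta> i + t))" by (rule \<theta>(2))
      also have "J (\<theta>(i := \<theta> i + t)) = J \<theta> + t * A + t\<^sup>2 * B / 2"
        unfolding J_def e A_def B_def
        by (simp add: power2_sum sum.distrib sum_distrib_left power_mult_distrib algebra_simps add_divide_distrib)

      finally show ?thesis by simp
    qed
    \<comment> \<open>Moving by - s, close to the minimizer - A/B of the quadratic but meaningful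
      for B = 0 too, changes the functional by - s^2 (B/2 + 1).\<close>
    define s where "s = A / (B + 1)"
    have s: "A = s * (B + 1)" "s \<noteq> 0" using A B by (auto simp: s_def)
    have "s\<^sup>2 * (B / 2 + 1) \<le> 0"
      using quad[of "- s"] by (simp add: s(1) algebra_simps power2_eq_square)
    moreover have "s\<^sup>2 * (B / 2 + 1) > 0" using s B by (intro mult_pos_pos) auto
    ultimately show False by linarith
  qed
  thus ?thesis by blast
qed

text \<open>The solution is taken in the range of the map, u_j = <\<omega>_j, \<theta>> with
  \<theta> from the normal equations. Then |u|^2 = <\<theta>, y> \<le> |\<theta>| |y| \<le> |u| |y|
  / c.\<close>

lemma solution_with_small_L2:
  assumes c: "c > 0" and low: "\<And>x. c * L2_set x {..<m} \<le> action_norm N m \<omega> x"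
  obtains u where "\<And>i. i < m \<Longrightarrow> (\<Sum>j<N. u j * \<omega> j i) = y i" "L2_set u {..<N} \<le> L2_set y {..<m} / c"
proof -
  obtain \<theta> where \<theta>: "\<And>i. i < m \<Longrightarrow> (\<Sum>j<N. dot m (\<omega> j) \<theta> * \<omega> j i) = y i"
    using normal_equations_solvable[OF assms] by blast
  define u where "u = (\<lambda>j. dot m (\<omega> j) \<theta>)"
  have uact: "L2_set u {..<N} = action_norm N m \<omega> \<theta>"
    by (simp add: u_def action_norm_def)
  have "(L2_set u {..<N})\<^sup>2 = (\<Sum>j<N. u j * dot m (\<omega> j) \<theta>)"
    by (simp add: L2_set_def sum_nonneg u_def power2_eq_square)
  also have "\<dots> = (\<Sum>i<m. \<theta> i * (\<Sum>j<N. u j * \<omega> j i))"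
    unfolding dot_def sum_distrib_left by (subst sum.swap) (simp add: mult_ac)
  also have "\<dots> = dot m \<theta> y"
    unfolding dot_def using \<theta> by (intro sum.cong) (auto simp: u_def)
  also have "\<dots> \<le> L2_set \<theta> {..<m} * L2_set y {..<m}"
    using abs_dot_le[of m \<theta> y] by simp
  also have "\<dots> \<le> (L2_set u {..<N} / c) * L2_set y {..<m}"
    using low[of \<theta>] c by (intro mult_right_mono) (auto simp: uact field_simps)
  finally have le: "L2_set u {..<N} * L2_set u {..<N} \<le> L2_set u {..<N} * (L2_set y {..<m} / c)"
    by (simp add: power2_eq_square)
  have "L2_set u {..<N} \<le> L2_set y {..<m} / c"
  proof (cases "L2_set u {..<N} = 0")
    case True
    thus ?thesis using c by simp
  next
    case False
    hence "L2_set u {..<N} > 0" using L2_set_nonneg[of u "{..<N}"] by linarith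
    thus ?thesis using le by (simp only: mult_le_cancel_left_pos)
  qed
  thus ?thesis by (intro that[of u]) (auto simp: u_def \<theta>)
qed

subsection \<open>The smallest singular value of a tall sign matrix\<close>

lemma L2_set_restrict_sq:
  fixes n :: nat
  shows "(L2_set (\<lambda>i. if P i then x i else 0) {..<n})\<^sup>2 = (\<Sum>i | i < n \<and> P i. (x i :: real)\<^sup>2)"
proof -
  have "(L2_set (\<lambda>i. if P i then x i else 0) {..<n})\<^sup>2 = (\<Sum>i<n. if P i then (x i)\<^sup>2 else 0)"
    by (simp add: L2_set_def sum_nonneg if_distrib[of "\<lambda>x. x\<^sup>2"] cong: if_cong)
  also have "\<dots> = (\<Sum>i | i < n \<and> P i. (x i)\<^sup>2)"
    using sum.inter_filter[of "{..<n}" "\<lambda>i. (x i)\<^sup>2" P] by simp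
  finally show ?thesis .
qed

lemma large_coordinates_sparse:
  assumes "\<kappa> > 0" "L2_set x {..<n} \<le> 1" "1 / \<kappa>\<^sup>2 \<le> real k"
  shows "sparse n k (\<lambda>i. if \<bar>x i\<bar> > \<kappa> then x i else 0)"
proof -
  let ?S = "{i. i < n \<and> (if \<bar>x i\<bar> > \<kappa> then x i else 0) \<noteq> 0}"
  have "real (card ?S) * \<kappa>\<^sup>2 = (\<Sum>i\<in>?S. \<kappa>\<^sup>2)" by simp
  also have "\<dots> \<le> (\<Sum>i\<in>?S. (x i)\<^sup>2)"
  proof (intro sum_mono)
    fix i assume "i \<in> ?S"
    hence "\<bar>\<kappa>\<bar> \<le> \<bar>x i\<bar>" using assms(1) by (auto split: if_splits)
    thus "\<kappa>\<^sup>2 \<le> (x i)\<^sup>2" by (simp add: abs_le_square_iff)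
  qed
  also have "\<dots> \<le> (\<Sum>i<n. (x i)\<^sup>2)" by (intro sum_mono2) auto
  also have "\<dots> \<le> 1" using assms(2) by (simp add: L2_set_def)
  finally have "real (card ?S) \<le> 1 / \<kappa>\<^sup>2" using assms(1) by (simp add: field_simps)
  hence "real (card ?S) \<le> real k" using assms(3) by linarith
  thus ?thesis by (simp add: sparse_def)
qed

text \<open>Small ball estimate with \<mu> = 1/\<gamma>^2 and \<kappa> = \<gamma>^2. The spread part
  gives 800 \<gamma>; this \<kappa> makes the error 12 \<mu>^2 \<kappa>^4 = 12 \<gamma>^4, which is
  at most \<gamma>. The threshold costs e \<le> 3, and 3 * 801 = 2403.\<close>

lemma action_lower_spread_fixed:
  assumes \<gamma>: "0 < \<gamma>" "\<gamma> \<le> 1 / 3" and spread: "1 / 800 \<le> L2_set (\<lambda>i. if \<bar>y i\<bar> \<le> \<gamma>\<^sup>2 then y i else 0) {..<n}"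
  shows "sign_prob N n (\<lambda>\<omega>. action_norm N n \<omega> y < \<gamma> * sqrt (real N)) \<le> (2403 * \<gamma>) ^ N"
proof -
  let ?F = "\<lambda>x. exp 1 * exp (- (1 / \<gamma>\<^sup>2) * (\<Sum>i<n. y i * x i)\<^sup>2)"
  have "sign_prob N n (\<lambda>\<omega>. action_norm N n \<omega> y < \<gamma> * sqrt (real N)) \<le> sign_average n ?F ^ N"
  proof (rule sign_prob_le_power)
    fix \<omega> assume "action_norm N n \<omega> y < \<gamma> * sqrt (real N)"
    hence "(action_norm N n \<omega> y)\<^sup>2 < (\<gamma> * sqrt (real N))\<^sup>2"
      by (intro power_strict_mono) auto
    also have "(action_norm N n \<omega> y)\<^sup>2 = (\<Sum>j<N. (\<Sum>i<n. y i * \<omega> j i)\<^sup>2)"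
      unfolding action_norm_def L2_set_def by (simp add: sum_nonneg dot_def mult.commute)
    finally have "(1 / \<gamma>\<^sup>2) * (\<Sum>j<N. (\<Sum>i<n. y i * \<omega> j i)\<^sup>2) \<le> (1 / \<gamma>\<^sup>2) * (\<gamma> * sqrt (real N))\<^sup>2"
      by (intro mult_left_mono) auto
    also have "\<dots> = real N" using \<gamma> by (simp add: power_mult_distrib)
    finally have "0 \<le> (\<Sum>j<N. 1 + - (1 / \<gamma>\<^sup>2) * (\<Sum>i<n. y i * \<omega> j i)\<^sup>2)"
      unfolding sum.distrib sum_distrib_left[symmetric] by simp
    hence "1 \<le> exp (\<Sum>j<N. 1 + - (1 / \<gamma>\<^sup>2) * (\<Sum>i<n. y i * \<omega> j i)\<^sup>2)" by simp
    thus "1 \<le> (\<Prod>j<N. ?F (\<omega> j))"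
      unfolding exp_sum[OF finite_lessThan] exp_add .
  qed auto
  also have "\<dots> \<le> (2403 * \<gamma>) ^ N"
  proof (intro power_mono)
    have "(1 / 800)\<^sup>2 \<le> (L2_set (\<lambda>i. if \<bar>y i\<bar> \<le> \<gamma>\<^sup>2 then y i else 0) {..<n})\<^sup>2"
      using spread by (intro power_mono) auto
    hence "sign_average n (\<lambda>x. exp (- (1 / \<gamma>\<^sup>2) * (\<Sum>i<n. y i * x i)\<^sup>2))
        \<le> 1 / sqrt (1 + (1 / \<gamma>\<^sup>2) * (1 / 800)\<^sup>2) + 12 * (1 / \<gamma>\<^sup>2)\<^sup>2 * (\<gamma>\<^sup>2) ^ 4"
      using \<gamma> unfolding L2_set_restrict_sq by (intro sign_average_exp_neg_square_le) auto
    also have "1 / sqrt (1 + (1 / \<gamma>\<^sup>2) * (1 / 800)\<^sup>2) \<le> 800 * \<gamma>"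
    proof -
      have "1 / (800 * \<gamma>) \<le> sqrt (1 + (1 / \<gamma>\<^sup>2) * (1 / 800)\<^sup>2)"
        using \<gamma> by (intro real_le_rsqrt) (simp add: power2_eq_square)
      thus ?thesis using \<gamma> by (simp add: field_simps add_pos_nonneg)
    qed
    also have "12 * (1 / \<gamma>\<^sup>2)\<^sup>2 * (\<gamma>\<^sup>2) ^ 4 = (12 * \<gamma> ^ 3) * \<gamma>"
      using \<gamma> by (simp add: field_simps eval_nat_numeral)
    also have "\<dots> \<le> 1 * \<gamma>"
    proof -
      have "\<gamma> ^ 3 \<le> (1 / 3) ^ 3" using \<gamma> by (intro power_mono) auto
      hence "12 * \<gamma> ^ 3 \<le> 1" by (simp add: power3_eq_cube)
      thus ?thesis using \<gamma> by (intro mult_right_mono) auto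
    qed
    finally have "sign_average n (\<lambda>x. exp (- (1 / \<gamma>\<^sup>2) * (\<Sum>i<n. y i * x i)\<^sup>2)) \<le> 801 * \<gamma>"
      by simp
    hence "sign_average n ?F \<le> 3 * (801 * \<gamma>)"
      unfolding sign_average_cmult using exp_le by (intro mult_mono) (auto intro!: sign_average_nonneg)
    thus "sign_average n ?F \<le> 2403 * \<gamma>" by simp
  qed (auto intro!: sign_average_nonneg)
  finally show ?thesis .
qed

text \<open>
  Compressible vectors are close to sparse ones; for the others the rounded vector keeps a
  substantial spread part, so that the small ball estimate applies on the net.
\<close>

lemma action_lower_from_parts:
  assumes m: "1 \<le> m" and \<gamma>: "0 < \<gamma>" "\<gamma> \<le> 1 / 50"
    and k0: "1 / (\<gamma>\<^sup>2)\<^sup>2 \<le> real k0"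
    and up: "\<And>x. action_norm N m \<omega> x \<le> 8 * sqrt (real N) * L2_set x {..<m}"
    and sp: "\<And>x. sparse m k0 x \<Longrightarrow> action_norm N m \<omega> x \<ge> sqrt (real N) / 20 * L2_set x {..<m}"
    and net: "\<And>z. z \<in> int_vectors m (real m / (\<gamma> / 16)) \<Longrightarrow>
        1 / 800 \<le> L2_set (\<lambda>i. if \<bar>\<gamma> / 16 / sqrt (real m) * z i\<bar> \<le> \<gamma>\<^sup>2 then \<gamma> / 16 / sqrt (real m) * z i else 0) {..<m} \<Longrightarrow>
        action_norm N m \<omega> (\<lambda>i. \<gamma> / 16 / sqrt (real m) * z i) \<ge> \<gamma> * sqrt (real N)"
  shows "\<gamma> / 2 * sqrt (real N) * L2_set x {..<m} \<le> action_norm N m \<omega> x"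
proof -
  have unit: "\<gamma> / 2 * sqrt (real N) \<le> action_norm N m \<omega> x" if x: "L2_set x {..<m} = 1" for x
  proof -
    define big where "big = (\<lambda>i. if \<bar>x i\<bar> > \<gamma>\<^sup>2 then x i else 0)"
    define small where "small = (\<lambda>i. if \<bar>x i\<bar> \<le> \<gamma>\<^sup>2 then x i else 0)"
    have split: "x = (\<lambda>i. big i + small i)" by (auto simp: big_def small_def)
    have split': "(\<lambda>i. big i - x i) = (\<lambda>i. (-1) * small i)" by (auto simp: big_def small_def)
    show ?thesis
    \<comment> \<open>In the compressible case the large part is sparse and carries norm at least
      399/400, while the small part contributes at most 8/400.\<close>
    proof (cases "L2_set small {..<m} \<le> 1 / 400")
      case True
      have "L2_set x {..<m} \<le> L2_set big {..<m} + L2_set small {..<m}"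
        by (subst split) (rule L2_set_triangle_ineq)
      hence "L2_set big {..<m} \<ge> 399 / 400" using x True by simp
      hence "sqrt (real N) / 20 * (399 / 400) \<le> sqrt (real N) / 20 * L2_set big {..<m}"
        by (intro mult_left_mono) auto
      also have "\<dots> \<le> action_norm N m \<omega> big"
        unfolding big_def by (intro sp large_coordinates_sparse) (use \<gamma> x k0 in auto)
      also have "\<dots> \<le> action_norm N m \<omega> x + action_norm N m \<omega> (\<lambda>i. (-1) * small i)"
        using action_norm_split[of N m \<omega> big x] unfolding split' .
      also have "action_norm N m \<omega> (\<lambda>i. (-1) * small i) \<le> 8 * sqrt (real N) * (1 / 400)"
      proof -
        have "action_norm N m \<omega> (\<lambda>i. (-1) * small i) = action_norm N m \<omega> small"
          unfolding action_norm_scale by simp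
        also have "\<dots> \<le> 8 * sqrt (real N) * L2_set small {..<m}" by (rule up)
        also have "\<dots> \<le> 8 * sqrt (real N) * (1 / 400)" using True by (intro mult_left_mono) auto
        finally show ?thesis .
      qed
      finally have "sqrt (real N) * (1 / 100) \<le> action_norm N m \<omega> x"
        using real_sqrt_ge_zero[of "real N"] by linarith
      moreover have "\<gamma> / 2 * sqrt (real N) \<le> (1 / 100) * sqrt (real N)"
        using \<gamma> by (intro mult_right_mono) auto
      ultimately show ?thesis by simp
    next
      case False
      have "0 < \<gamma> / 16" "L2_set x {..<m} \<le> 1" using \<gamma> x by auto
      then obtain z where z: "z \<in> int_vectors m (real m / (\<gamma> / 16))"
        "\<And>i. i < m \<Longrightarrow> \<bar>\<gamma> / 16 / sqrt (real m) * z i\<bar> \<le> \<bar>x i\<bar>"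
        "L2_set (\<lambda>i. x i - \<gamma> / 16 / sqrt (real m) * z i) {..<m} \<le> \<gamma> / 16"
        using rounding_net[OF sparse_self[of m x] m] by blast
      define y where "y = (\<lambda>i. \<gamma> / 16 / sqrt (real m) * z i)"
      \<comment> \<open>Rounding towards zero turns small coordinates of x into small coordinates of
        the net point, whose spread part therefore has norm at least 1/400 - \<gamma>/16 \<ge>
        1/800.\<close>
      have "L2_set small {..<m} \<le> L2_set (\<lambda>i. if \<bar>x i\<bar> \<le> \<gamma>\<^sup>2 then y i else 0) {..<m}
          + L2_set (\<lambda>i. if \<bar>x i\<bar> \<le> \<gamma>\<^sup>2 then x i - y i else 0) {..<m}"
        by (rule order_trans[OF _ L2_set_triangle_ineq]) (auto simp: small_def intro!: L2_set_le_abs)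
      also have "L2_set (\<lambda>i. if \<bar>x i\<bar> \<le> \<gamma>\<^sup>2 then y i else 0) {..<m} \<le> L2_set (\<lambda>i. if \<bar>y i\<bar> \<le> \<gamma>\<^sup>2 then y i else 0) {..<m}"
      proof (rule L2_set_le_abs)
        fix i assume "i \<in> {..<m}"
        hence "\<bar>y i\<bar> \<le> \<bar>x i\<bar>" using z(2)[of i] unfolding y_def by simp
        thus "\<bar>if \<bar>x i\<bar> \<le> \<gamma>\<^sup>2 then y i else 0\<bar> \<le> \<bar>if \<bar>y i\<bar> \<le> \<gamma>\<^sup>2 then y i else 0\<bar>" by auto
      qed
      also have "L2_set (\<lambda>i. if \<bar>x i\<bar> \<le> \<gamma>\<^sup>2 then x i - y i else 0) {..<m} \<le> L2_set (\<lambda>i. x i - y i) {..<m}"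
        by (rule L2_set_le_abs) auto
      also have "\<dots> \<le> \<gamma> / 16" using z(3) by (simp add: y_def)
      finally have "1 / 800 \<le> L2_set (\<lambda>i. if \<bar>y i\<bar> \<le> \<gamma>\<^sup>2 then y i else 0) {..<m}"
        using False \<gamma> by simp
      hence "\<gamma> * sqrt (real N) \<le> action_norm N m \<omega> y"
        unfolding y_def by (rule net[OF z(1)])
      also have "\<dots> \<le> action_norm N m \<omega> x + action_norm N m \<omega> (\<lambda>i. y i - x i)"
        by (rule action_norm_split)
      also have "action_norm N m \<omega> (\<lambda>i. y i - x i) \<le> 8 * sqrt (real N) * L2_set (\<lambda>i. x i - y i) {..<m}"
        unfolding action_norm_minus[of N m \<omega> y] by (rule up)
      also have "\<dots> \<le> 8 * sqrt (real N) * (\<gamma> / 16)"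
        using z(3) by (intro mult_left_mono) (auto simp: y_def)
      finally show ?thesis by (simp add: mult_ac)
    qed
  qed
  show ?thesis
  proof (cases "L2_set x {..<m} = 0")
    case False
    hence pos: "L2_set x {..<m} > 0" using L2_set_nonneg[of x "{..<m}"] by linarith
    have "\<gamma> / 2 * sqrt (real N) \<le> action_norm N m \<omega> (\<lambda>i. inverse (L2_set x {..<m}) * x i)"
      using pos by (intro unit) (simp add: L2_set_scale)
    thus ?thesis using pos unfolding action_norm_scale by (simp add: field_simps)
  qed simp
qed

text \<open>A constant factor is bought by halving the rate and starting at a larger m.\<close>

lemma eventually_exp_absorb:
  fixes h A :: real
  assumes "h > 0"
  shows "\<exists>M. \<forall>m\<ge>M. A * exp (- (2 * h) * real m) \<le> exp (- h * real m)"
proof -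
  define A' where "A' = max A 1"
  have A': "A' > 0" "A \<le> A'" by (auto simp: A'_def)
  obtain M :: nat where M: "ln A' / h \<le> real M" using real_arch_simple by blast
  have "A * exp (- (2 * h) * real m) \<le> exp (- h * real m)" if "m \<ge> M" for m
  proof -
    have "ln A' / h \<le> real m" using M that by linarith
    hence "ln A' \<le> h * real m" using assms by (simp add: field_simps)
    have "A * exp (- (2 * h) * real m) \<le> A' * exp (- (2 * h) * real m)"
      using A' by (intro mult_right_mono) auto
    also have "\<dots> = exp (ln A' + - (2 * h) * real m)" unfolding exp_add using A' by simp
    also have "\<dots> \<le> exp (- h * real m)" using \<open>ln A' \<le> h * real m\<close> by simp
    finally show ?thesis .
  qed
  thus ?thesis by blast
qed

text \<open>The spread vectors dominate: (99/\<gamma>)^m net points against (2403 \<gamma>)^N with N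
  \<ge> 2 m leave (99 * 2403^2 * \<gamma>)^m, and \<gamma> = 10^(-10) makes the base less than
  1.\<close>

lemma smallest_singular_value:
  "\<exists>c>0. \<exists>h>0. \<exists>M. \<forall>m\<ge>M. \<forall>N\<ge>2 * m.
     sign_prob N m (\<lambda>\<omega>. \<exists>x. action_norm N m \<omega> x < c * sqrt (real N) * L2_set x {..<m}) \<le> exp (- h * real m)"
proof -
  define \<gamma> :: real where "\<gamma> = 1 / 10 ^ 10"
  have \<gamma>: "0 < \<gamma>" "\<gamma> \<le> 1 / 50" "\<gamma> \<le> 1 / 3" "2403 * \<gamma> \<le> 1" by (auto simp: \<gamma>_def)
  obtain k0 :: nat where k0': "1 / (\<gamma>\<^sup>2)\<^sup>2 \<le> real k0" using real_arch_simple by blast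
  have "0 < 1 / (\<gamma>\<^sup>2)\<^sup>2" using \<gamma> by simp
  hence k0: "1 \<le> k0" using k0' by (cases k0) auto
  \<comment> \<open>This makes 2 m / (exp s - 1) equal to m/10000, below the decay 2 m / 5000. The
    level k0 does not depend on m, so the other factor exp(160 k0 s) is a constant and goes into
    A.\<close>
  define s where "s = ln (20001 :: real)"
  have s: "s > 0" "exp s = 20001" by (auto simp: s_def)
  define A where "A = 2 + 2 * exp (160 * real k0 * s)"
  obtain M where M: "\<And>m. m \<ge> M \<Longrightarrow> A * exp (- (2 * (1/10000)) * real m) \<le> exp (- (1/10000) * real m)"
    using eventually_exp_absorb[of "1/10000" A] by auto
  have main: "sign_prob N m (\<lambda>\<omega>. \<exists>x. action_norm N m \<omega> x < \<gamma> / 2 * sqrt (real N) * L2_set x {..<m}) \<le> exp (- (1/10000) * real m)"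
    if m: "m \<ge> max M 1" and N: "N \<ge> 2 * m" for m N
  proof -
    have m1: "1 \<le> m" using m by simp
    have N': "2 * real m \<le> real N" using N by linarith
    let ?y = "\<lambda>z i. \<gamma> / 16 / sqrt (real m) * real_of_int (z i)"
    let ?U = "\<lambda>\<omega>. \<exists>x. sparse m m x \<and> action_norm N m \<omega> x > 8 * sqrt (real N) * L2_set x {..<m}"
    let ?S = "\<lambda>\<omega>. \<exists>x. sparse m k0 x \<and>
              (action_norm N m \<omega> x > 8 * sqrt (real N) * L2_set x {..<m} \<or>
               action_norm N m \<omega> x < sqrt (real N) / 20 * L2_set x {..<m})"
    let ?Q = "\<lambda>z \<omega>. 1 / 800 \<le> L2_set (\<lambda>i. if \<bar>?y z i\<bar> \<le> \<gamma>\<^sup>2 then ?y z i else 0) {..<m} \<and>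
        action_norm N m \<omega> (?y z) < \<gamma> * sqrt (real N)"
    let ?I = "\<lambda>\<omega>. \<exists>z\<in>int_vectors m (real m / (\<gamma> / 16)). ?Q z \<omega>"
    have "sign_prob N m (\<lambda>\<omega>. \<exists>x. action_norm N m \<omega> x < \<gamma> / 2 * sqrt (real N) * L2_set x {..<m})
       \<le> sign_prob N m (\<lambda>\<omega>. ?U \<omega> \<or> (?S \<omega> \<or> ?I \<omega>))"
    proof (rule sign_prob_mono, rule ccontr)
      fix \<omega> assume "\<exists>x. action_norm N m \<omega> x < \<gamma> / 2 * sqrt (real N) * L2_set x {..<m}"
        and no: "\<not> (?U \<omega> \<or> (?S \<omega> \<or> ?I \<omega>))"
      then obtain x where x: "action_norm N m \<omega> x < \<gamma> / 2 * sqrt (real N) * L2_set x {..<m}" by blast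
      have "\<gamma> / 2 * sqrt (real N) * L2_set x {..<m} \<le> action_norm N m \<omega> x"
      proof (rule action_lower_from_parts[OF m1 \<gamma>(1,2) k0'])
        show "action_norm N m \<omega> x \<le> 8 * sqrt (real N) * L2_set x {..<m}" for x
          using no sparse_self[of m x] by (meson not_less)
        show "sqrt (real N) / 20 * L2_set x {..<m} \<le> action_norm N m \<omega> x" if "sparse m k0 x" for x
          using no that by (meson not_less)
        show "\<gamma> * sqrt (real N) \<le> action_norm N m \<omega> (?y z)"
          if "z \<in> int_vectors m (real m / (\<gamma> / 16))"
            "1 / 800 \<le> L2_set (\<lambda>i. if \<bar>?y z i\<bar> \<le> \<gamma>\<^sup>2 then ?y z i else 0) {..<m}" for z
          using no that by (meson not_less)
      qed
      thus False using x by linarith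
    qed
    also have "\<dots> \<le> sign_prob N m ?U + (sign_prob N m ?S + sign_prob N m ?I)"
      using sign_prob_disj[of N m ?U "\<lambda>\<omega>. ?S \<omega> \<or> ?I \<omega>"] sign_prob_disj[of N m ?S ?I] by linarith
    also have "sign_prob N m ?U \<le> real (card (int_vectors m (2 * real m))) * exp (- 3 * real N)"
      by (rule action_upper_sparse[OF m1])
    also have "real (card (int_vectors m (2 * real m))) * exp (- 3 * real N) \<le> exp (4 * real m) * exp (- 3 * (2 * real m))"
      using N' by (intro mult_mono card_int_vectors_double) auto
    also have "\<dots> \<le> exp (- (2 * (1/10000)) * real m)"
      unfolding exp_add[symmetric] by simp
    also have "sign_prob N m ?S \<le> 2 * real (card (int_vectors m (160 * real k0))) * exp (- real N / 5000)"
      by (rule action_sparse[OF k0])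
    also have "\<dots> \<le> 2 * exp (160 * real k0 * s + real m / 10000) * exp (- (2 * real m) / 5000)"
    proof (intro mult_mono)
      have "real (card (int_vectors m (160 * real k0))) \<le> exp (s * (160 * real k0) + 2 * real m / (exp s - 1))"
        by (rule card_int_vectors_exp[OF s(1)])
      thus "real (card (int_vectors m (160 * real k0))) \<le> exp (160 * real k0 * s + real m / 10000)"
        unfolding s(2) by (simp add: mult_ac)
    qed (use N' in auto)
    also have "\<dots> = 2 * exp (160 * real k0 * s) * exp (- 3 / 10000 * real m)"
      by (simp add: exp_add[symmetric] del: exp_add)
    also have "\<dots> \<le> 2 * exp (160 * real k0 * s) * exp (- (2 * (1/10000)) * real m)"
      by (intro mult_left_mono) auto
    also have "sign_prob N m ?I \<le> real (card (int_vectors m (real m / (\<gamma> / 16)))) * (2403 * \<gamma>) ^ N"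
      by (rule sign_prob_union_if[OF _ _ action_lower_spread_fixed[OF \<gamma>(1,3)]]) (use \<gamma> in simp_all)
    also have "\<dots> \<le> (99 / \<gamma>) ^ m * (2403 * \<gamma>) ^ (2 * m)"
    proof (intro mult_mono)
      \<comment> \<open>The counting parameter is the mesh parameter \<gamma>/16, for which exp(s L)
        is just e^m.\<close>
      have "real (card (int_vectors m (real m / (\<gamma> / 16)))) \<le> exp (\<gamma> / 16 * (real m / (\<gamma> / 16))) * (1 + 2 / (exp (\<gamma> / 16) - 1)) ^ m"
        using \<gamma> by (intro card_int_vectors) auto
      also have "\<dots> \<le> 3 ^ m * (33 / \<gamma>) ^ m"
      proof (intro mult_mono power_mono)
        have "exp (\<gamma> / 16 * (real m / (\<gamma> / 16))) = exp 1 ^ m"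
          using \<gamma> by (simp add: exp_of_nat_mult[symmetric])
        also have "\<dots> \<le> 3 ^ m" using exp_le by (intro power_mono) auto
        finally show "exp (\<gamma> / 16 * (real m / (\<gamma> / 16))) \<le> 3 ^ m" .
        have "\<gamma> / 16 \<le> exp (\<gamma> / 16) - 1"
          using exp_ge_add_one_self[of "\<gamma> / 16"] by linarith
        hence "2 / (exp (\<gamma> / 16) - 1) \<le> 2 / (\<gamma> / 16)"
          using \<gamma> by (intro divide_left_mono mult_pos_pos) auto
        also have "2 / (\<gamma> / 16) = 32 / \<gamma>" by simp
        finally have "2 / (exp (\<gamma> / 16) - 1) \<le> 32 / \<gamma>" .
        moreover have "1 \<le> 1 / \<gamma>" using \<gamma> by simp
        moreover have "33 / \<gamma> = 1 / \<gamma> + 32 / \<gamma>" by (simp add: add_divide_distrib[symmetric])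
        ultimately show "1 + 2 / (exp (\<gamma> / 16) - 1) \<le> 33 / \<gamma>" by linarith
      qed (use \<gamma> in \<open>auto intro!: add_nonneg_nonneg\<close>)
      also have "\<dots> = (99 / \<gamma>) ^ m" by (simp add: power_mult_distrib[symmetric])
      finally show "real (card (int_vectors m (real m / (\<gamma> / 16)))) \<le> (99 / \<gamma>) ^ m" .
      show "(2403 * \<gamma>) ^ N \<le> (2403 * \<gamma>) ^ (2 * m)"
        using \<gamma> N by (intro power_decreasing) auto
    qed (use \<gamma> in auto)
    also have "\<dots> = (99 / \<gamma> * (2403 * \<gamma>)\<^sup>2) ^ m"
      by (simp only: power_mult_distrib power_mult)
    also have "\<dots> \<le> (1 - 1/5000) ^ m"
      by (intro power_mono) (auto simp: \<gamma>_def power2_eq_square)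
    also have "\<dots> \<le> exp (- (1/5000)) ^ m"
      using exp_ge_add_one_self[of "- (1/5000) :: real"] by (intro power_mono) auto
    also have "\<dots> = exp (- (2 * (1/10000)) * real m)"
      by (simp add: exp_of_nat_mult[symmetric])
    finally have "sign_prob N m (\<lambda>\<omega>. \<exists>x. action_norm N m \<omega> x < \<gamma> / 2 * sqrt (real N) * L2_set x {..<m})
        \<le> A * exp (- (2 * (1/10000)) * real m)"
      by (simp add: A_def algebra_simps)
    also have "\<dots> \<le> exp (- (1/10000) * real m)" by (rule M) (use m in simp)
    finally show ?thesis .
  qed
  show ?thesis
    by (rule exI[of _ "\<gamma> / 2"], rule conjI, use \<gamma> in simp, rule exI[of _ "1/10000"], rule conjI, simp,
        rule exI[of _ "max M 1"]) (use main in blast)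
qed

subsection \<open>Riesz products\<close>

text \<open>Separates the mean from the fluctuations: the average of exp(sY) is at most s times the
  mean of Y plus the average of exp((sY)^2), and Y need neither be bounded nor centred.\<close>

lemma exp_le_add_exp_square: "exp y \<le> y + exp (y\<^sup>2 :: real)"
proof -
  have e2: "1 + y\<^sup>2 \<le> exp (y\<^sup>2)" by (rule exp_ge_add_one_self)
  consider "y > 1" | "0 \<le> y" "y \<le> 1" | "y < 0" "y \<ge> -1" | "y < -1" by linarith
  thus ?thesis
  proof cases
    case 1
    hence "y \<le> y\<^sup>2" by (simp add: power2_eq_square)
    hence "exp y \<le> exp (y\<^sup>2)" by simp
    thus ?thesis using 1 by linarith
  next
    case 2
    thus ?thesis using exp_bound[of y] e2 by linarith
  next
    case 3
    define x where "x = - y"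
    have x: "0 < x" "x \<le> 1" using 3 by (auto simp: x_def)
    \<comment> \<open>For -1 \<le> y < 0 the goal follows from exp y \<le> 1 + y + y^2; this is
      checked after multiplication by a lower Taylor polynomial of exp(-y).\<close>
    have "1 + x + x\<^sup>2 / 2 \<le> exp x" using x by (intro exp_lower_Taylor_quadratic) auto
    hence "(1 - x + x\<^sup>2) * (1 + x + x\<^sup>2 / 2) \<le> (1 - x + x\<^sup>2) * exp x"
      using x by (intro mult_left_mono) auto
    moreover have "(1 - x + x\<^sup>2) * (1 + x + x\<^sup>2 / 2) = 1 + x\<^sup>2 / 2 + x ^ 3 / 2 + x ^ 4 / 2"
      by (simp add: field_simps power2_eq_square power3_eq_cube power4_eq_xxxx)
    moreover have "0 \<le> x\<^sup>2 / 2 + x ^ 3 / 2 + x ^ 4 / 2" using x by simp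
    ultimately have "1 \<le> (1 - x + x\<^sup>2) * exp x" by linarith
    hence "exp (- x) * 1 \<le> exp (- x) * ((1 - x + x\<^sup>2) * exp x)" by (intro mult_left_mono) auto
    also have "\<dots> = 1 - x + x\<^sup>2" by (simp add: exp_minus field_simps)
    finally have "exp y \<le> 1 + y + y\<^sup>2" by (simp add: x_def)
    thus ?thesis using e2 by linarith
  next
    case 4
    have "exp y \<le> 1" using 4 by simp
    moreover have "- y \<le> y\<^sup>2" using 4 mult_left_mono_neg[of y "-1" y] by (simp add: power2_eq_square)
    ultimately show ?thesis using e2 by linarith
  qed
qed

text \<open>Chord of a convex function. It turns an exponential moment at scale 1 into a bound 1 +
  O(p) at scale p.\<close>

lemma exp_scaled_le: "0 \<le> p \<Longrightarrow> p \<le> 1 \<Longrightarrow> exp (p * W) \<le> 1 + p * (exp W - 1 :: real)"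
  using convex_onD[OF exp_convex, of p 0 W] by (simp add: algebra_simps)

text \<open>The excess 1 over the mean gains s in the exponent, while the second order costs 4 (s
  T)^2 = s/2. The choice s = 1/(8 T^2) thus leaves the rate s/2 = 1/(16 T^2).\<close>

lemma iid_sum_tail:
  fixes Y :: "(nat \<Rightarrow> real) \<Rightarrow> real"
  assumes T: "T \<ge> 1" and s: "s = 1 / (8 * T\<^sup>2)"
    and mean: "sign_average m Y \<le> \<mu>"
    and sub: "sign_average m (\<lambda>x. exp ((s * Y x)\<^sup>2)) \<le> exp (2 * (s * T)\<^sup>2)"
  shows "sign_prob N m (\<lambda>\<omega>. (\<Sum>j<N. Y (\<omega> j)) > real N * (\<mu> + 1)) \<le> exp (- real N / (16 * T\<^sup>2))"
proof -
  have s0: "s > 0" using T by (simp add: s)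
  let ?F = "\<lambda>x. exp (- (s * (\<mu> + 1))) * exp (s * Y x)"
  have "sign_prob N m (\<lambda>\<omega>. (\<Sum>j<N. Y (\<omega> j)) > real N * (\<mu> + 1)) \<le> sign_average m ?F ^ N"
  proof (rule sign_prob_le_power)
    fix \<omega> assume "(\<Sum>j<N. Y (\<omega> j)) > real N * (\<mu> + 1)"
    hence "s * (real N * (\<mu> + 1)) \<le> s * (\<Sum>j<N. Y (\<omega> j))" using s0 by (intro mult_left_mono) auto
    hence "0 \<le> (\<Sum>j<N. - (s * (\<mu> + 1)) + s * Y (\<omega> j))"
      unfolding sum.distrib sum_distrib_left[symmetric] by (simp add: mult_ac)
    hence "1 \<le> exp (\<Sum>j<N. - (s * (\<mu> + 1)) + s * Y (\<omega> j))" by simp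
    thus "1 \<le> (\<Prod>j<N. ?F (\<omega> j))"
      unfolding exp_sum[OF finite_lessThan] exp_add .
  qed auto
  also have "\<dots> \<le> exp (- 1 / (16 * T\<^sup>2)) ^ N"
  proof (intro power_mono)
    have sT: "(s * T)\<^sup>2 = 1 / (64 * T\<^sup>2)" using T by (simp add: s power2_eq_square field_simps)
    have T2: "T\<^sup>2 \<ge> 1" using T by (simp add: one_le_power)
    have "1 / (64 * T\<^sup>2) \<le> 1 / 64" using T2 by (intro divide_left_mono) auto
    hence u: "0 \<le> 2 * (s * T)\<^sup>2" "2 * (s * T)\<^sup>2 \<le> 1" unfolding sT by auto
    have "sign_average m (\<lambda>x. exp (s * Y x)) \<le> sign_average m (\<lambda>x. s * Y x + exp ((s * Y x)\<^sup>2))"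
      by (intro sign_average_mono exp_le_add_exp_square)
    also have "\<dots> = s * sign_average m Y + sign_average m (\<lambda>x. exp ((s * Y x)\<^sup>2))"
      by (simp only: sign_average_add sign_average_cmult)
    also have "\<dots> \<le> s * \<mu> + exp (2 * (s * T)\<^sup>2)"
      using mean sub s0 by (intro add_mono mult_left_mono) auto
    also have "exp (2 * (s * T)\<^sup>2) \<le> 1 + 4 * (s * T)\<^sup>2"
    proof -
      have "exp (2 * (s * T)\<^sup>2) \<le> 1 + 2 * (s * T)\<^sup>2 + (2 * (s * T)\<^sup>2)\<^sup>2"
        using u by (intro exp_bound)
      moreover have "(2 * (s * T)\<^sup>2)\<^sup>2 \<le> 2 * (s * T)\<^sup>2"
        using u mult_left_mono[OF u(2) u(1)] by (simp add: power2_eq_square)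
      ultimately show ?thesis by linarith
    qed
    also have "s * \<mu> + (1 + 4 * (s * T)\<^sup>2) \<le> exp (s * \<mu> + 4 * (s * T)\<^sup>2)"
      using exp_ge_add_one_self[of "s * \<mu> + 4 * (s * T)\<^sup>2"] by linarith
    finally have "sign_average m ?F \<le> exp (- (s * (\<mu> + 1))) * exp (s * \<mu> + 4 * (s * T)\<^sup>2)"
      unfolding sign_average_cmult by (intro mult_left_mono) auto
    also have "\<dots> = exp (- s + 4 * (s * T)\<^sup>2)"
      by (simp add: exp_add[symmetric] algebra_simps del: exp_add)
    also have "- s + 4 * (s * T)\<^sup>2 = - 1 / (16 * T\<^sup>2)"
      unfolding sT s using T by (simp add: field_simps)
    finally show "sign_average m ?F \<le> exp (- 1 / (16 * T\<^sup>2))" .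
  qed (auto intro!: sign_average_nonneg)
  also have "\<dots> = exp (- real N / (16 * T\<^sup>2))"
    by (simp add: exp_of_nat_mult[symmetric])
  finally show ?thesis .
qed

definition riesz :: "nat \<Rightarrow> real \<Rightarrow> (nat \<Rightarrow> real) \<Rightarrow> (nat \<Rightarrow> real) \<Rightarrow> real" where
  "riesz m \<tau> r x = (\<Prod>i<m. 1 + \<tau> * r i * x i)"

text \<open>Bounded weights are needed for the tail bounds. Values above T are discarded, so the
  loss is at most w^2/T and is controlled by moments of the untruncated weight w.\<close>

definition riesz_trunc :: "nat \<Rightarrow> real \<Rightarrow> (nat \<Rightarrow> real) \<Rightarrow> real \<Rightarrow> (nat \<Rightarrow> real) \<Rightarrow> real" where
  "riesz_trunc m \<tau> r T x = (if riesz m \<tau> r x \<le> T then riesz m \<tau> r x else 0)"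

context
  fixes m :: nat and \<tau> :: real and r :: "nat \<Rightarrow> real"
  assumes lam: "0 < \<tau>" "\<tau> \<le> 1" and r: "\<And>i. i < m \<Longrightarrow> \<bar>r i\<bar> \<le> 1"
begin

lemma riesz_nonneg: "x \<in> sign_vectors m \<Longrightarrow> 0 \<le> riesz m \<tau> r x"
  unfolding riesz_def
proof (intro prod_nonneg)
  fix i assume "x \<in> sign_vectors m" "i \<in> {..<m}"
  hence "\<bar>\<tau> * r i * x i\<bar> = \<tau> * \<bar>r i\<bar>" using lam by (simp add: abs_mult abs_sign_vector)
  also have "\<dots> \<le> 1 * 1" using lam r[of i] \<open>i \<in> {..<m}\<close> by (intro mult_mono) auto
  finally show "0 \<le> 1 + \<tau> * r i * x i" by linarith
qed

lemma riesz_mean: "sign_average m (riesz m \<tau> r) = 1"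
  unfolding riesz_def[abs_def] by (subst sign_average_prod) simp

text \<open>Every factor other than the i-th averages to 1.\<close>

lemma riesz_coordinate:
  assumes "i < m"
  shows "sign_average m (\<lambda>x. riesz m \<tau> r x * x i) = \<tau> * r i"
proof -
  let ?F = "\<lambda>l x. (1 + \<tau> * r l * x) * (if l = i then x else 1)"
  have "sign_average m (\<lambda>x. riesz m \<tau> r x * x i) = sign_average m (\<lambda>x. \<Prod>l<m. ?F l (x l))"
    unfolding riesz_def prod.distrib using assms by (intro sign_average_cong) (simp add: prod.delta')
  also have "\<dots> = (\<Prod>l<m. (?F l 1 + ?F l (-1)) / 2)" by (rule sign_average_prod)
  also have "\<dots> = (\<Prod>l<m. if l = i then \<tau> * r i else 1)" by (intro prod.cong) auto
  also have "\<dots> = \<tau> * r i" using assms by simp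
  finally show ?thesis .
qed

lemma riesz_linear: "sign_average m (\<lambda>x. riesz m \<tau> r x * dot m \<theta> x) = \<tau> * dot m \<theta> r"
proof -
  have "sign_average m (\<lambda>x. riesz m \<tau> r x * dot m \<theta> x)
      = sign_average m (\<lambda>x. \<Sum>i<m. \<theta> i * (riesz m \<tau> r x * x i))"
    by (simp add: dot_def sum_distrib_left mult_ac)
  also have "\<dots> = (\<Sum>i<m. \<theta> i * (\<tau> * r i))"
    unfolding sign_average_sum sign_average_cmult by (intro sum.cong) (auto simp: riesz_coordinate)
  also have "\<dots> = \<tau> * dot m \<theta> r" by (simp add: dot_def sum_distrib_left mult_ac)
  finally show ?thesis .
qed

text \<open>With t = \<tau> r_i, one factor averages to 1 + 6 t^2 + t^4, and t^4 \<le> \<tau>^2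
  because \<tau> \<le> 1.\<close>

lemma riesz_fourth: "sign_average m (\<lambda>x. riesz m \<tau> r x ^ 4) \<le> exp (7 * \<tau>\<^sup>2 * real m)"
proof -
  have "sign_average m (\<lambda>x. riesz m \<tau> r x ^ 4) = sign_average m (\<lambda>x. \<Prod>i<m. (1 + \<tau> * r i * x i) ^ 4)"
    unfolding riesz_def by (simp add: prod_power_distrib)
  also have "\<dots> = (\<Prod>i<m. ((1 + \<tau> * r i * 1) ^ 4 + (1 + \<tau> * r i * (-1)) ^ 4) / 2)"
    by (rule sign_average_prod)
  also have "\<dots> \<le> (\<Prod>i<m. exp (7 * \<tau>\<^sup>2))"
  proof (intro prod_mono conjI)
    fix i assume i: "i \<in> {..<m}"
    define t where "t = \<tau> * r i"
    have "\<bar>t\<bar> = \<tau> * \<bar>r i\<bar>" using lam by (simp add: t_def abs_mult)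
    also have "\<dots> \<le> \<tau> * 1" using lam r[of i] i by (intro mult_left_mono) auto
    finally have "\<bar>t\<bar> \<le> \<bar>\<tau>\<bar>" using lam by simp
    hence t2: "t\<^sup>2 \<le> \<tau>\<^sup>2" by (simp add: abs_le_square_iff)
    have "\<tau>\<^sup>2 \<le> 1" using lam by (simp add: power_le_one)
    hence "t\<^sup>2 * t\<^sup>2 \<le> 1 * \<tau>\<^sup>2" using t2 by (intro mult_mono) auto
    hence "1 + 6 * t\<^sup>2 + t\<^sup>2 * t\<^sup>2 \<le> 1 + 7 * \<tau>\<^sup>2" using t2 by linarith
    also have "\<dots> \<le> exp (7 * \<tau>\<^sup>2)" by (rule exp_ge_add_one_self)
    finally show "((1 + \<tau> * r i * 1) ^ 4 + (1 + \<tau> * r i * (-1)) ^ 4) / 2 \<le> exp (7 * \<tau>\<^sup>2)"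
      unfolding mult_minus_right mult_1_right t_def[symmetric]
      by (simp add: power4_eq_xxxx power2_eq_square algebra_simps)
    show "0 \<le> ((1 + \<tau> * r i * 1) ^ 4 + (1 + \<tau> * r i * (-1)) ^ 4) / 2"
      by (intro divide_nonneg_nonneg add_nonneg_nonneg zero_le_even_power) auto
  qed
  also have "\<dots> = exp (7 * \<tau>\<^sup>2 * real m)"
    by (simp add: exp_of_nat_mult[symmetric] mult_ac)
  finally show ?thesis .
qed

lemma riesz_trunc_bounds:
  assumes "x \<in> sign_vectors m" "T \<ge> 1"
  shows "0 \<le> riesz_trunc m \<tau> r T x" "riesz_trunc m \<tau> r T x \<le> T"
    "riesz_trunc m \<tau> r T x \<le> riesz m \<tau> r x"
    "riesz m \<tau> r x - riesz_trunc m \<tau> r T x \<le> (riesz m \<tau> r x)\<^sup>2 / T"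
proof -
  let ?w = "riesz m \<tau> r x"
  have w: "0 \<le> ?w" by (rule riesz_nonneg[OF assms(1)])
  show "0 \<le> riesz_trunc m \<tau> r T x" "riesz_trunc m \<tau> r T x \<le> T" "riesz_trunc m \<tau> r T x \<le> ?w"
    using w assms by (auto simp: riesz_trunc_def)
  show "?w - riesz_trunc m \<tau> r T x \<le> ?w\<^sup>2 / T"
  proof (cases "?w \<le> T")
    case True
    thus ?thesis using assms by (simp add: riesz_trunc_def)
  next
    case False
    hence "?w * T \<le> ?w * ?w" using w by (intro mult_left_mono) auto
    thus ?thesis using False assms by (simp add: riesz_trunc_def field_simps power2_eq_square)
  qed
qed

text \<open>T is the square root of the bound on the fourth moment. The truncation loss (w^2/T) |Z|,
  with w the weight and Z the linear form, is at most w^4/(2 T^2) + Z^2/2, whose averages are at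
  most 1/2 and 1.\<close>

lemma riesz_trunc_linear:
  assumes T: "T = exp (7 * \<tau>\<^sup>2 * real m / 2)" and \<theta>: "L2_set \<theta> {..<m} \<le> 1"
  shows "sign_average m (\<lambda>x. riesz_trunc m \<tau> r T x * dot m \<theta> x) \<le> \<tau> * dot m \<theta> r + 2"
proof -
  have T1: "T \<ge> 1" unfolding T by simp
  have \<theta>2: "(\<Sum>i<m. (\<theta> i)\<^sup>2) \<le> 1" using \<theta> by (simp add: L2_set_def)
  have amgm: "a * b \<le> (a\<^sup>2 + b\<^sup>2) / 2" for a b :: real
    using sum_squares_bound[of a b] by simp
  have Z2: "sign_average m (\<lambda>x. (dot m \<theta> x)\<^sup>2) \<le> 2"
  proof -
    have "sign_average m (\<lambda>x. (dot m \<theta> x)\<^sup>2) \<le> sign_average m (\<lambda>x. 4 * exp ((dot m \<theta> x)\<^sup>2 / 4) - 4)"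
    proof (intro sign_average_mono)
      fix x
      show "(dot m \<theta> x)\<^sup>2 \<le> 4 * exp ((dot m \<theta> x)\<^sup>2 / 4) - 4"
        using exp_ge_add_one_self[of "(dot m \<theta> x)\<^sup>2 / 4"] by linarith
    qed
    also have "\<dots> = 4 * sign_average m (\<lambda>x. exp ((dot m \<theta> x)\<^sup>2 / 4)) - 4"
      by (simp only: sign_average_diff sign_average_cmult sign_average_const)
    also have "sign_average m (\<lambda>x. exp ((dot m \<theta> x)\<^sup>2 / 4)) \<le> sqrt 2"
      unfolding dot_def by (rule sign_average_exp_square_le[OF \<theta>2])
    also have "sqrt 2 \<le> 3 / 2" by (rule real_le_lsqrt) (auto simp: power2_eq_square)
    finally show ?thesis by simp
  qed
  have "sign_average m (\<lambda>x. riesz_trunc m \<tau> r T x * dot m \<theta> x)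
     \<le> sign_average m (\<lambda>x. riesz m \<tau> r x * dot m \<theta> x + (1 / (2 * T\<^sup>2) * riesz m \<tau> r x ^ 4 + 1 / 2 * (dot m \<theta> x)\<^sup>2))"
  proof (intro sign_average_mono)
    fix x assume x: "x \<in> sign_vectors m"
    let ?w = "riesz m \<tau> r x" and ?v = "riesz_trunc m \<tau> r T x" and ?Z = "dot m \<theta> x"
    note b = riesz_trunc_bounds[OF x T1]
    have "(?v - ?w) * ?Z \<le> \<bar>?v - ?w\<bar> * \<bar>?Z\<bar>" by (simp add: abs_mult[symmetric])
    also have "\<dots> \<le> (?w\<^sup>2 / T) * \<bar>?Z\<bar>" using b by (intro mult_right_mono) auto
    also have "\<dots> \<le> ((?w\<^sup>2 / T)\<^sup>2 + \<bar>?Z\<bar>\<^sup>2) / 2"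
      by (rule amgm)
    also have "\<dots> = 1 / (2 * T\<^sup>2) * ?w ^ 4 + 1 / 2 * ?Z\<^sup>2"
      by (simp add: power_divide add_divide_distrib)
    finally show "?v * ?Z \<le> ?w * ?Z + (1 / (2 * T\<^sup>2) * ?w ^ 4 + 1 / 2 * ?Z\<^sup>2)"
      by (simp add: algebra_simps)
  qed
  also have "\<dots> = \<tau> * dot m \<theta> r + (1 / (2 * T\<^sup>2) * sign_average m (\<lambda>x. riesz m \<tau> r x ^ 4) + 1 / 2 * sign_average m (\<lambda>x. (dot m \<theta> x)\<^sup>2))"
    by (simp only: sign_average_add sign_average_cmult riesz_linear)
  also have "\<dots> \<le> \<tau> * dot m \<theta> r + (1 / (2 * T\<^sup>2) * T\<^sup>2 + 1 / 2 * 2)"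
  proof (intro add_left_mono add_mono mult_left_mono Z2)
    have "T\<^sup>2 = exp (7 * \<tau>\<^sup>2 * real m)" unfolding T by (simp add: exp_double[symmetric])
    thus "sign_average m (\<lambda>x. riesz m \<tau> r x ^ 4) \<le> T\<^sup>2" using riesz_fourth by simp
  qed auto
  also have "1 / (2 * T\<^sup>2) * T\<^sup>2 + 1 / 2 * 2 \<le> (2::real)" using T1 by simp
  finally show ?thesis by simp
qed

lemma riesz_trunc_sum_tail:
  assumes T: "T = exp (7 * \<tau>\<^sup>2 * real m / 2)"
  shows "sign_prob N m (\<lambda>\<omega>. (\<Sum>j<N. riesz_trunc m \<tau> r T (\<omega> j)) > real N * 2) \<le> exp (- real N / (16 * T\<^sup>2))"
proof -
  have T1: "T \<ge> 1" unfolding T by simp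
  define s where "s = 1 / (8 * T\<^sup>2)"
  have "sign_prob N m (\<lambda>\<omega>. (\<Sum>j<N. riesz_trunc m \<tau> r T (\<omega> j)) > real N * (1 + 1)) \<le> exp (- real N / (16 * T\<^sup>2))"
  proof (rule iid_sum_tail[OF T1 s_def])
    have "sign_average m (riesz_trunc m \<tau> r T) \<le> sign_average m (riesz m \<tau> r)"
      using riesz_trunc_bounds[OF _ T1] by (intro sign_average_mono) auto
    thus "sign_average m (riesz_trunc m \<tau> r T) \<le> 1" by (simp add: riesz_mean)
    have "sign_average m (\<lambda>x. exp ((s * riesz_trunc m \<tau> r T x)\<^sup>2)) \<le> sign_average m (\<lambda>x. exp (2 * (s * T)\<^sup>2))"
    proof (intro sign_average_mono)
      fix x assume x: "x \<in> sign_vectors m"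
      have "(s * riesz_trunc m \<tau> r T x)\<^sup>2 \<le> (s * T)\<^sup>2"
        using riesz_trunc_bounds[OF x T1] by (intro power_mono mult_left_mono) (auto simp: s_def)
      also have "\<dots> \<le> 2 * (s * T)\<^sup>2" using zero_le_power2[of "s * T"] by linarith
      finally show "exp ((s * riesz_trunc m \<tau> r T x)\<^sup>2) \<le> exp (2 * (s * T)\<^sup>2)" by simp
    qed
    thus "sign_average m (\<lambda>x. exp ((s * riesz_trunc m \<tau> r T x)\<^sup>2)) \<le> exp (2 * (s * T)\<^sup>2)" by simp
  qed
  thus ?thesis by simp
qed

text \<open>The linear form is not bounded uniformly in m, so its exponential square moment takes
  over: (sY)^2 \<le> p Z^2/4 with p = 4 (s T)^2, and convexity with sqrt 2 \<le> 3/2 gives 1 + p/2 =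
  1 + 2 (s T)^2.\<close>

lemma riesz_trunc_linear_tail:
  assumes T: "T = exp (7 * \<tau>\<^sup>2 * real m / 2)" and \<theta>: "L2_set \<theta> {..<m} \<le> 1"
  shows "sign_prob N m (\<lambda>\<omega>. (\<Sum>j<N. riesz_trunc m \<tau> r T (\<omega> j) * dot m \<theta> (\<omega> j)) > real N * (\<tau> * dot m \<theta> r + 3))
           \<le> exp (- real N / (16 * T\<^sup>2))"
proof -
  have T1: "T \<ge> 1" unfolding T by simp
  have \<theta>2: "(\<Sum>i<m. (\<theta> i)\<^sup>2) \<le> 1" using \<theta> by (simp add: L2_set_def)
  define s where "s = 1 / (8 * T\<^sup>2)"
  define p where "p = 4 * (s * T)\<^sup>2"
  have T2: "T\<^sup>2 \<ge> 1" using T1 by (simp add: one_le_power)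
  have "p = 1 / (16 * T\<^sup>2)" using T1 by (simp add: p_def s_def power2_eq_square field_simps)
  moreover have "1 / (16 * T\<^sup>2) \<le> 1 / 1" using T2 by (intro divide_left_mono) auto
  ultimately have p: "0 \<le> p" "p \<le> 1" by auto
  let ?Y = "\<lambda>x. riesz_trunc m \<tau> r T x * dot m \<theta> x"
  have "sign_prob N m (\<lambda>\<omega>. (\<Sum>j<N. ?Y (\<omega> j)) > real N * ((\<tau> * dot m \<theta> r + 2) + 1)) \<le> exp (- real N / (16 * T\<^sup>2))"
  proof (rule iid_sum_tail[OF T1 s_def riesz_trunc_linear[OF T \<theta>]])
    have "sign_average m (\<lambda>x. exp ((s * ?Y x)\<^sup>2)) \<le> sign_average m (\<lambda>x. (1 - p) + p * exp ((dot m \<theta> x)\<^sup>2 / 4))"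
    proof (intro sign_average_mono)
      fix x assume x: "x \<in> sign_vectors m"
      have "(s * ?Y x)\<^sup>2 = (s * riesz_trunc m \<tau> r T x)\<^sup>2 * (dot m \<theta> x)\<^sup>2"
        by (simp add: power_mult_distrib)
      also have "\<dots> \<le> (s * T)\<^sup>2 * (dot m \<theta> x)\<^sup>2"
        using riesz_trunc_bounds[OF x T1] by (intro mult_right_mono power_mono mult_left_mono) (auto simp: s_def)
      also have "\<dots> = p * ((dot m \<theta> x)\<^sup>2 / 4)" by (simp add: p_def)
      finally have "exp ((s * ?Y x)\<^sup>2) \<le> exp (p * ((dot m \<theta> x)\<^sup>2 / 4))" by simp
      also have "\<dots> \<le> 1 + p * (exp ((dot m \<theta> x)\<^sup>2 / 4) - 1)"
        by (rule exp_scaled_le[OF p])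
      finally show "exp ((s * ?Y x)\<^sup>2) \<le> (1 - p) + p * exp ((dot m \<theta> x)\<^sup>2 / 4)"
        by (simp add: algebra_simps)
    qed
    also have "\<dots> = (1 - p) + p * sign_average m (\<lambda>x. exp ((dot m \<theta> x)\<^sup>2 / 4))"
      by (simp only: sign_average_add sign_average_cmult sign_average_const)
    also have "sign_average m (\<lambda>x. exp ((dot m \<theta> x)\<^sup>2 / 4)) \<le> sqrt 2"
      unfolding dot_def by (rule sign_average_exp_square_le[OF \<theta>2])
    also have "sqrt 2 \<le> 3 / 2" by (rule real_le_lsqrt) (auto simp: power2_eq_square)
    also have "(1 - p) + p * (3 / 2) = 1 + 2 * (s * T)\<^sup>2" by (simp add: p_def)
    also have "\<dots> \<le> exp (2 * (s * T)\<^sup>2)" by (rule exp_ge_add_one_self)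
    finally show "sign_average m (\<lambda>x. exp ((s * ?Y x)\<^sup>2)) \<le> exp (2 * (s * T)\<^sup>2)"
      using p by (simp add: mult_left_mono)
  qed
  thus ?thesis by (simp add: add.assoc)
qed

end


text \<open>Duality: the norm of V is its product with its own direction. Replacing the direction by
  a net point costs at most half of the norm, which moves to the left-hand side.\<close>

lemma L2_set_le_from_net:
  assumes m: "1 \<le> m"
    and net: "\<And>z. z \<in> int_vectors m (2 * real m) \<Longrightarrow> L2_set (\<lambda>i. 1 / 2 / sqrt (real m) * z i) {..<m} \<le> 1
           \<Longrightarrow> dot m (\<lambda>i. 1 / 2 / sqrt (real m) * z i) V \<le> v"
  shows "L2_set V {..<m} \<le> 2 * v"
proof (cases "L2_set V {..<m} = 0")
  case True
  \<comment> \<open>The zero vector of the net forces v to be nonnegative, which settles V =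
    0.\<close>
  have "(\<lambda>i\<in>{..<m}. 0) \<in> int_vectors m (2 * real m)" by (simp add: int_vectors_def)
  from net[OF this] have "0 \<le> v" by (simp add: dot_def L2_set_def)
  thus ?thesis using True by simp
next
  case False
  define l where "l = L2_set V {..<m}"
  have l: "l > 0" using False L2_set_nonneg[of V "{..<m}"] unfolding l_def by linarith
  define \<theta> where "\<theta> = (\<lambda>i. inverse l * V i)"
  have "L2_set \<theta> {..<m} \<le> 1" using l by (simp add: \<theta>_def L2_set_scale l_def[symmetric])
  moreover have "(0::real) < 1 / 2" by simp
  ultimately obtain z where z: "z \<in> int_vectors m (real m / (1 / 2))"
      "\<And>i. i < m \<Longrightarrow> \<bar>1 / 2 / sqrt (real m) * z i\<bar> \<le> \<bar>\<theta> i\<bar>"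
      "L2_set (\<lambda>i. \<theta> i - 1 / 2 / sqrt (real m) * z i) {..<m} \<le> 1 / 2"
    using rounding_net[OF sparse_self[of m \<theta>] m] by blast
  define y where "y = (\<lambda>i. 1 / 2 / sqrt (real m) * z i)"
  have "L2_set y {..<m} \<le> L2_set \<theta> {..<m}"
    unfolding y_def by (rule L2_set_le_abs) (rule z(2), simp)
  hence "dot m y V \<le> v"
    unfolding y_def using \<open>L2_set \<theta> {..<m} \<le> 1\<close> z(1) by (intro net) (auto simp: mult.commute)
  moreover have "dot m (\<lambda>i. \<theta> i - y i) V \<le> 1 / 2 * l"
  proof -
    have "dot m (\<lambda>i. \<theta> i - y i) V \<le> L2_set (\<lambda>i. \<theta> i - y i) {..<m} * l"
      using abs_dot_le[of m "\<lambda>i. \<theta> i - y i" V] by (simp add: l_def)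
    also have "\<dots> \<le> 1 / 2 * l" using z(3) l unfolding y_def by (intro mult_right_mono) auto
    finally show ?thesis .
  qed
  moreover have "dot m \<theta> V = dot m y V + dot m (\<lambda>i. \<theta> i - y i) V"
    by (simp add: dot_def algebra_simps sum.distrib[symmetric])
  moreover have "dot m \<theta> V = l"
  proof -
    have "dot m \<theta> V = inverse l * (\<Sum>i<m. (V i)\<^sup>2)"
      by (simp add: dot_def \<theta>_def sum_distrib_left power2_eq_square mult_ac)
    also have "(\<Sum>i<m. (V i)\<^sup>2) = l\<^sup>2" by (simp add: l_def L2_set_def sum_nonneg)
    finally show ?thesis using l by (simp add: power2_eq_square)
  qed
  ultimately have "l \<le> 2 * v" by linarith
  thus ?thesis by (simp add: l_def)
qed


lemma riesz_approximation:
  assumes m: "1 \<le> m" and N: "1 \<le> N" and lam: "0 < \<tau>" "\<tau> \<le> 1" and r: "\<And>i. i < m \<Longrightarrow> \<bar>r i\<bar> \<le> 1"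
  shows "sign_prob N m (\<lambda>\<omega>. \<not> (\<exists>u. (\<Sum>j<N. \<bar>u j\<bar>) \<le> 2 / \<tau> \<and>
              L2_set (\<lambda>i. r i - (\<Sum>j<N. u j * \<omega> j i)) {..<m} \<le> 6 / \<tau>))
           \<le> exp (5 * real m) * exp (- real N / (16 * exp (7 * \<tau>\<^sup>2 * real m)))"
proof -
  define T where "T = exp (7 * \<tau>\<^sup>2 * real m / 2)"
  have T2: "T\<^sup>2 = exp (7 * \<tau>\<^sup>2 * real m)" unfolding T_def by (simp add: exp_double[symmetric])
  have T1: "T \<ge> 1" unfolding T_def by simp
  let ?w = "riesz_trunc m \<tau> r T"
  let ?y = "\<lambda>z i. 1 / 2 / sqrt (real m) * real_of_int (z i)"
  let ?A = "\<lambda>\<omega>. (\<Sum>j<N. ?w (\<omega> j)) > real N * 2"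
  let ?Q = "\<lambda>z \<omega>. L2_set (?y z) {..<m} \<le> 1 \<and> (\<Sum>j<N. ?w (\<omega> j) * dot m (?y z) (\<omega> j)) > real N * (\<tau> * dot m (?y z) r + 3)"
  let ?B = "\<lambda>\<omega>. \<exists>z\<in>int_vectors m (2 * real m). ?Q z \<omega>"
  let ?e = "exp (- real N / (16 * T\<^sup>2))"
  have "sign_prob N m (\<lambda>\<omega>. \<not> (\<exists>u. (\<Sum>j<N. \<bar>u j\<bar>) \<le> 2 / \<tau> \<and>
              L2_set (\<lambda>i. r i - (\<Sum>j<N. u j * \<omega> j i)) {..<m} \<le> 6 / \<tau>))
     \<le> sign_prob N m (\<lambda>\<omega>. ?A \<omega> \<or> ?B \<omega>)"
  proof (rule sign_prob_mono, rule ccontr)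
    fix \<omega> assume \<omega>: "\<omega> \<in> sign_families N m" and no: "\<not> (?A \<omega> \<or> ?B \<omega>)"
      and not: "\<not> (\<exists>u. (\<Sum>j<N. \<bar>u j\<bar>) \<le> 2 / \<tau> \<and>
              L2_set (\<lambda>i. r i - (\<Sum>j<N. u j * \<omega> j i)) {..<m} \<le> 6 / \<tau>)"
    \<comment> \<open>The empirical average of the weighted columns is close to its mean \<tau> r.
      Division by \<tau> reproduces r; it raises the total weight to at most 2/\<tau> and the
      deviation per net direction to 3/\<tau>.\<close>
    define u where "u = (\<lambda>j. ?w (\<omega> j) / (real N * \<tau>))"
    have "(\<Sum>j<N. \<bar>u j\<bar>) = (\<Sum>j<N. ?w (\<omega> j)) / (real N * \<tau>)"
      unfolding sum_divide_distrib
    proof (intro sum.cong refl)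
      fix j assume "j \<in> {..<N}"
      hence "0 \<le> ?w (\<omega> j)" using sign_families_nth[OF \<omega>] lam r T1 by (intro riesz_trunc_bounds) auto
      thus "\<bar>u j\<bar> = ?w (\<omega> j) / (real N * \<tau>)" using lam by (simp add: u_def)
    qed
    also have "\<dots> \<le> (real N * 2) / (real N * \<tau>)"
      using no lam by (intro divide_right_mono) auto
    also have "\<dots> = 2 / \<tau>" using N by simp
    finally have 1: "(\<Sum>j<N. \<bar>u j\<bar>) \<le> 2 / \<tau>" .
    define V where "V = (\<lambda>i. (\<Sum>j<N. u j * \<omega> j i) - r i)"
    have "L2_set V {..<m} \<le> 2 * (3 / \<tau>)"
    proof (rule L2_set_le_from_net[OF m])
      fix z assume z: "z \<in> int_vectors m (2 * real m)" "L2_set (?y z) {..<m} \<le> 1"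
      have "dot m (?y z) V = (\<Sum>j<N. u j * dot m (?y z) (\<omega> j)) - dot m (?y z) r"
      proof -
        have "dot m (?y z) (\<lambda>i. \<Sum>j<N. u j * \<omega> j i) = (\<Sum>j<N. u j * dot m (?y z) (\<omega> j))"
          unfolding dot_def sum_distrib_left by (subst sum.swap) (simp add: mult_ac)
        thus ?thesis unfolding V_def dot_diff_right by simp
      qed
      also have "(\<Sum>j<N. u j * dot m (?y z) (\<omega> j)) = (\<Sum>j<N. ?w (\<omega> j) * dot m (?y z) (\<omega> j)) / (real N * \<tau>)"
        by (simp add: u_def sum_divide_distrib)
      also have "\<dots> \<le> real N * (\<tau> * dot m (?y z) r + 3) / (real N * \<tau>)"
        using no z lam by (intro divide_right_mono) (auto simp: not_less)
      also have "\<dots> = dot m (?y z) r + 3 / \<tau>" using N lam by (simp add: field_simps)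
      finally show "dot m (?y z) V \<le> 3 / \<tau>" by simp
    qed
    moreover have "L2_set (\<lambda>i. r i - (\<Sum>j<N. u j * \<omega> j i)) {..<m} = L2_set V {..<m}"
      unfolding L2_set_def V_def by (simp add: power2_commute)
    ultimately show False using not 1 by auto
  qed
  also have "\<dots> \<le> sign_prob N m ?A + sign_prob N m ?B" by (rule sign_prob_disj)
  also have "sign_prob N m ?A \<le> ?e"
    by (rule riesz_trunc_sum_tail[OF lam r T_def])
  also have "sign_prob N m ?B \<le> real (card (int_vectors m (2 * real m))) * ?e"
    by (rule sign_prob_union_if[OF _ _ riesz_trunc_linear_tail[OF lam r T_def]]) simp_all
  also have "\<dots> \<le> exp (4 * real m) * ?e"
    by (intro mult_right_mono card_int_vectors_double) auto
  also have "?e + exp (4 * real m) * ?e \<le> exp (5 * real m) * ?e"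
  proof -
    have "1 + exp (4 * real m) \<le> 2 * exp (4 * real m)" by simp
    also have "\<dots> \<le> exp (real m) * exp (4 * real m)"
    proof (intro mult_right_mono)
      show "2 \<le> exp (real m)" using exp_ge_add_one_self[of "real m"] m by linarith
    qed auto
    also have "\<dots> = exp (5 * real m)" by (simp add: exp_add[symmetric] del: exp_add)
    finally have "(1 + exp (4 * real m)) * ?e \<le> exp (5 * real m) * ?e" by (intro mult_right_mono) auto
    thus ?thesis by (simp add: algebra_simps)
  qed
  finally show ?thesis unfolding T2 by simp
qed

section \<open>Uniform approximation and the quotient property\<close>

lemma quotient_approximation:
  "\<exists>R0>1. \<forall>m N. 1 \<le> m \<longrightarrow> R0 * real m \<le> real N \<longrightarrow> ln (real N) \<le> real m \<longrightarrow>
     sign_prob N m (\<lambda>\<omega>. \<not> (\<forall>y. (\<forall>i<m. \<bar>y i\<bar> \<le> 1) \<longrightarrow>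
        (\<exists>u. (\<Sum>j<N. \<bar>u j\<bar>) \<le> 2 * sqrt 14 * sqrt (real m / ln (real N / real m)) \<and>
             L2_set (\<lambda>i. y i - (\<Sum>j<N. u j * \<omega> j i)) {..<m} \<le> (1 + 6 * sqrt 14) * sqrt (real m / ln (real N / real m)))))
       \<le> exp (- real m)"
proof -
  \<comment> \<open>Here R stands for N/m. The logarithm bounds the entropy of the grid of
    right-hand sides per coordinate; in the 6, the part 5 comes from
    \<open>riesz_approximation\<close> and the part 1 is the rate to be proved.\<close>
  have "eventually (\<lambda>R::real. ln (2 * sqrt (ln R) + 3) + 6 \<le> sqrt R / 16) at_top"
    by real_asymp
  then obtain R1 where R1: "\<And>R::real. R \<ge> R1 \<Longrightarrow> ln (2 * sqrt (ln R) + 3) + 6 \<le> sqrt R / 16"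
    by (auto simp: eventually_at_top_linorder)
  define R0 where "R0 = max R1 2"
  have main: "sign_prob N m (\<lambda>\<omega>. \<not> (\<forall>y. (\<forall>i<m. \<bar>y i\<bar> \<le> 1) \<longrightarrow>
        (\<exists>u. (\<Sum>j<N. \<bar>u j\<bar>) \<le> 2 * sqrt 14 * sqrt (real m / ln (real N / real m)) \<and>
             L2_set (\<lambda>i. y i - (\<Sum>j<N. u j * \<omega> j i)) {..<m} \<le> (1 + 6 * sqrt 14) * sqrt (real m / ln (real N / real m)))))
       \<le> exp (- real m)"
    if m: "1 \<le> m" and N: "R0 * real m \<le> real N" and lnN: "ln (real N) \<le> real m" for m N :: nat
  proof -
    define R where "R = real N / real m"
    define L where "L = ln R"
    have R: "R \<ge> R0" using N m by (simp add: R_def field_simps)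
    hence R2: "R \<ge> 2" "R \<ge> R1" by (auto simp: R0_def)
    have Lpos: "L > 0" using R2 by (simp add: L_def)
    have NR: "real N = R * real m" using m by (simp add: R_def)
    have N1: "1 \<le> N" using NR R2 m by (cases N) auto
    have "L \<le> ln (real N)" using m N1 unfolding L_def R_def by (simp add: ln_div)
    hence Lm: "L \<le> real m" using lnN by simp
    \<comment> \<open>This makes 7 \<tau>^2 m = L/2, so that T^2 = sqrt R and the failure exponent
      is (sqrt R / 16) m, which outgrows the entropy. The hypothesis ln N \<le> m gives L \<le> m
      and hence \<tau> \<le> 1.\<close>
    define \<tau> where "\<tau> = sqrt (L / (14 * real m))"
    have \<tau>: "0 < \<tau>" "\<tau> \<le> 1"
      using Lpos m Lm by (auto simp: \<tau>_def)
    have \<tau>2: "7 * \<tau>\<^sup>2 * real m = L / 2"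
      using Lpos m by (simp add: \<tau>_def)
    have inv: "1 / \<tau> = sqrt 14 * sqrt (real m / L)"
      by (simp add: \<tau>_def real_sqrt_divide real_sqrt_mult)
    have expL: "exp (L / 2) = sqrt R"
      using R2 by (simp add: L_def powr_half_sqrt[symmetric] powr_def)
    define M where "M = nat \<lceil>sqrt L\<rceil>"
    have M: "sqrt L \<le> real M" "real M \<le> sqrt L + 1" "M \<ge> 1"
    proof -
      have "sqrt L > 0" using Lpos by simp
      hence c1: "\<lceil>sqrt L\<rceil> \<ge> 1" by (simp add: one_le_ceiling)
      hence Mc: "real M = real_of_int \<lceil>sqrt L\<rceil>" by (simp add: M_def)
      thus "sqrt L \<le> real M" "real M \<le> sqrt L + 1" by linarith+
      have "1 \<le> real M" using c1 Mc by linarith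
      thus "M \<ge> 1" by simp
    qed
    let ?G = "{..<m} \<rightarrow>\<^sub>E {- int M..int M}"
    let ?Q = "\<lambda>(p :: nat \<Rightarrow> int) \<omega>. \<not> (\<exists>u. (\<Sum>j<N. \<bar>u j\<bar>) \<le> 2 / \<tau> \<and>
              L2_set (\<lambda>i. real_of_int (p i) / real M - (\<Sum>j<N. u j * \<omega> j i)) {..<m} \<le> 6 / \<tau>)"
    let ?e = "exp (5 * real m) * exp (- real N / (16 * sqrt R))"
    have first: "sign_prob N m (\<lambda>\<omega>. \<not> (\<forall>y. (\<forall>i<m. \<bar>y i\<bar> \<le> 1) \<longrightarrow>
        (\<exists>u. (\<Sum>j<N. \<bar>u j\<bar>) \<le> 2 * sqrt 14 * sqrt (real m / ln (real N / real m)) \<and>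
             L2_set (\<lambda>i. y i - (\<Sum>j<N. u j * \<omega> j i)) {..<m} \<le> (1 + 6 * sqrt 14) * sqrt (real m / ln (real N / real m)))))
       \<le> sign_prob N m (\<lambda>\<omega>. \<exists>p\<in>?G. ?Q p \<omega>)"
    proof (rule sign_prob_mono, rule ccontr)
      fix \<omega> assume no: "\<not> (\<exists>p\<in>?G. ?Q p \<omega>)"
        and not: "\<not> (\<forall>y. (\<forall>i<m. \<bar>y i\<bar> \<le> 1) \<longrightarrow>
        (\<exists>u. (\<Sum>j<N. \<bar>u j\<bar>) \<le> 2 * sqrt 14 * sqrt (real m / ln (real N / real m)) \<and>
             L2_set (\<lambda>i. y i - (\<Sum>j<N. u j * \<omega> j i)) {..<m} \<le> (1 + 6 * sqrt 14) * sqrt (real m / ln (real N / real m))))"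
      then obtain y where y: "\<And>i. i < m \<Longrightarrow> \<bar>y i\<bar> \<le> 1"
        and noty: "\<not> (\<exists>u. (\<Sum>j<N. \<bar>u j\<bar>) \<le> 2 * sqrt 14 * sqrt (real m / L) \<and>
             L2_set (\<lambda>i. y i - (\<Sum>j<N. u j * \<omega> j i)) {..<m} \<le> (1 + 6 * sqrt 14) * sqrt (real m / L))"
        unfolding L_def R_def by blast
      define p where "p = (\<lambda>i\<in>{..<m}. \<lfloor>y i * real M\<rfloor>)"
      have pG: "p \<in> ?G"
      proof (intro PiE_I)
        fix i assume i: "i \<in> {..<m}"
        have "\<bar>y i * real M\<bar> \<le> 1 * real M" using y[of i] i unfolding abs_mult by (intro mult_mono) auto
        hence "- real M \<le> y i * real M" "y i * real M \<le> real M" by auto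
        hence "real_of_int (- int M) \<le> y i * real M" "y i * real M < real_of_int (int M + 1)" by auto
        hence "- int M \<le> \<lfloor>y i * real M\<rfloor>" "\<lfloor>y i * real M\<rfloor> < int M + 1"
          by (simp_all only: le_floor_iff floor_less_iff)
        thus "p i \<in> {- int M..int M}" using i by (auto simp: p_def)
      qed (simp add: p_def)
      obtain u where u: "(\<Sum>j<N. \<bar>u j\<bar>) \<le> 2 / \<tau>"
        "L2_set (\<lambda>i. real_of_int (p i) / real M - (\<Sum>j<N. u j * \<omega> j i)) {..<m} \<le> 6 / \<tau>"
        using no pG by blast
      have "L2_set (\<lambda>i. y i - (\<Sum>j<N. u j * \<omega> j i)) {..<m}
          \<le> L2_set (\<lambda>i. y i - real_of_int (p i) / real M) {..<m} + L2_set (\<lambda>i. real_of_int (p i) / real M - (\<Sum>j<N. u j * \<omega> j i)) {..<m}"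
        by (rule order_trans[OF _ L2_set_triangle_ineq]) simp
      also have "L2_set (\<lambda>i. y i - real_of_int (p i) / real M) {..<m} \<le> L2_set (\<lambda>i. 1 / sqrt L) {..<m}"
      proof (rule L2_set_le_abs)
        fix i assume "i \<in> {..<m}"
        hence p: "p i = \<lfloor>y i * real M\<rfloor>" by (simp add: p_def)
        have "\<bar>y i * real M - real_of_int (p i)\<bar> \<le> 1" unfolding p by linarith
        moreover have "y i - real_of_int (p i) / real M = (y i * real M - real_of_int (p i)) / real M"
          using M(3) by (simp add: field_simps)
        ultimately have "\<bar>y i - real_of_int (p i) / real M\<bar> \<le> 1 / real M"
          by (simp add: abs_div divide_right_mono)
        also have "\<dots> \<le> 1 / sqrt L" using M Lpos by (intro divide_left_mono) auto
        finally show "\<bar>y i - real_of_int (p i) / real M\<bar> \<le> \<bar>1 / sqrt L\<bar>" using Lpos by simp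
      qed
      also have "L2_set (\<lambda>i. 1 / sqrt L) {..<m} = sqrt (real m / L)"
        using Lpos by (simp add: L2_set_def power_divide)
      also note u(2)
      also have "sqrt (real m / L) + 6 / \<tau> = (1 + 6 * sqrt 14) * sqrt (real m / L)"
        using inv by (simp add: algebra_simps divide_inverse)
      finally have "L2_set (\<lambda>i. y i - (\<Sum>j<N. u j * \<omega> j i)) {..<m} \<le> (1 + 6 * sqrt 14) * sqrt (real m / L)"
        by simp
      moreover have "(\<Sum>j<N. \<bar>u j\<bar>) \<le> 2 * sqrt 14 * sqrt (real m / L)"
        using u(1) inv by (simp add: divide_inverse mult_ac)
      ultimately show False using noty by blast
    qed
    have NsR: "real N / (16 * sqrt R) = sqrt R / 16 * real m"
    proof -
      have "real N = sqrt R * sqrt R * real m" using NR R2 by simp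
      thus ?thesis using R2 by (simp add: field_simps)
    qed
    note first
    also have "sign_prob N m (\<lambda>\<omega>. \<exists>p\<in>?G. ?Q p \<omega>) \<le> real (card ?G) * ?e"
    proof (rule sign_prob_union)
      fix p assume p: "p \<in> ?G"
      have "\<bar>real_of_int (p i) / real M\<bar> \<le> 1" if "i < m" for i
      proof -
        have "p i \<in> {- int M..int M}" by (rule PiE_mem[OF p]) (simp add: that)
        hence "\<bar>p i\<bar> \<le> int M" unfolding atLeastAtMost_iff by linarith
        hence "\<bar>real_of_int (p i)\<bar> \<le> real M" by linarith
        thus ?thesis using M(3) by (simp add: abs_div)
      qed
      from riesz_approximation[OF m N1 \<tau> this]
      show "sign_prob N m (?Q p) \<le> ?e" unfolding \<tau>2 expL .
    qed (auto intro!: finite_PiE)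
    also have "real (card ?G) = (2 * real M + 1) ^ m"
      by (subst card_PiE) (auto simp: nat_add_distrib add.commute)
    also have "\<dots> = exp (ln (2 * real M + 1) * real m)"
      by (simp add: mult.commute[of _ "real m"] exp_of_nat_mult)
    also have "exp (ln (2 * real M + 1) * real m) * (exp (5 * real m) * exp (- real N / (16 * sqrt R)))
        = exp ((ln (2 * real M + 1) + 5 - sqrt R / 16) * real m)"
      using NsR by (simp add: exp_add[symmetric] algebra_simps del: exp_add)
    also have "\<dots> \<le> exp (- 1 * real m)"
    proof -
      have "ln (2 * real M + 1) \<le> ln (2 * sqrt L + 3)" using M by simp
      hence "ln (2 * real M + 1) + 5 - sqrt R / 16 \<le> - 1"
        using R1[OF R2(2)] by (simp add: L_def)
      thus ?thesis unfolding exp_le_cancel_iff by (intro mult_right_mono) auto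
    qed
    finally show ?thesis by simp
  qed
  show ?thesis
    by (rule exI[of _ R0]) (use main in \<open>auto simp: R0_def\<close>)
qed

text \<open>
  The Riesz products leave an error that is small only in the Euclidean norm; the smallest
  singular value absorbs it.  For bounded N/m the smallest singular value alone suffices.
\<close>

lemma quotient_property:
  "\<exists>C>0. \<exists>h>0. \<exists>M. \<forall>m\<ge>M. \<forall>N\<ge>2 * m. ln (real N) \<le> real m \<longrightarrow>
     sign_prob N m (\<lambda>\<omega>. \<not> (\<forall>y. (\<forall>i<m. \<bar>y i\<bar> \<le> 1) \<longrightarrow>
        (\<exists>u. (\<forall>i<m. (\<Sum>j<N. u j * \<omega> j i) = y i) \<and>
             (\<Sum>j<N. \<bar>u j\<bar>) \<le> C * sqrt (real m / ln (real N / real m)))))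
       \<le> exp (- h * real m)"
proof -
  obtain R0 where R0: "R0 > 1" and appr: "\<And>m N. 1 \<le> m \<Longrightarrow> R0 * real m \<le> real N \<Longrightarrow> ln (real N) \<le> real m \<Longrightarrow>
     sign_prob N m (\<lambda>\<omega>. \<not> (\<forall>y. (\<forall>i<m. \<bar>y i\<bar> \<le> 1) \<longrightarrow>
        (\<exists>u. (\<Sum>j<N. \<bar>u j\<bar>) \<le> 2 * sqrt 14 * sqrt (real m / ln (real N / real m)) \<and>
             L2_set (\<lambda>i. y i - (\<Sum>j<N. u j * \<omega> j i)) {..<m} \<le> (1 + 6 * sqrt 14) * sqrt (real m / ln (real N / real m)))))
       \<le> exp (- real m)"
    using quotient_approximation by blast
  obtain c h M where c: "c > 0" and h: "h > 0" and ssv: "\<And>m N. m \<ge> M \<Longrightarrow> N \<ge> 2 * m \<Longrightarrow>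
     sign_prob N m (\<lambda>\<omega>. \<exists>x. action_norm N m \<omega> x < c * sqrt (real N) * L2_set x {..<m}) \<le> exp (- h * real m)"
    using smallest_singular_value by blast
  define h' where "h' = min h 1 / 2"
  have h': "h' > 0" "2 * h' \<le> h" "2 * h' \<le> 1" using h by (auto simp: h'_def)
  obtain M2 where M2: "\<And>m. m \<ge> M2 \<Longrightarrow> 2 * exp (- (2 * h') * real m) \<le> exp (- h' * real m)"
    using eventually_exp_absorb[OF h'(1), of 2] by auto
  \<comment> \<open>The first entry serves N/m < R0, where L \<le> ln R0. The second adds the
    l1-norm of the Riesz approximation and that of the correction of its error.\<close>
  define C where "C = max (sqrt (ln R0) / c) (2 * sqrt 14 + (1 + 6 * sqrt 14) / c)"
  have C: "C > 0" using R0 c by (auto simp: C_def less_max_iff_disj)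
  have main: "sign_prob N m (\<lambda>\<omega>. \<not> (\<forall>y. (\<forall>i<m. \<bar>y i\<bar> \<le> 1) \<longrightarrow>
        (\<exists>u. (\<forall>i<m. (\<Sum>j<N. u j * \<omega> j i) = y i) \<and>
             (\<Sum>j<N. \<bar>u j\<bar>) \<le> C * sqrt (real m / ln (real N / real m)))))
       \<le> exp (- h' * real m)" (is "sign_prob N m (\<lambda>\<omega>. \<not> ?good \<omega>) \<le> _")
    if m: "m \<ge> max (max M M2) 1" and N: "N \<ge> 2 * m" and lnN: "ln (real N) \<le> real m" for m N
  proof -
    have m1: "1 \<le> m" and mM: "m \<ge> M" and mM2: "m \<ge> M2" using m by auto
    have N0: "real N > 0" using N m1 by simp
    define L where "L = ln (real N / real m)"
    have "real N / real m \<ge> 2" using N m1 by (simp add: field_simps)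
    hence L: "L > 0" by (simp add: L_def)
    let ?S = "\<lambda>\<omega>. \<exists>x. action_norm N m \<omega> x < c * sqrt (real N) * L2_set x {..<m}"
    \<comment> \<open>The factor sqrt N lost in passing from the Euclidean to the l1-norm cancels
      against the sqrt N in the singular value bound.\<close>
    have solve: "\<exists>u. (\<forall>i<m. (\<Sum>j<N. u j * \<omega> j i) = e i) \<and> (\<Sum>j<N. \<bar>u j\<bar>) \<le> L2_set e {..<m} / c"
      if "\<not> ?S \<omega>" for \<omega> e
    proof -
      have "0 < c * sqrt (real N)" using c N0 by simp
      moreover have "c * sqrt (real N) * L2_set x {..<m} \<le> action_norm N m \<omega> x" for x
        using that by (meson not_less)
      ultimately obtain u where u: "\<And>i. i < m \<Longrightarrow> (\<Sum>j<N. u j * \<omega> j i) = e i"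
        "L2_set u {..<N} \<le> L2_set e {..<m} / (c * sqrt (real N))"
        by (rule solution_with_small_L2[where y = e]) blast
      have "(\<Sum>j<N. \<bar>u j\<bar>) \<le> sqrt (real N) * L2_set u {..<N}"
        using sum_abs_le_L2_set[of "{..<N}" u] by simp
      also have "\<dots> \<le> sqrt (real N) * (L2_set e {..<m} / (c * sqrt (real N)))"
        using u by (intro mult_left_mono) auto
      also have "\<dots> = L2_set e {..<m} / c" using N0 by simp
      finally show ?thesis using u(1) by blast
    qed
    show ?thesis
    proof (cases "R0 * real m \<le> real N")
      case False
      have "sign_prob N m (\<lambda>\<omega>. \<not> ?good \<omega>) \<le> sign_prob N m ?S"
      proof (rule sign_prob_mono, rule ccontr)
        fix \<omega> assume bad: "\<not> ?good \<omega>" and nS: "\<not> ?S \<omega>"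
        then obtain y where y: "\<And>i. i < m \<Longrightarrow> \<bar>y i\<bar> \<le> 1"
          and noty: "\<not> (\<exists>u. (\<forall>i<m. (\<Sum>j<N. u j * \<omega> j i) = y i) \<and> (\<Sum>j<N. \<bar>u j\<bar>) \<le> C * sqrt (real m / L))"
          unfolding L_def by blast
        obtain u where u: "\<forall>i<m. (\<Sum>j<N. u j * \<omega> j i) = y i" "(\<Sum>j<N. \<bar>u j\<bar>) \<le> L2_set y {..<m} / c"
          using solve[OF nS] by blast
        have "L2_set y {..<m} \<le> L2_set (\<lambda>i. 1) {..<m}"
          by (rule L2_set_le_abs) (use y in auto)
        also have "\<dots> = sqrt (real m)" by (simp add: L2_set_def)
        finally have "L2_set y {..<m} / c \<le> sqrt (real m) / c" using c by (intro divide_right_mono) auto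
        also have "\<dots> \<le> (sqrt (ln R0) / c) * sqrt (real m / L)"
        proof -
          have "L \<le> ln R0" unfolding L_def using False m1 N0 R0 by (simp add: field_simps)
          hence "sqrt L \<le> sqrt (ln R0)" by simp
          hence "sqrt (real m) * sqrt L \<le> sqrt (real m) * sqrt (ln R0)" by (intro mult_left_mono) auto
          thus ?thesis using c L by (simp add: real_sqrt_divide field_simps)
        qed
        also have "\<dots> \<le> C * sqrt (real m / L)"
          using L by (intro mult_right_mono) (auto simp: C_def)
        finally show False using noty u by auto
      qed
      also have "\<dots> \<le> exp (- h * real m)" by (rule ssv[OF mM N])
      also have "\<dots> \<le> exp (- h' * real m)"
      proof -
        have "h' \<le> h" using h' by simp
        from mult_right_mono[OF this, of "real m"] show ?thesis by simp
      qed
      finally show ?thesis .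
    next
      case True
      let ?K = "sqrt (real m / L)"
      define ok where "ok = (\<lambda>(\<omega> :: nat \<Rightarrow> nat \<Rightarrow> real) (y :: nat \<Rightarrow> real) u. (\<Sum>j<N. \<bar>u j\<bar>) \<le> 2 * sqrt 14 * ?K \<and>
             L2_set (\<lambda>i. y i - (\<Sum>j<N. u j * \<omega> j i)) {..<m} \<le> (1 + 6 * sqrt 14) * ?K)"
      let ?A = "\<lambda>\<omega>. \<not> (\<forall>y. (\<forall>i<m. \<bar>y i\<bar> \<le> 1) \<longrightarrow> (\<exists>u. ok \<omega> y u))"
      have "sign_prob N m (\<lambda>\<omega>. \<not> ?good \<omega>) \<le> sign_prob N m (\<lambda>\<omega>. ?S \<omega> \<or> ?A \<omega>)"
      proof (rule sign_prob_mono, rule ccontr)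
        fix \<omega> assume bad: "\<not> ?good \<omega>" and no: "\<not> (?S \<omega> \<or> ?A \<omega>)"
        from bad obtain y where y: "\<forall>i<m. \<bar>y i\<bar> \<le> 1"
          and noty: "\<not> (\<exists>u. (\<forall>i<m. (\<Sum>j<N. u j * \<omega> j i) = y i) \<and> (\<Sum>j<N. \<bar>u j\<bar>) \<le> C * ?K)"
          unfolding L_def by blast
        note nS = no[unfolded de_Morgan_disj, THEN conjunct1]
          and nA = no[unfolded de_Morgan_disj not_not, THEN conjunct2]
        obtain u where ok: "ok \<omega> y u" using nA[THEN spec, THEN mp, OF y] by (rule exE)
        note u = ok[unfolded ok_def, THEN conjunct1] ok[unfolded ok_def, THEN conjunct2]
        obtain v where v: "\<forall>i<m. (\<Sum>j<N. v j * \<omega> j i) = y i - (\<Sum>j<N. u j * \<omega> j i)"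
          "(\<Sum>j<N. \<bar>v j\<bar>) \<le> L2_set (\<lambda>i. y i - (\<Sum>j<N. u j * \<omega> j i)) {..<m} / c"
          using solve[OF nS, of "\<lambda>i. y i - (\<Sum>j<N. u j * \<omega> j i)"] by blast
        have "(\<Sum>j<N. \<bar>u j + v j\<bar>) \<le> (\<Sum>j<N. \<bar>u j\<bar>) + (\<Sum>j<N. \<bar>v j\<bar>)"
          unfolding sum.distrib[symmetric] by (intro sum_mono abs_triangle_ineq)
        also have "\<dots> \<le> 2 * sqrt 14 * ?K + (1 + 6 * sqrt 14) * ?K / c"
          using u v c by (intro add_mono order_trans[OF v(2)] divide_right_mono) auto
        also have "\<dots> = (2 * sqrt 14 + (1 + 6 * sqrt 14) / c) * ?K"
          using c by (simp add: field_simps)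
        also have "\<dots> \<le> C * ?K" using L by (intro mult_right_mono) (auto simp: C_def)
        finally have uv1: "(\<Sum>j<N. \<bar>u j + v j\<bar>) \<le> C * ?K" .
        have uv2: "\<forall>i<m. (\<Sum>j<N. (u j + v j) * \<omega> j i) = y i"
          using v(1) by (simp add: algebra_simps sum.distrib)
        show False
          by (rule notE[OF noty], rule exI[of _ "\<lambda>j. u j + v j"], rule conjI[OF uv2 uv1])
      qed
      also have "\<dots> \<le> sign_prob N m ?S + sign_prob N m ?A" by (rule sign_prob_disj)
      also have "sign_prob N m ?S \<le> exp (- h * real m)" by (rule ssv[OF mM N])
      also have "\<dots> \<le> exp (- (2 * h') * real m)"
        using mult_right_mono[OF h'(2), of "real m"] by simp
      also have "sign_prob N m ?A \<le> exp (- real m)"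
        using appr[OF m1 True lnN] unfolding L_def ok_def .
      also have "\<dots> \<le> exp (- (2 * h') * real m)"
        using mult_right_mono[OF h'(3), of "real m"] by simp
      also have "exp (- (2 * h') * real m) + exp (- (2 * h') * real m) \<le> exp (- h' * real m)"
        using M2[OF mM2] by simp
      finally show ?thesis by simp
    qed
  qed
  show ?thesis
    by (rule exI[of _ C], rule conjI, rule C, rule exI[of _ h'], rule conjI, rule h'(1),
        rule exI[of _ "max (max M M2) 1"]) (use main in blast)
qed

subsection \<open>Restricted isometries and l1-minimization\<close>

lemma top_subset:
  fixes v :: "nat \<Rightarrow> real"
  assumes "finite P" "k \<le> card P"
  shows "\<exists>Q\<subseteq>P. card Q = k \<and> (\<forall>i\<in>Q. \<forall>j\<in>P - Q. \<bar>v j\<bar> \<le> \<bar>v i\<bar>)"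
  using assms(2)
proof (induction k)
  case 0
  show ?case by (rule exI[of _ "{}"]) auto
next
  case (Suc k)
  then obtain Q where Q: "Q \<subseteq> P" "card Q = k" "\<forall>i\<in>Q. \<forall>j\<in>P - Q. \<bar>v j\<bar> \<le> \<bar>v i\<bar>" by auto
  have "P - Q \<noteq> {}" using Q Suc.prems by auto
  then obtain l where l: "l \<in> P - Q" "\<And>j. j \<in> P - Q \<Longrightarrow> \<bar>v j\<bar> \<le> \<bar>v l\<bar>"
  proof -
    let ?V = "(\<lambda>j. \<bar>v j\<bar>) ` (P - Q)"
    assume that: "\<And>l. l \<in> P - Q \<Longrightarrow> (\<And>j. j \<in> P - Q \<Longrightarrow> \<bar>v j\<bar> \<le> \<bar>v l\<bar>) \<Longrightarrow> thesis"
    have V: "finite ?V" "?V \<noteq> {}" using assms(1) \<open>P - Q \<noteq> {}\<close> by auto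
    from Max_in[OF V] obtain l where l: "l \<in> P - Q" "Max ?V = \<bar>v l\<bar>" by blast
    show thesis
    proof (rule that[OF l(1)])
      fix j assume "j \<in> P - Q"
      hence "\<bar>v j\<bar> \<le> Max ?V" using V by (intro Max_ge) auto
      thus "\<bar>v j\<bar> \<le> \<bar>v l\<bar>" using l(2) by simp
    qed
  qed
  have "card (insert l Q) = Suc k"
    using l Q finite_subset[OF Q(1) assms(1)] by simp
  moreover have "\<forall>i\<in>insert l Q. \<forall>j\<in>P - insert l Q. \<bar>v j\<bar> \<le> \<bar>v i\<bar>"
    using l Q by blast
  ultimately show ?case using l Q by (intro exI[of _ "insert l Q"]) auto
qed

definition restrict_to :: "nat set \<Rightarrow> (nat \<Rightarrow> real) \<Rightarrow> nat \<Rightarrow> real" where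
  "restrict_to P v = (\<lambda>i. if i \<in> P then v i else 0)"

lemma sparse_restrict_to:
  assumes "finite P" "card P \<le> k"
  shows "sparse n k (restrict_to P v)"
proof -
  have "{i. i < n \<and> restrict_to P v i \<noteq> 0} \<subseteq> P"
    by (auto simp: restrict_to_def)
  from card_mono[OF assms(1) this] show ?thesis
    unfolding sparse_def using assms(2) by linarith
qed

lemma L2_set_restrict_to:
  assumes "P \<subseteq> {..<n}"
  shows "L2_set (restrict_to P v) {..<n} = L2_set v P"
proof -
  have "(\<Sum>i<n. (restrict_to P v i)\<^sup>2) = (\<Sum>i\<in>P. (v i)\<^sup>2)"
    using assms by (intro sum.mono_neutral_cong_right) (auto simp: restrict_to_def)
  thus ?thesis by (simp add: L2_set_def)
qed

text \<open>The level t is the smallest modulus on the set Q of the k largest entries: it bounds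
  everything outside Q and is at most the average over Q.\<close>

lemma top_subset_level:
  fixes v :: "nat \<Rightarrow> real"
  assumes "finite P" "1 \<le> k" "k \<le> card P"
  obtains Q t where "Q \<subseteq> P" "card Q = k" "t \<ge> 0" "\<And>j. j \<in> P - Q \<Longrightarrow> \<bar>v j\<bar> \<le> t"
    "real k * t \<le> (\<Sum>i\<in>Q. \<bar>v i\<bar>)"
proof -
  obtain Q where Q: "Q \<subseteq> P" "card Q = k" "\<forall>i\<in>Q. \<forall>j\<in>P - Q. \<bar>v j\<bar> \<le> \<bar>v i\<bar>"
    using top_subset[OF assms(1,3)] by blast
  have fin: "finite Q" "Q \<noteq> {}" using Q assms finite_subset[OF Q(1) assms(1)] by auto
  define t where "t = Min ((\<lambda>i. \<bar>v i\<bar>) ` Q)"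
  have tQ: "t \<in> (\<lambda>i. \<bar>v i\<bar>) ` Q" unfolding t_def using fin by (intro Min_in) auto
  have "real k * t = (\<Sum>i\<in>Q. t)" using Q by simp
  also have "\<dots> \<le> (\<Sum>i\<in>Q. \<bar>v i\<bar>)"
    using fin by (intro sum_mono) (auto simp: t_def)
  finally show ?thesis using that[of Q t] Q tQ by auto
qed

text \<open>Blocks of k largest entries are peeled off one after another. A block has Euclidean norm
  at most sqrt k times its largest modulus, which is at most the average over the preceding block,
  so the sum telescopes to the l1-norm over sqrt k.\<close>

lemma action_norm_block_bound:
  assumes up: "\<And>x. sparse n k x \<Longrightarrow> action_norm N n \<omega> x \<le> B * L2_set x {..<n}"
    and k: "1 \<le> k" and B: "0 \<le> B" and P: "P \<subseteq> {..<n}" and M: "0 \<le> M" "\<And>i. i \<in> P \<Longrightarrow> \<bar>v i\<bar> \<le> M"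
  shows "action_norm N n \<omega> (restrict_to P v) \<le> B * (sqrt (real k) * M + (\<Sum>i\<in>P. \<bar>v i\<bar>) / sqrt (real k))"
  using P M
proof (induction "card P" arbitrary: P M rule: less_induct)
  case less
  have fin: "finite P" using less.prems finite_subset by blast
  have L2: "L2_set v Q \<le> sqrt (real (card Q)) * M" if "Q \<subseteq> P" for Q
  proof -
    have "(\<Sum>i\<in>Q. (v i)\<^sup>2) \<le> (\<Sum>i\<in>Q. M\<^sup>2)"
      using that less.prems by (intro sum_mono power2_le_iff_abs_le[THEN iffD2]) auto
    hence "L2_set v Q \<le> sqrt (real (card Q) * M\<^sup>2)" unfolding L2_set_def by simp
    thus ?thesis using less.prems by (simp add: real_sqrt_mult)
  qed
  show ?case
  proof (cases "card P \<le> k")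
    case True
    have "action_norm N n \<omega> (restrict_to P v) \<le> B * L2_set v P"
      using up[OF sparse_restrict_to[OF fin True]] less.prems(1) by (simp add: L2_set_restrict_to)
    also have "\<dots> \<le> B * (sqrt (real k) * M)"
    proof (intro mult_left_mono B)
      have "sqrt (real (card P)) * M \<le> sqrt (real k) * M"
        using True less.prems by (intro mult_right_mono) auto
      thus "L2_set v P \<le> sqrt (real k) * M" using L2[of P] by simp
    qed
    also have "\<dots> \<le> B * (sqrt (real k) * M + (\<Sum>i\<in>P. \<bar>v i\<bar>) / sqrt (real k))"
      using B by (intro mult_left_mono) (auto intro!: divide_nonneg_nonneg sum_nonneg)
    finally show ?thesis .
  next
    case False
    hence "k \<le> card P" by simp
    from top_subset_level[OF fin k this] obtain Q t where
      Q: "Q \<subseteq> P" "card Q = k" "t \<ge> 0" "\<And>j. j \<in> P - Q \<Longrightarrow> \<bar>v j\<bar> \<le> t"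
      "real k * t \<le> (\<Sum>i\<in>Q. \<bar>v i\<bar>)"
      by blast
    have finQ: "finite Q" using Q fin finite_subset by blast
    have "restrict_to P v = (\<lambda>i. restrict_to Q v i + restrict_to (P - Q) v i)"
      using Q(1) by (auto simp: restrict_to_def fun_eq_iff)
    hence "action_norm N n \<omega> (restrict_to P v) \<le> action_norm N n \<omega> (restrict_to Q v) + action_norm N n \<omega> (restrict_to (P - Q) v)"
      using action_norm_triangle[of N n \<omega> "restrict_to Q v" "restrict_to (P - Q) v"] by simp
    also have "action_norm N n \<omega> (restrict_to Q v) \<le> B * L2_set v Q"
      using up[OF sparse_restrict_to[OF finQ]] Q less.prems(1) by (subst L2_set_restrict_to[symmetric, of Q n]) auto
    also have "\<dots> \<le> B * (sqrt (real k) * M)"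
      using L2[OF Q(1)] Q(2) by (intro mult_left_mono B) simp
    also have "action_norm N n \<omega> (restrict_to (P - Q) v) \<le> B * (sqrt (real k) * t + (\<Sum>i\<in>P - Q. \<bar>v i\<bar>) / sqrt (real k))"
    proof (rule less.hyps)
      have "Q \<noteq> {}" using Q(2) k by auto
      hence "P - Q \<subset> P" using Q(1) by auto
      thus "card (P - Q) < card P" by (rule psubset_card_mono[OF fin])
    qed (use less.prems Q in auto)
    also have "sqrt (real k) * t \<le> (\<Sum>i\<in>Q. \<bar>v i\<bar>) / sqrt (real k)"
      using Q(5) k by (simp add: field_simps)
    also have "B * (sqrt (real k) * M) + B * ((\<Sum>i\<in>Q. \<bar>v i\<bar>) / sqrt (real k) + (\<Sum>i\<in>P - Q. \<bar>v i\<bar>) / sqrt (real k))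
       = B * (sqrt (real k) * M + (\<Sum>i\<in>P. \<bar>v i\<bar>) / sqrt (real k))"
      using sum.subset_diff[OF Q(1) fin, of "\<lambda>i. \<bar>v i\<bar>"] by (simp add: algebra_simps add_divide_distrib)
    finally show ?thesis using B by (simp add: mult_left_mono)
  qed
qed

text \<open>The k largest entries are controlled by the lower isometry bound, after the image of the
  rest has been removed by the block bound. The rest itself has small Euclidean norm because its
  entries are at most |v|/k, with |v| the l1-norm.\<close>

lemma L2_set_le_action_and_l1:
  assumes up: "\<And>x. sparse n k x \<Longrightarrow> action_norm N n \<omega> x \<le> B * L2_set x {..<n}"
    and low: "\<And>x. sparse n k x \<Longrightarrow> b * L2_set x {..<n} \<le> action_norm N n \<omega> x"
    and k: "1 \<le> k" and B: "0 \<le> B" and b: "0 < b"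
  shows "L2_set v {..<n} \<le> action_norm N n \<omega> v / b + (B / b + 1) * ((\<Sum>i<n. \<bar>v i\<bar>) / sqrt (real k))"
proof (cases "n \<le> k")
  case True
  hence "sparse n k v" using sparse_self[of n v] by (simp add: sparse_def)
  from low[OF this] have "L2_set v {..<n} \<le> action_norm N n \<omega> v / b" using b by (simp add: field_simps)
  moreover have "0 \<le> (B / b + 1) * ((\<Sum>i<n. \<bar>v i\<bar>) / sqrt (real k))"
    using B b by (intro mult_nonneg_nonneg divide_nonneg_nonneg sum_nonneg) auto
  ultimately show ?thesis by linarith
next
  case False
  hence "k \<le> card {..<n}" by simp
  from top_subset_level[OF finite_lessThan k this] obtain Q t where
    Q: "Q \<subseteq> {..<n}" "card Q = k" "t \<ge> 0" "\<And>j. j \<in> {..<n} - Q \<Longrightarrow> \<bar>v j\<bar> \<le> t"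
    "real k * t \<le> (\<Sum>i\<in>Q. \<bar>v i\<bar>)"
    by blast
  have finQ: "finite Q" using Q finite_subset by blast
  let ?R = "{..<n} - Q"
  let ?s = "(\<Sum>i<n. \<bar>v i\<bar>) / sqrt (real k)"
  have tot: "(\<Sum>i\<in>Q. \<bar>v i\<bar>) + (\<Sum>i\<in>?R. \<bar>v i\<bar>) = (\<Sum>i<n. \<bar>v i\<bar>)"
    using sum.subset_diff[OF Q(1), of "\<lambda>i. \<bar>v i\<bar>"] by simp
  have kt: "sqrt (real k) * t \<le> (\<Sum>i\<in>Q. \<bar>v i\<bar>) / sqrt (real k)"
    using Q(5) k by (simp add: field_simps)
  have rest: "action_norm N n \<omega> (restrict_to ?R v) \<le> B * ?s"
  proof -
    have "action_norm N n \<omega> (restrict_to ?R v) \<le> B * (sqrt (real k) * t + (\<Sum>i\<in>?R. \<bar>v i\<bar>) / sqrt (real k))"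
      by (rule action_norm_block_bound[OF up k B _ Q(3,4)]) auto
    also have "\<dots> \<le> B * ((\<Sum>i\<in>Q. \<bar>v i\<bar>) / sqrt (real k) + (\<Sum>i\<in>?R. \<bar>v i\<bar>) / sqrt (real k))"
      using kt B by (intro mult_left_mono add_right_mono)
    also have "\<dots> = B * ?s" unfolding add_divide_distrib[symmetric] tot ..
    finally show ?thesis .
  qed
  have v: "v = (\<lambda>i. restrict_to Q v i + restrict_to (- Q) v i)" by (auto simp: restrict_to_def)
  have spQ: "sparse n k (restrict_to Q v)" using sparse_restrict_to[OF finQ] Q by simp
  have "b * L2_set (restrict_to Q v) {..<n} \<le> action_norm N n \<omega> (restrict_to Q v)"
    by (rule low[OF spQ])
  also have "\<dots> \<le> action_norm N n \<omega> v + action_norm N n \<omega> (\<lambda>i. v i - restrict_to Q v i)"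
    using action_norm_split[of N n \<omega> "restrict_to Q v" v] unfolding action_norm_minus[of N n \<omega> v] .
  also have "action_norm N n \<omega> (\<lambda>i. v i - restrict_to Q v i) = action_norm N n \<omega> (restrict_to ?R v)"
    by (rule action_norm_cong) (auto simp: restrict_to_def)
  also note rest
  finally have 1: "L2_set (restrict_to Q v) {..<n} \<le> action_norm N n \<omega> v / b + B / b * ?s"
    using b by (simp add: field_simps)
  have 2: "L2_set (restrict_to ?R v) {..<n} \<le> ?s"
  proof -
    have "(L2_set v ?R)\<^sup>2 = (\<Sum>i\<in>?R. \<bar>v i\<bar> * \<bar>v i\<bar>)"
      by (simp add: L2_set_def sum_nonneg power2_eq_square)
    also have "\<dots> \<le> (\<Sum>i\<in>?R. t * \<bar>v i\<bar>)" using Q(4) by (intro sum_mono mult_right_mono) auto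
    also have "\<dots> = t * (\<Sum>i\<in>?R. \<bar>v i\<bar>)" by (simp add: sum_distrib_left)
    also have "\<dots> \<le> ((\<Sum>i<n. \<bar>v i\<bar>) / real k) * (\<Sum>i<n. \<bar>v i\<bar>)"
    proof (intro mult_mono)
      have "real k * t \<le> (\<Sum>i<n. \<bar>v i\<bar>)"
      proof -
        have "0 \<le> (\<Sum>i\<in>?R. \<bar>v i\<bar>)" by (intro sum_nonneg) auto
        thus ?thesis using Q(5) tot by linarith
      qed
      thus "t \<le> (\<Sum>i<n. \<bar>v i\<bar>) / real k" using k by (simp add: field_simps)
      show "(\<Sum>i\<in>?R. \<bar>v i\<bar>) \<le> (\<Sum>i<n. \<bar>v i\<bar>)" by (intro sum_mono2) auto
    qed (auto intro!: sum_nonneg divide_nonneg_nonneg)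
    also have "\<dots> = ?s\<^sup>2" by (simp add: power_divide power2_eq_square)
    finally have "L2_set v ?R \<le> ?s"
      by (rule power2_le_imp_le) (auto intro!: sum_nonneg divide_nonneg_nonneg)
    thus ?thesis by (subst L2_set_restrict_to) auto
  qed
  have "L2_set v {..<n} \<le> L2_set (restrict_to Q v) {..<n} + L2_set (restrict_to (- Q) v) {..<n}"
    by (subst v) (rule L2_set_triangle_ineq)
  also have "L2_set (restrict_to (- Q) v) {..<n} = L2_set (restrict_to ?R v) {..<n}"
    by (rule L2_set_cong) (auto simp: restrict_to_def)
  finally show ?thesis using 1 2 unfolding distrib_right mult_1 by linarith
qed

section \<open>Stability of l1-minimization and compressibility\<close>

text \<open>Near-minimality bounds the mass of v outside S by its mass on S plus twice the tail of x
  plus t. The size limit k/(16 D^2) for S makes the mass on S at most a quarter of the total mass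
  plus a multiple of A, so the total mass can be solved for.\<close>

lemma l1_minimizer_stability:
  fixes x z :: "nat \<Rightarrow> real"
  defines "v \<equiv> \<lambda>i. z i - x i"
  assumes min: "(\<Sum>i<n. \<bar>z i\<bar>) \<le> (\<Sum>i<n. \<bar>x i\<bar>) + t"
    and width: "L2_set v {..<n} \<le> A + D * ((\<Sum>i<n. \<bar>v i\<bar>) / sqrt (real k))"
    and D: "D \<ge> 1" and A: "A \<ge> 0" and k: "1 \<le> k"
    and S: "S \<subseteq> {..<n}" "real (card S) \<le> real k / (16 * D\<^sup>2)"
  shows "L2_set v {..<n} \<le> 2 * A + D * ((4 * (\<Sum>i\<in>{..<n} - S. \<bar>x i\<bar>) + 2 * t) / sqrt (real k))"
proof -
  let ?R = "{..<n} - S"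
  let ?vn = "\<Sum>i<n. \<bar>v i\<bar>" and ?\<sigma> = "\<Sum>i\<in>?R. \<bar>x i\<bar>"
  have finS: "finite S" using S finite_subset by blast
  have tot: "(\<Sum>i\<in>S. g i) + (\<Sum>i\<in>?R. g i) = (\<Sum>i<n. g i)" for g :: "nat \<Rightarrow> real"
    using sum.subset_diff[OF S(1), of g] by simp
  have "(\<Sum>i\<in>S. \<bar>x i\<bar> - \<bar>v i\<bar>) + (\<Sum>i\<in>?R. \<bar>v i\<bar> - \<bar>x i\<bar>) \<le> (\<Sum>i\<in>S. \<bar>z i\<bar>) + (\<Sum>i\<in>?R. \<bar>z i\<bar>)"
    unfolding v_def by (intro add_mono sum_mono) auto
  also have "\<dots> \<le> (\<Sum>i\<in>S. \<bar>x i\<bar>) + ?\<sigma> + t"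
    unfolding tot using min .
  finally have "(\<Sum>i\<in>?R. \<bar>v i\<bar>) \<le> (\<Sum>i\<in>S. \<bar>v i\<bar>) + 2 * ?\<sigma> + t"
    by (simp add: sum_subtractf)
  hence vn: "?vn \<le> 2 * (\<Sum>i\<in>S. \<bar>v i\<bar>) + 2 * ?\<sigma> + t"
    using tot[of "\<lambda>i. \<bar>v i\<bar>"] by simp
  have "(\<Sum>i\<in>S. \<bar>v i\<bar>) \<le> sqrt (real (card S)) * L2_set v S" by (rule sum_abs_le_L2_set[OF finS])
  also have "\<dots> \<le> (sqrt (real k) / (4 * D)) * L2_set v {..<n}"
  proof (intro mult_mono)
    have "sqrt (real (card S)) \<le> sqrt (real k / (16 * D\<^sup>2))" using S by simp
    also have "\<dots> = sqrt (real k) / (4 * D)" using D by (simp add: real_sqrt_divide real_sqrt_mult)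
    finally show "sqrt (real (card S)) \<le> sqrt (real k) / (4 * D)" .
    show "L2_set v S \<le> L2_set v {..<n}"
      unfolding L2_set_def using S by (intro real_sqrt_le_mono sum_mono2) auto
  qed (use D in auto)
  also have "\<dots> \<le> (sqrt (real k) / (4 * D)) * (A + D * (?vn / sqrt (real k)))"
    using width D by (intro mult_left_mono) auto
  also have "\<dots> = sqrt (real k) * A / (4 * D) + ?vn / 4"
    using D k by (simp add: field_simps)
  finally have "?vn \<le> sqrt (real k) * A / D + 4 * ?\<sigma> + 2 * t"
    using vn by (simp add: field_simps)
  hence "D * (?vn / sqrt (real k)) \<le> D * ((sqrt (real k) * A / D + 4 * ?\<sigma> + 2 * t) / sqrt (real k))"
    using D by (intro mult_left_mono divide_right_mono) auto
  also have "\<dots> = A + D * ((4 * ?\<sigma> + 2 * t) / sqrt (real k))"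
    using D k by (simp add: field_simps)
  finally show ?thesis using width by simp
qed

text \<open>S collects the entries above t = C1 / K^(1/q), at most K of them by Markov's inequality
  for the q-th powers. Outside S each entry is at most its q-th power times t^(1-q).\<close>

lemma tail_of_lq_bounded:
  fixes a :: "nat \<Rightarrow> real"
  assumes q: "0 < q" "q \<le> 1" and C: "0 < C1" and K: "0 < K" and a: "lp_norm n q a \<le> C1"
  obtains S where "S \<subseteq> {..<n}" "real (card S) \<le> K"
    "(\<Sum>i\<in>{..<n} - S. \<bar>a i\<bar>) \<le> C1 * K powr (1 - 1 / q)"
proof -
  let ?s = "\<Sum>i<n. \<bar>a i\<bar> powr q"
  have s0: "?s \<ge> 0" by (intro sum_nonneg) auto
  have s: "?s \<le> C1 powr q"
  proof -
    have "?s = (?s powr (1 / q)) powr q" using q s0 by (simp add: powr_powr)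
    also have "\<dots> \<le> C1 powr q" using a q unfolding lp_norm_def by (intro powr_mono2) auto
    finally show ?thesis .
  qed
  define t where "t = C1 / K powr (1 / q)"
  have t: "t > 0" using C K by (simp add: t_def)
  have tq: "t powr q = C1 powr q / K" using C K q by (simp add: t_def powr_divide powr_powr)
  define S where "S = {i. i < n \<and> \<bar>a i\<bar> > t}"
  have "real (card S) * t powr q = (\<Sum>i\<in>S. t powr q)" by simp
  also have "\<dots> \<le> (\<Sum>i\<in>S. \<bar>a i\<bar> powr q)"
    using q t by (intro sum_mono powr_mono2) (auto simp: S_def)
  also have "\<dots> \<le> ?s" by (intro sum_mono2) (auto simp: S_def)
  also note s
  finally have "real (card S) * (C1 powr q / K) \<le> C1 powr q" unfolding tq .
  hence 1: "real (card S) \<le> K" using C K by (simp add: field_simps)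
  have "(\<Sum>i\<in>{..<n} - S. \<bar>a i\<bar>) \<le> (\<Sum>i\<in>{..<n} - S. \<bar>a i\<bar> powr q * t powr (1 - q))"
  proof (intro sum_mono)
    fix i assume "i \<in> {..<n} - S"
    hence at: "\<bar>a i\<bar> \<le> t" by (auto simp: S_def)
    show "\<bar>a i\<bar> \<le> \<bar>a i\<bar> powr q * t powr (1 - q)"
    proof (cases "a i = 0")
      case False
      hence "\<bar>a i\<bar> = \<bar>a i\<bar> powr q * \<bar>a i\<bar> powr (1 - q)" by (simp add: powr_add[symmetric])
      also have "\<dots> \<le> \<bar>a i\<bar> powr q * t powr (1 - q)"
        using at q by (intro mult_left_mono powr_mono2) auto
      finally show ?thesis .
    qed simp
  qed
  also have "\<dots> \<le> ?s * t powr (1 - q)"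
    unfolding sum_distrib_right[symmetric] by (intro mult_right_mono sum_mono2) auto
  also have "\<dots> \<le> C1 powr q * t powr (1 - q)" using s by (intro mult_right_mono) auto
  also have "\<dots> = C1 powr q * C1 powr (1 - q) / K powr ((1 - q) / q)"
    using C K by (simp add: t_def powr_divide powr_powr)
  also have "\<dots> = C1 * K powr (1 - 1 / q)"
  proof -
    have "C1 powr q * C1 powr (1 - q) = C1" using C by (simp add: powr_add[symmetric])
    moreover have "- ((1 - q) / q) = 1 - 1 / q" using q by (simp add: field_simps)
    hence "1 / K powr ((1 - q) / q) = K powr (1 - 1 / q)" by (simp add: powr_minus_divide[symmetric])
    ultimately show ?thesis by (simp add: divide_inverse)
  qed
  finally show ?thesis using that[of S] 1 by (auto simp: S_def)
qed

lemma restricted_isometry: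
  "\<exists>c>0. \<exists>h>0. \<exists>M. \<forall>m\<ge>M. \<forall>n\<ge>2 * m. \<forall>k. 1 \<le> k \<longrightarrow> real k \<le> c * (real m / ln (real n / real m)) \<longrightarrow>
     sign_prob m n (\<lambda>\<omega>. \<exists>x. sparse n k x \<and>
              (action_norm m n \<omega> x > 8 * sqrt (real m) * L2_set x {..<n} \<or>
               action_norm m n \<omega> x < sqrt (real m) / 20 * L2_set x {..<n})) \<le> exp (- h * real m)"
proof -
  \<comment> \<open>Since L \<ge> ln 2, the constant ln 40001 is absorbed into a multiple of L; c is
    then chosen to make 160 A' c equal to 1/20000.\<close>
  define A' where "A' = 1 + ln 40001 / ln (2::real)"
  have A': "A' > 0" by (simp add: A'_def add_pos_nonneg)
  define c where "c = 1 / (160 * 20000 * A')"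
  have c: "c > 0" using A' by (simp add: c_def)
  obtain M where M: "\<And>m. m \<ge> M \<Longrightarrow> 2 * exp (- (2 * (1/20000)) * real m) \<le> exp (- (1/20000) * real m)"
    using eventually_exp_absorb[of "1/20000" 2] by auto
  have main: "sign_prob m n (\<lambda>\<omega>. \<exists>x. sparse n k x \<and>
              (action_norm m n \<omega> x > 8 * sqrt (real m) * L2_set x {..<n} \<or>
               action_norm m n \<omega> x < sqrt (real m) / 20 * L2_set x {..<n})) \<le> exp (- (1/20000) * real m)"
    if m: "m \<ge> max M 1" and n: "n \<ge> 2 * m" and k: "1 \<le> k" "real k \<le> c * (real m / ln (real n / real m))" for m n k :: nat
  proof -
    define R where "R = real n / real m"
    have m1: "m \<ge> 1" "m \<ge> M" using m by auto
    have R: "R \<ge> 2" using n m1 by (simp add: R_def field_simps)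
    define L where "L = ln R"
    have L2: "ln 2 \<le> L" using R by (simp add: L_def)
    have L: "L > 0" using L2 ln_gt_zero[of "2::real"] by linarith
    \<comment> \<open>This makes 2 n / (exp s - 1) exactly m/20000, while s is of order ln(n/m), the
      entropy per nonzero coordinate. Both contributions together are half of the decay
      m/5000.\<close>
    define s where "s = ln (1 + 40000 * R)"
    have s: "s > 0" "exp s = 1 + 40000 * R" using R by (auto simp: s_def)
    have "s \<le> ln (40001 * R)" unfolding s_def using R by simp
    also have "\<dots> = ln 40001 + L" using R by (simp add: ln_mult L_def)
    also have "ln 40001 \<le> (ln 40001 / ln 2) * L"
      using L2 by (simp add: field_simps)
    finally have sA: "s \<le> A' * L" by (simp add: A'_def algebra_simps)
    have "real (card (int_vectors n (160 * real k))) \<le> exp (s * (160 * real k) + 2 * real n / (exp s - 1))"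
      by (rule card_int_vectors_exp[OF s(1)])
    also have "\<dots> \<le> exp (real m / 20000 + real m / 20000)"
    proof -
      have e1: "2 * real n / (exp s - 1) = real m / 20000"
        using m1 n unfolding s(2) R_def by (simp add: field_simps)
      have "s * (160 * real k) \<le> (A' * L) * (160 * (c * (real m / L)))"
        using sA s k(2) c L A' by (intro mult_mono) (auto simp: L_def R_def)
      also have "\<dots> = real m / 20000"
        using L A' by (simp add: c_def field_simps)
      finally show ?thesis using e1 by simp
    qed
    finally have card: "real (card (int_vectors n (160 * real k))) \<le> exp (real m / 10000)" by simp
    have "sign_prob m n (\<lambda>\<omega>. \<exists>x. sparse n k x \<and>
              (action_norm m n \<omega> x > 8 * sqrt (real m) * L2_set x {..<n} \<or>
               action_norm m n \<omega> x < sqrt (real m) / 20 * L2_set x {..<n}))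
        \<le> 2 * real (card (int_vectors n (160 * real k))) * exp (- real m / 5000)"
      by (rule action_sparse[OF k(1)])
    also have "\<dots> \<le> 2 * exp (real m / 10000) * exp (- real m / 5000)"
      using card by (intro mult_right_mono mult_left_mono) auto
    also have "\<dots> = 2 * exp (- (2 * (1/20000)) * real m)"
      by (simp add: exp_add[symmetric] del: exp_add)
    also have "\<dots> \<le> exp (- (1/20000) * real m)" by (rule M[OF m1(2)])
    finally show ?thesis .
  qed
  show ?thesis
    by (rule exI[of _ c], rule conjI, rule c, rule exI[of _ "1/20000"], rule conjI, simp,
        rule exI[of _ "max M 1"]) (use main in blast)
qed

subsection \<open>Random sign matrices as sign families\<close>

text \<open>The support of \<open>sign_matrix_pmf\<close>; 0 is the default value that
  \<open>Pi_pmf\<close> assigns outside the index range.\<close>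

definition sign_matrices :: "nat \<Rightarrow> nat \<Rightarrow> (nat \<times> nat \<Rightarrow> real) set" where
  "sign_matrices m d = PiE_dflt ({..<m} \<times> {..<d}) 0 (\<lambda>_. {1 / sqrt (real m), - 1 / sqrt (real m)})"

text \<open>Multiplication by sqrt m turns entries into signs. The nested restrictions make the
  result extensional in both indices, so that matrices and sign families correspond bijectively;
  \<open>scaled_columns\<close> does the same with the indices exchanged.\<close>

definition scaled_rows :: "nat \<Rightarrow> nat \<Rightarrow> (nat \<times> nat \<Rightarrow> real) \<Rightarrow> nat \<Rightarrow> nat \<Rightarrow> real" where
  "scaled_rows m d \<Phi> = (\<lambda>i\<in>{..<m}. \<lambda>k\<in>{..<d}. sqrt (real m) * \<Phi> (i, k))"

definition scaled_columns :: "nat \<Rightarrow> nat \<Rightarrow> (nat \<times> nat \<Rightarrow> real) \<Rightarrow> nat \<Rightarrow> nat \<Rightarrow> real" where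
  "scaled_columns m d \<Phi> = (\<lambda>k\<in>{..<d}. \<lambda>i\<in>{..<m}. sqrt (real m) * \<Phi> (i, k))"

lemma sign_matrix_pmf_eq: "sign_matrix_pmf m d = pmf_of_set (sign_matrices m d)"
  unfolding sign_matrix_pmf_def sign_matrices_def by (rule Pi_pmf_of_set) auto

lemma finite_sign_matrices [simp]: "finite (sign_matrices m d)"
  unfolding sign_matrices_def by (rule finite_PiE_dflt) auto

lemma sign_matrices_nonempty: "sign_matrices m d \<noteq> {}"
proof -
  have "(\<lambda>p. if p \<in> {..<m} \<times> {..<d} then 1 / sqrt (real m) else 0) \<in> sign_matrices m d"
    unfolding sign_matrices_def PiE_dflt_def by auto
  thus ?thesis by blast
qed

lemma sign_matrices_entry:
  assumes "\<Phi> \<in> sign_matrices m d" "i < m" "k < d"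
  shows "\<Phi> (i, k) = 1 / sqrt (real m) \<or> \<Phi> (i, k) = - 1 / sqrt (real m)"
proof -
  have "(i, k) \<in> {..<m} \<times> {..<d}" using assms by simp
  thus ?thesis using assms(1) unfolding sign_matrices_def PiE_dflt_def by blast
qed

lemma sign_matrices_outside:
  assumes "\<Phi> \<in> sign_matrices m d" "\<not> (i < m \<and> k < d)"
  shows "\<Phi> (i, k) = 0"
proof -
  have "(i, k) \<notin> {..<m} \<times> {..<d}" using assms by simp
  thus ?thesis using assms(1) unfolding sign_matrices_def PiE_dflt_def by blast
qed

lemma scaled_entry:
  assumes "\<Phi> \<in> sign_matrices m d" "i < m" "k < d"
  shows "sqrt (real m) * \<Phi> (i, k) \<in> {1, - 1}"
  using sign_matrices_entry[OF assms] assms(2) by auto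

lemma set_pmf_sign_matrix: "set_pmf (sign_matrix_pmf m d) = sign_matrices m d"
  unfolding sign_matrix_pmf_eq by (rule set_pmf_of_set[OF sign_matrices_nonempty finite_sign_matrices])

lemma unscaled_in_sign_matrices:
  assumes "\<And>i k. i < m \<Longrightarrow> k < d \<Longrightarrow> \<omega> i k \<in> {1, - 1 :: real}"
  shows "(\<lambda>(i, k). if i < m \<and> k < d then \<omega> i k / sqrt (real m) else 0) \<in> sign_matrices m d"
  unfolding sign_matrices_def PiE_dflt_def
proof (intro CollectI allI conjI impI)
  fix p :: "nat \<times> nat"
  obtain i k where p: "p = (i, k)" by (cases p)
  show "(case p of (i, k) \<Rightarrow> if i < m \<and> k < d then \<omega> i k / sqrt (real m) else 0) \<in> {1 / sqrt (real m), - 1 / sqrt (real m)}"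
    if "p \<in> {..<m} \<times> {..<d}"
    using that assms[of i k] p by auto
  show "(case p of (i, k) \<Rightarrow> if i < m \<and> k < d then \<omega> i k / sqrt (real m) else 0) = 0"
    if "p \<notin> {..<m} \<times> {..<d}"
    using that p by auto
qed

lemma bij_scaled_rows:
  assumes m: "1 \<le> m"
  shows "bij_betw (scaled_rows m d) (sign_matrices m d) (sign_families m d)"
proof (rule bij_betw_byWitness[where f' = "\<lambda>\<omega> (i, k). if i < m \<and> k < d then \<omega> i k / sqrt (real m) else 0"])
  show "\<forall>\<Phi>\<in>sign_matrices m d. (\<lambda>(i, k). if i < m \<and> k < d then scaled_rows m d \<Phi> i k / sqrt (real m) else 0) = \<Phi>"
    using m by (auto simp: fun_eq_iff scaled_rows_def sign_matrices_outside)
  show "\<forall>\<omega>\<in>sign_families m d. scaled_rows m d (\<lambda>(i, k). if i < m \<and> k < d then \<omega> i k / sqrt (real m) else 0) = \<omega>"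
  proof
    fix \<omega> assume \<omega>: "\<omega> \<in> sign_families m d"
    show "scaled_rows m d (\<lambda>(i, k). if i < m \<and> k < d then \<omega> i k / sqrt (real m) else 0) = \<omega>"
    proof (rule ext)
      fix i
      show "scaled_rows m d (\<lambda>(i, k). if i < m \<and> k < d then \<omega> i k / sqrt (real m) else 0) i = \<omega> i"
      proof (cases "i < m")
        case True
        hence "\<omega> i \<in> extensional {..<d}"
          using sign_families_nth[OF \<omega> True] by (simp add: sign_vectors_def PiE_def)
        thus ?thesis using True m
          by (intro ext) (auto simp: scaled_rows_def extensional_def)
      next
        case False
        thus ?thesis using \<omega> by (auto simp: scaled_rows_def sign_families_def PiE_def extensional_def)
      qed
    qed
  qed
  show "scaled_rows m d ` sign_matrices m d \<subseteq> sign_families m d"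
  proof
    fix \<omega> assume "\<omega> \<in> scaled_rows m d ` sign_matrices m d"
    then obtain \<Phi> where \<Phi>: "\<Phi> \<in> sign_matrices m d" "\<omega> = scaled_rows m d \<Phi>" by blast
    show "\<omega> \<in> sign_families m d"
      unfolding \<Phi>(2) scaled_rows_def sign_families_def sign_vectors_def
      by (rule restrict_PiE_iff[THEN iffD2], rule ballI, rule restrict_PiE_iff[THEN iffD2], rule ballI,
          rule scaled_entry[OF \<Phi>(1)]) simp_all
  qed
  show "(\<lambda>\<omega> (i, k). if i < m \<and> k < d then \<omega> i k / sqrt (real m) else 0) ` sign_families m d \<subseteq> sign_matrices m d"
  proof (rule image_subsetI)
    fix \<omega> assume \<omega>: "\<omega> \<in> sign_families m d"
    show "(\<lambda>(i, k). if i < m \<and> k < d then \<omega> i k / sqrt (real m) else 0) \<in> sign_matrices m d"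
      using sign_vector_cases[OF sign_families_nth[OF \<omega>]] by (intro unscaled_in_sign_matrices) auto
  qed
qed

lemma bij_scaled_columns:
  assumes m: "1 \<le> m"
  shows "bij_betw (scaled_columns m d) (sign_matrices m d) (sign_families d m)"
proof (rule bij_betw_byWitness[where f' = "\<lambda>\<omega> (i, k). if i < m \<and> k < d then \<omega> k i / sqrt (real m) else 0"])
  show "\<forall>\<Phi>\<in>sign_matrices m d. (\<lambda>(i, k). if i < m \<and> k < d then scaled_columns m d \<Phi> k i / sqrt (real m) else 0) = \<Phi>"
    using m by (auto simp: fun_eq_iff scaled_columns_def sign_matrices_outside)
  show "\<forall>\<omega>\<in>sign_families d m. scaled_columns m d (\<lambda>(i, k). if i < m \<and> k < d then \<omega> k i / sqrt (real m) else 0) = \<omega>"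
  proof
    fix \<omega> assume \<omega>: "\<omega> \<in> sign_families d m"
    show "scaled_columns m d (\<lambda>(i, k). if i < m \<and> k < d then \<omega> k i / sqrt (real m) else 0) = \<omega>"
    proof (rule ext)
      fix k
      show "scaled_columns m d (\<lambda>(i, k). if i < m \<and> k < d then \<omega> k i / sqrt (real m) else 0) k = \<omega> k"
      proof (cases "k < d")
        case True
        hence "\<omega> k \<in> extensional {..<m}"
          using sign_families_nth[OF \<omega> True] by (simp add: sign_vectors_def PiE_def)
        thus ?thesis using True m
          by (intro ext) (auto simp: scaled_columns_def extensional_def)
      next
        case False
        thus ?thesis using \<omega> by (auto simp: scaled_columns_def sign_families_def PiE_def extensional_def)
      qed
    qed
  qed
  show "scaled_columns m d ` sign_matrices m d \<subseteq> sign_families d m"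
  proof
    fix \<omega> assume "\<omega> \<in> scaled_columns m d ` sign_matrices m d"
    then obtain \<Phi> where \<Phi>: "\<Phi> \<in> sign_matrices m d" "\<omega> = scaled_columns m d \<Phi>" by blast
    show "\<omega> \<in> sign_families d m"
      unfolding \<Phi>(2) scaled_columns_def sign_families_def sign_vectors_def
      by (rule restrict_PiE_iff[THEN iffD2], rule ballI, rule restrict_PiE_iff[THEN iffD2], rule ballI,
          rule scaled_entry[OF \<Phi>(1)]) simp_all
  qed
  show "(\<lambda>\<omega> (i, k). if i < m \<and> k < d then \<omega> k i / sqrt (real m) else 0) ` sign_families d m \<subseteq> sign_matrices m d"
  proof (rule image_subsetI)
    fix \<omega> assume \<omega>: "\<omega> \<in> sign_families d m"
    show "(\<lambda>(i, k). if i < m \<and> k < d then \<omega> k i / sqrt (real m) else 0) \<in> sign_matrices m d"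
      using sign_vector_cases[OF sign_families_nth[OF \<omega>]] by (intro unscaled_in_sign_matrices[of m d "\<lambda>i k. \<omega> k i"]) auto
  qed
qed

text \<open>Both sides are proportions in finite sets of the same cardinality 2^(n N), matched by
  the bijection.\<close>

lemma prob_sign_matrix:
  assumes bij: "bij_betw T (sign_matrices m d) (sign_families N n)"
  shows "measure (measure_pmf (sign_matrix_pmf m d)) {\<Phi> \<in> sign_matrices m d. Q (T \<Phi>)} = sign_prob N n Q"
proof -
  have "card (sign_families N n) = 2 ^ (n * N)"
    unfolding sign_families_def by (subst card_PiE) (auto simp: card_sign_vectors power_mult)
  hence c1: "card (sign_matrices m d) = 2 ^ (n * N)"
    using bij_betw_same_card[OF bij] by simp
  have "bij_betw T {\<Phi> \<in> sign_matrices m d. Q (T \<Phi>)} {\<omega> \<in> sign_families N n. Q \<omega>}"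
    using bij by (auto simp: bij_betw_def inj_on_def image_iff)
  hence c2: "card {\<Phi> \<in> sign_matrices m d. Q (T \<Phi>)} = card {\<omega> \<in> sign_families N n. Q \<omega>}"
    by (rule bij_betw_same_card)
  have "sign_matrices m d \<inter> {\<Phi> \<in> sign_matrices m d. Q (T \<Phi>)} = {\<Phi> \<in> sign_matrices m d. Q (T \<Phi>)}"
    by blast
  thus ?thesis
    unfolding sign_matrix_pmf_eq measure_pmf_of_set[OF sign_matrices_nonempty finite_sign_matrices] sign_prob_def
    using c1 c2 by simp
qed

subsection \<open>Concentration of the sampled gradients\<close>

lemma prob_space_indep_coordinates:
  assumes M: "prob_space M" and I: "I \<noteq> {}"
  shows "prob_space.indep_vars (Pi\<^sub>M I (\<lambda>_. M)) (\<lambda>_. M) (\<lambda>i \<omega>. \<omega> i) I"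
proof -
  interpret P: prob_space "Pi\<^sub>M I (\<lambda>_. M)" by (rule prob_space_PiM) (rule M)
  have "distr (Pi\<^sub>M I (\<lambda>_. M)) (Pi\<^sub>M I (\<lambda>_. M)) (\<lambda>x. \<lambda>i\<in>I. x i) = distr (Pi\<^sub>M I (\<lambda>_. M)) (Pi\<^sub>M I (\<lambda>_. M)) (\<lambda>x. x)"
    by (rule distr_cong) (auto simp: space_PiM PiE_def extensional_restrict)
  also have "\<dots> = Pi\<^sub>M I (\<lambda>_. M)" by (rule distr_id)
  also have "\<dots> = Pi\<^sub>M I (\<lambda>i. distr (Pi\<^sub>M I (\<lambda>_. M)) M (\<lambda>x. x i))"
    by (intro PiM_cong refl distr_PiM_component[symmetric]) (use M in auto)
  finally show ?thesis
    by (subst P.indep_vars_iff_distr_eq_PiM'[OF I]) (auto intro: measurable_component_singleton)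
qed

text \<open>Hoeffding's inequality for a deviation of n s \<alpha> below a mean that is at least n
  \<alpha>: the exponent is 2 (n s \<alpha>)^2 / (n B^2).\<close>

lemma sample_mean_lower_bound:
  fixes H :: "'a \<Rightarrow> real"
  assumes M: "prob_space M" and H: "H \<in> borel_measurable M" and rng: "\<And>x. x \<in> space M \<Longrightarrow> 0 \<le> H x \<and> H x \<le> B"
    and B: "B > 0" and n: "1 \<le> n" and \<alpha>: "0 < \<alpha>" "\<alpha> \<le> (\<integral>x. H x \<partial>M)" and s: "0 < s"
  shows "measure (Pi\<^sub>M {..<n} (\<lambda>_. M)) {\<xi> \<in> space (Pi\<^sub>M {..<n} (\<lambda>_. M)). real n * (\<alpha> * (1 - s)) \<le> (\<Sum>j<n. H (\<xi> j))}
      \<ge> 1 - exp (- (2 * real n * s\<^sup>2 * \<alpha>\<^sup>2 / B\<^sup>2))"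
proof -
  let ?P = "Pi\<^sub>M {..<n} (\<lambda>_. M)"
  interpret P: prob_space ?P by (rule prob_space_PiM) (rule M)
  interpret prob_space M by (rule M)
  have ne: "{..<n} \<noteq> {}" using n by (simp add: lessThan_empty_iff)
  have meas [measurable]: "(\<lambda>\<xi>. H (\<xi> j)) \<in> borel_measurable ?P" if "j < n" for j
    using that H by (intro measurable_compose[OF measurable_component_singleton]) auto
  have indep: "P.indep_vars (\<lambda>_. borel) (\<lambda>j \<xi>. H (\<xi> j)) {..<n}"
    by (rule P.indep_vars_compose2[OF prob_space_indep_coordinates[OF M ne]]) (rule H)
  interpret Hf: Hoeffding_ineq ?P "{..<n}" "\<lambda>j \<xi>. H (\<xi> j)" "\<lambda>_. 0" "\<lambda>_. B" "\<Sum>j<n. P.expectation (\<lambda>\<xi>. H (\<xi> j))"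
  proof unfold_locales
    show "finite {..<n}" by simp
    show "P.indep_vars (\<lambda>_. borel) (\<lambda>j \<xi>. H (\<xi> j)) {..<n}" by (rule indep)
    show "AE \<xi> in ?P. H (\<xi> j) \<in> {0..B}" if "j \<in> {..<n}" for j
      using that rng by (intro AE_I2) (auto simp: space_PiM PiE_def Pi_def)
  qed simp
  have ex: "P.expectation (\<lambda>\<xi>. H (\<xi> j)) = (\<integral>x. H x \<partial>M)" if "j \<in> {..<n}" for j
  proof -
    have "(\<integral>x. H x \<partial>M) = (\<integral>x. H x \<partial>distr ?P M (\<lambda>\<xi>. \<xi> j))"
      by (subst distr_PiM_component) (use M that in auto)
    also have "\<dots> = P.expectation (\<lambda>\<xi>. H (\<xi> j))"
      using H that by (intro integral_distr measurable_component_singleton) auto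
    finally show ?thesis by simp
  qed
  have mu: "(\<Sum>j<n. P.expectation (\<lambda>\<xi>. H (\<xi> j))) = real n * (\<integral>x. H x \<partial>M)"
    using ex by simp
  define \<epsilon> where "\<epsilon> = real n * (s * \<alpha>)"
  have \<epsilon>: "\<epsilon> \<ge> 0" using \<alpha> s by (simp add: \<epsilon>_def)
  have "P.prob {\<xi> \<in> space ?P. (\<Sum>j<n. H (\<xi> j)) \<le> (\<Sum>j<n. P.expectation (\<lambda>\<xi>. H (\<xi> j))) - \<epsilon>}
      \<le> exp (- 2 * \<epsilon>\<^sup>2 / (\<Sum>j<n. (B - 0)\<^sup>2))"
    by (rule Hf.Hoeffding_ineq_le[OF \<epsilon>]) (use B n in simp)
  also have "- 2 * \<epsilon>\<^sup>2 / (\<Sum>j<n. (B - 0)\<^sup>2) = - (2 * real n * s\<^sup>2 * \<alpha>\<^sup>2 / B\<^sup>2)"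
    using n B by (simp add: \<epsilon>_def power_mult_distrib power2_eq_square)
  finally have le: "P.prob {\<xi> \<in> space ?P. (\<Sum>j<n. H (\<xi> j)) \<le> (\<Sum>j<n. P.expectation (\<lambda>\<xi>. H (\<xi> j))) - \<epsilon>}
      \<le> exp (- (2 * real n * s\<^sup>2 * \<alpha>\<^sup>2 / B\<^sup>2))" .
  let ?G = "{\<xi> \<in> space ?P. real n * (\<alpha> * (1 - s)) \<le> (\<Sum>j<n. H (\<xi> j))}"
  have sets: "?G \<in> P.events"
    by measurable
  have "1 - P.prob ?G = P.prob (space ?P - ?G)" by (rule P.prob_compl[OF sets, symmetric])
  also have "\<dots> \<le> P.prob {\<xi> \<in> space ?P. (\<Sum>j<n. H (\<xi> j)) \<le> (\<Sum>j<n. P.expectation (\<lambda>\<xi>. H (\<xi> j))) - \<epsilon>}"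
  proof (rule P.finite_measure_mono)
    show "space ?P - ?G \<subseteq> {\<xi> \<in> space ?P. (\<Sum>j<n. H (\<xi> j)) \<le> (\<Sum>j<n. P.expectation (\<lambda>\<xi>. H (\<xi> j))) - \<epsilon>}"
    proof
      fix \<xi> assume "\<xi> \<in> space ?P - ?G"
      hence \<xi>: "\<xi> \<in> space ?P" "(\<Sum>j<n. H (\<xi> j)) \<le> real n * (\<alpha> * (1 - s))" by auto
      have "real n * (\<alpha> * (1 - s)) \<le> real n * (\<integral>x. H x \<partial>M) - \<epsilon>"
        using mult_left_mono[OF \<alpha>(2), of "real n"] by (simp add: \<epsilon>_def algebra_simps)
      thus "\<xi> \<in> {\<xi> \<in> space ?P. (\<Sum>j<n. H (\<xi> j)) \<le> (\<Sum>j<n. P.expectation (\<lambda>\<xi>. H (\<xi> j))) - \<epsilon>}"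
        using \<xi> unfolding mu by auto
    qed
    show "{\<xi> \<in> space ?P. (\<Sum>j<n. H (\<xi> j)) \<le> (\<Sum>j<n. P.expectation (\<lambda>\<xi>. H (\<xi> j))) - \<epsilon>} \<in> P.events"
      by measurable
  qed
  also note le
  finally show ?thesis by linarith
qed

subsection \<open>Recovery of a single gradient\<close>

lemma lp_norm_2: "lp_norm d 2 x = L2_set x {..<d}"
  unfolding lp_norm_def L2_set_def
  by (simp add: powr_half_sqrt sum_nonneg)

lemma lp_norm_1: "lp_norm d 1 x = (\<Sum>i<d. \<bar>x i\<bar>)"
  unfolding lp_norm_def by (simp add: sum_nonneg powr_one_gt_zero_iff)

text \<open>The feasible set is closed, and the l1-norm bounds every coordinate, so it is coercive.
  Any solution of the system, extensional or not, provides the starting point after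
  restriction.\<close>

lemma l1_minimizers_nonempty:
  assumes w: "\<And>i. i < m \<Longrightarrow> (\<Sum>k<d. \<Phi> (i, k) * w k) = y i"
  shows "l1_minimizers d m \<Phi> y \<noteq> {}"
proof -
  define G where "G = {z. \<forall>i\<in>{..<m}. dot d (\<lambda>k. \<Phi> (i, k)) z = y i}"
  have "G = (\<Inter>i\<in>{..<m}. {z. dot d (\<lambda>k. \<Phi> (i, k)) z = y i})"
    by (auto simp: G_def)
  moreover have "closed (\<Inter>i\<in>{..<m}. {z. dot d (\<lambda>k. \<Phi> (i, k)) z = y i})"
    by (intro closed_INT ballI closed_Collect_eq continuous_intros)
  ultimately have G: "closed G" by simp
  define x0 where "x0 = (\<lambda>k\<in>{..<d}. w k)"
  have x0: "x0 \<in> vectors d \<inter> G"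
    using w by (auto simp: x0_def vectors_def G_def dot_def)
  have "\<exists>x\<in>vectors d \<inter> G. \<forall>y\<in>vectors d \<inter> G. (\<Sum>i<d. \<bar>x i\<bar>) \<le> (\<Sum>i<d. \<bar>y i\<bar>)"
  proof (rule attains_min_vectors[OF G x0, where r = "\<Sum>i<d. \<bar>x0 i\<bar>"])
    show "continuous_on UNIV (\<lambda>x :: nat \<Rightarrow> real. \<Sum>i<d. \<bar>x i\<bar>)"
      by (intro continuous_intros continuous_on_product_coordinates)
    fix x i assume "(\<Sum>i<d. \<bar>x i\<bar>) \<le> (\<Sum>i<d. \<bar>x0 i\<bar>)" "i < d"
    moreover have "\<bar>x i\<bar> \<le> (\<Sum>i<d. \<bar>x i\<bar>)"
      using \<open>i < d\<close> by (intro member_le_sum) auto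
    ultimately show "\<bar>x i\<bar> \<le> (\<Sum>i<d. \<bar>x0 i\<bar>)" by linarith
  qed
  then obtain x where x: "x \<in> vectors d \<inter> G" "\<And>y. y \<in> vectors d \<inter> G \<Longrightarrow> lp_norm d 1 x \<le> lp_norm d 1 y"
    unfolding lp_norm_1 by blast
  have "{z \<in> vectors d. \<forall>i<m. (\<Sum>k<d. \<Phi> (i, k) * z k) = y i} = vectors d \<inter> G"
    by (auto simp: G_def dot_def)
  hence "x \<in> l1_minimizers d m \<Phi> y"
    unfolding l1_minimizers_def Let_def using x by blast
  thus ?thesis by blast
qed

text \<open>The deterministic interface between probability and recovery: restricted isometry up to
  level k for the rows, the quotient property for the columns, both stated for unnormalised
  signs.\<close>

definition good_matrix :: "nat \<Rightarrow> nat \<Rightarrow> nat \<Rightarrow> real \<Rightarrow> (nat \<times> nat \<Rightarrow> real) \<Rightarrow> bool" where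
  "good_matrix d m k C \<Phi> \<longleftrightarrow>
     (\<forall>x. sparse d k x \<longrightarrow>
        action_norm m d (scaled_rows m d \<Phi>) x \<le> 8 * sqrt (real m) * L2_set x {..<d} \<and>
        sqrt (real m) / 20 * L2_set x {..<d} \<le> action_norm m d (scaled_rows m d \<Phi>) x) \<and>
     (\<forall>y. (\<forall>i<m. \<bar>y i\<bar> \<le> 1) \<longrightarrow>
        (\<exists>u. (\<forall>i<m. (\<Sum>j<d. u j * scaled_columns m d \<Phi> j i) = y i) \<and>
             (\<Sum>j<d. \<bar>u j\<bar>) \<le> C * sqrt (real m / ln (real d / real m))))"

lemma good_matrix_absorbs_noise:
  assumes m: "1 \<le> m" and good: "good_matrix d m k C \<Phi>"
    and \<beta>: "0 \<le> \<beta>" and noise: "\<And>i. i < m \<Longrightarrow> \<bar>\<eta> i\<bar> \<le> \<beta> / real m"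
  obtains u where "\<And>i. i < m \<Longrightarrow> (\<Sum>k<d. \<Phi> (i, k) * u k) = \<eta> i"
    "(\<Sum>k<d. \<bar>u k\<bar>) \<le> \<beta> / sqrt (real m) * (C * sqrt (real m / ln (real d / real m)))"
proof -
  \<comment> \<open>Rescaled to sup-norm at most 1. For \<beta> = 0 the quotient is 0 by convention,
    which is consistent because the noise then vanishes.\<close>
  define y where "y = (\<lambda>i. \<eta> i * real m / \<beta>)"
  have "\<bar>y i\<bar> \<le> 1" if "i < m" for i
  proof (cases "\<beta> = 0")
    case False
    hence "\<beta> > 0" using \<beta> by simp
    thus ?thesis using noise[OF that] m by (simp add: y_def abs_mult field_simps)
  qed (simp add: y_def)
  then obtain u where u: "\<forall>i<m. (\<Sum>j<d. u j * scaled_columns m d \<Phi> j i) = y i"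
    "(\<Sum>j<d. \<bar>u j\<bar>) \<le> C * sqrt (real m / ln (real d / real m))"
    using good unfolding good_matrix_def by blast
  let ?c = "\<beta> / sqrt (real m)"
  have "(\<Sum>k<d. \<Phi> (i, k) * (?c * u k)) = \<eta> i" if i: "i < m" for i
  proof -
    have "(\<Sum>j<d. u j * scaled_columns m d \<Phi> j i) = sqrt (real m) * (\<Sum>k<d. \<Phi> (i, k) * u k)"
      unfolding sum_distrib_left using i by (intro sum.cong) (auto simp: scaled_columns_def)
    hence "sqrt (real m) * (\<Sum>k<d. \<Phi> (i, k) * u k) = y i" using u(1) i by simp
    hence "(\<Sum>k<d. \<Phi> (i, k) * u k) = y i / sqrt (real m)" using m by (simp add: field_simps)
    moreover have "(\<Sum>k<d. \<Phi> (i, k) * (?c * u k)) = ?c * (\<Sum>k<d. \<Phi> (i, k) * u k)"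
      unfolding sum_distrib_left by (intro sum.cong) auto
    ultimately have "(\<Sum>k<d. \<Phi> (i, k) * (?c * u k)) = ?c * (y i / sqrt (real m))" by simp
    also have "\<dots> = \<beta> * y i / real m" by simp
    also have "\<dots> = \<eta> i"
      using noise[OF i] m by (cases "\<beta> = 0") (auto simp: y_def)
    finally show ?thesis .
  qed
  moreover have "(\<Sum>k<d. \<bar>?c * u k\<bar>) \<le> ?c * (C * sqrt (real m / ln (real d / real m)))"
  proof -
    have "(\<Sum>k<d. \<bar>?c * u k\<bar>) = ?c * (\<Sum>k<d. \<bar>u k\<bar>)"
      unfolding sum_distrib_left using \<beta> by (intro sum.cong) (auto simp: abs_mult)
    thus ?thesis using mult_left_mono[OF u(2), of ?c] \<beta> by simp
  qed
  ultimately show ?thesis using that[of "\<lambda>k. ?c * u k"] by blast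
qed

text \<open>Adding the noise representation u to x gives a vector that fits the data exactly, so the
  minimizer exceeds the l1-norm of x by at most that of u. The constants are 161 = 8/(1/20) + 1 and
  40 = 2 * 20.\<close>

lemma l1_recovery:
  fixes x z y :: "nat \<Rightarrow> real"
  assumes m: "1 \<le> m" and k: "1 \<le> k" and good: "good_matrix d m k C \<Phi>"
    and \<beta>: "0 \<le> \<beta>" and noise: "\<And>i. i < m \<Longrightarrow> \<bar>y i - (\<Sum>l<d. \<Phi> (i, l) * x l)\<bar> \<le> \<beta> / real m"
    and z: "z \<in> l1_minimizers d m \<Phi> y"
    and S: "S \<subseteq> {..<d}" "real (card S) \<le> real k / (16 * 161\<^sup>2)"
  shows "L2_set (\<lambda>i. z i - x i) {..<d} \<le> 40 * (\<beta> / sqrt (real m)) +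
     161 * ((4 * (\<Sum>i\<in>{..<d} - S. \<bar>x i\<bar>) + 2 * (\<beta> / sqrt (real m) * (C * sqrt (real m / ln (real d / real m))))) / sqrt (real k))"
proof -
  let ?\<eta> = "\<lambda>i. y i - (\<Sum>l<d. \<Phi> (i, l) * x l)"
  obtain u where u: "\<And>i. i < m \<Longrightarrow> (\<Sum>l<d. \<Phi> (i, l) * u l) = ?\<eta> i"
    "(\<Sum>l<d. \<bar>u l\<bar>) \<le> \<beta> / sqrt (real m) * (C * sqrt (real m / ln (real d / real m)))"
    by (rule good_matrix_absorbs_noise[OF m good \<beta>, of ?\<eta>]) (use noise in auto)
  define t where "t = \<beta> / sqrt (real m) * (C * sqrt (real m / ln (real d / real m)))"
  define w where "w = (\<lambda>l\<in>{..<d}. x l + u l)"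
  let ?F = "{z \<in> vectors d. \<forall>i<m. (\<Sum>l<d. \<Phi> (i, l) * z l) = y i}"
  have zF: "z \<in> ?F" "\<And>w. w \<in> ?F \<Longrightarrow> lp_norm d 1 z \<le> lp_norm d 1 w"
    using z unfolding l1_minimizers_def Let_def by auto
  have "(\<Sum>l<d. \<Phi> (i, l) * w l) = y i" if "i < m" for i
  proof -
    have "(\<Sum>l<d. \<Phi> (i, l) * w l) = (\<Sum>l<d. \<Phi> (i, l) * x l + \<Phi> (i, l) * u l)"
      by (intro sum.cong) (auto simp: w_def algebra_simps)
    thus ?thesis using u(1)[OF that] by (simp add: sum.distrib)
  qed
  hence "w \<in> ?F" by (simp add: w_def vectors_def)
  hence "(\<Sum>i<d. \<bar>z i\<bar>) \<le> (\<Sum>i<d. \<bar>w i\<bar>)" using zF(2)[of w] by (simp add: lp_norm_1)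
  also have "\<dots> \<le> (\<Sum>i<d. \<bar>x i\<bar> + \<bar>u i\<bar>)"
    by (intro sum_mono) (auto simp: w_def)
  also have "\<dots> \<le> (\<Sum>i<d. \<bar>x i\<bar>) + t" using u(2) by (simp add: sum.distrib t_def)
  finally have min: "(\<Sum>i<d. \<bar>z i\<bar>) \<le> (\<Sum>i<d. \<bar>x i\<bar>) + t" .
  let ?v = "\<lambda>i. z i - x i"
  let ?\<omega> = "scaled_rows m d \<Phi>"
  have act: "action_norm m d ?\<omega> ?v \<le> \<beta>"
  proof -
    have "action_norm m d ?\<omega> ?v \<le> L2_set (\<lambda>i. \<beta> / sqrt (real m)) {..<m}"
      unfolding action_norm_def
    proof (rule L2_set_le_abs)
      fix i assume i: "i \<in> {..<m}"
      have "dot d (?\<omega> i) ?v = sqrt (real m) * ((\<Sum>l<d. \<Phi> (i, l) * z l) - (\<Sum>l<d. \<Phi> (i, l) * x l))"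
        using i unfolding dot_def sum_subtractf[symmetric] sum_distrib_left
        by (intro sum.cong) (auto simp: scaled_rows_def algebra_simps)
      also have "\<dots> = sqrt (real m) * ?\<eta> i" using zF(1) i by simp
      finally have "\<bar>dot d (?\<omega> i) ?v\<bar> = sqrt (real m) * \<bar>?\<eta> i\<bar>" by (simp add: abs_mult)
      also have "\<dots> \<le> sqrt (real m) * (\<beta> / real m)" using noise[of i] i by (intro mult_left_mono) auto
      also have "\<dots> = \<beta> / sqrt (real m)"
        using m by (simp add: field_simps)
      finally show "\<bar>dot d (?\<omega> i) ?v\<bar> \<le> \<bar>\<beta> / sqrt (real m)\<bar>" by linarith
    qed
    also have "\<dots> = \<beta>" using m \<beta> by (simp add: L2_set_def power_divide)
    finally show ?thesis .
  qed
  have rip: "\<And>x. sparse d k x \<Longrightarrow> action_norm m d ?\<omega> x \<le> (8 * sqrt (real m)) * L2_set x {..<d}"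
    "\<And>x. sparse d k x \<Longrightarrow> (sqrt (real m) / 20) * L2_set x {..<d} \<le> action_norm m d ?\<omega> x"
    using good unfolding good_matrix_def by auto
  have "L2_set ?v {..<d} \<le> action_norm m d ?\<omega> ?v / (sqrt (real m) / 20)
      + (8 * sqrt (real m) / (sqrt (real m) / 20) + 1) * ((\<Sum>i<d. \<bar>?v i\<bar>) / sqrt (real k))"
    by (rule L2_set_le_action_and_l1[OF rip k]) (use m in auto)
  also have "8 * sqrt (real m) / (sqrt (real m) / 20) + 1 = 161" using m by simp
  also have "action_norm m d ?\<omega> ?v / (sqrt (real m) / 20) \<le> \<beta> / (sqrt (real m) / 20)"
    using act by (intro divide_right_mono) auto
  finally have width: "L2_set ?v {..<d} \<le> 20 * (\<beta> / sqrt (real m)) + 161 * ((\<Sum>i<d. \<bar>?v i\<bar>) / sqrt (real k))"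
    by (simp add: mult.commute)
  have "L2_set ?v {..<d} \<le> 2 * (20 * (\<beta> / sqrt (real m))) +
      161 * ((4 * (\<Sum>i\<in>{..<d} - S. \<bar>x i\<bar>) + 2 * t) / sqrt (real k))"
    by (rule l1_minimizer_stability[OF min width _ _ k S]) (use \<beta> in auto)
  thus ?thesis unfolding t_def by simp
qed

subsection \<open>Good matrices are likely\<close>

lemma good_matrix_likely:
  "\<exists>C>0. \<exists>c>0. \<exists>h>0. \<exists>M. \<forall>m\<ge>M. \<forall>d\<ge>2 * m. \<forall>k. ln (real d) \<le> real m \<longrightarrow> 1 \<le> k \<longrightarrow>
     real k \<le> c * (real m / ln (real d / real m)) \<longrightarrow>
     measure (measure_pmf (sign_matrix_pmf m d)) {\<Phi> \<in> sign_matrices m d. good_matrix d m k C \<Phi>} \<ge> 1 - exp (- h * real m)"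
proof -
  obtain C h1 M1 where C: "C > 0" and h1: "h1 > 0" and Q: "\<And>m N. m \<ge> M1 \<Longrightarrow> N \<ge> 2 * m \<Longrightarrow> ln (real N) \<le> real m \<Longrightarrow>
     sign_prob N m (\<lambda>\<omega>. \<not> (\<forall>y. (\<forall>i<m. \<bar>y i\<bar> \<le> 1) \<longrightarrow>
        (\<exists>u. (\<forall>i<m. (\<Sum>j<N. u j * \<omega> j i) = y i) \<and>
             (\<Sum>j<N. \<bar>u j\<bar>) \<le> C * sqrt (real m / ln (real N / real m)))))
       \<le> exp (- h1 * real m)"
    using quotient_property by blast
  obtain c h2 M2 where c: "c > 0" and h2: "h2 > 0" and R: "\<And>m n k. m \<ge> M2 \<Longrightarrow> n \<ge> 2 * m \<Longrightarrow> 1 \<le> k \<Longrightarrow>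
     real k \<le> c * (real m / ln (real n / real m)) \<Longrightarrow>
     sign_prob m n (\<lambda>\<omega>. \<exists>x. sparse n k x \<and>
              (action_norm m n \<omega> x > 8 * sqrt (real m) * L2_set x {..<n} \<or>
               action_norm m n \<omega> x < sqrt (real m) / 20 * L2_set x {..<n})) \<le> exp (- h2 * real m)"
    using restricted_isometry by blast
  \<comment> \<open>Half of the smaller rate, so that the sum of the two failure probabilities is
    absorbed.\<close>
  define h where "h = min h1 h2 / 2"
  have h: "h > 0" "2 * h \<le> h1" "2 * h \<le> h2" using h1 h2 by (auto simp: h_def)
  obtain M3 where M3: "\<And>m. m \<ge> M3 \<Longrightarrow> 2 * exp (- (2 * h) * real m) \<le> exp (- h * real m)"
    using eventually_exp_absorb[OF h(1), of 2] by auto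
  have main: "measure (measure_pmf (sign_matrix_pmf m d)) {\<Phi> \<in> sign_matrices m d. good_matrix d m k C \<Phi>} \<ge> 1 - exp (- h * real m)"
    if m: "m \<ge> max (max M1 M2) (max M3 1)" and d: "d \<ge> 2 * m" and ld: "ln (real d) \<le> real m" and k: "1 \<le> k"
      and kc: "real k \<le> c * (real m / ln (real d / real m))" for m d k :: nat
  proof -
    have m': "m \<ge> M1" "m \<ge> M2" "m \<ge> M3" "1 \<le> m" using m by auto
    let ?p = "sign_matrix_pmf m d"
    define A where "A = (\<lambda>\<omega>. \<exists>x. sparse d k x \<and>
              (action_norm m d \<omega> x > 8 * sqrt (real m) * L2_set x {..<d} \<or>
               action_norm m d \<omega> x < sqrt (real m) / 20 * L2_set x {..<d}))"
    define B where "B = (\<lambda>\<omega>. \<forall>y. (\<forall>i<m. \<bar>y i\<bar> \<le> 1) \<longrightarrow>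
        (\<exists>u. (\<forall>i<m. (\<Sum>j<d. u j * \<omega> j i) = y i) \<and>
             (\<Sum>j<d. \<bar>u j\<bar>) \<le> C * sqrt (real m / ln (real d / real m))))"
    let ?G = "{\<Phi> \<in> sign_matrices m d. good_matrix d m k C \<Phi>}"
    let ?A = "{\<Phi> \<in> sign_matrices m d. A (scaled_rows m d \<Phi>)}"
    let ?B = "{\<Phi> \<in> sign_matrices m d. \<not> B (scaled_columns m d \<Phi>)}"
    have good: "good_matrix d m k C \<Phi>" if "\<not> A (scaled_rows m d \<Phi>)" "B (scaled_columns m d \<Phi>)" for \<Phi>
    proof -
      have "action_norm m d (scaled_rows m d \<Phi>) x \<le> 8 * sqrt (real m) * L2_set x {..<d} \<and>
        sqrt (real m) / 20 * L2_set x {..<d} \<le> action_norm m d (scaled_rows m d \<Phi>) x" if "sparse d k x" for x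
        using \<open>\<not> A (scaled_rows m d \<Phi>)\<close> that unfolding A_def by (meson not_less)
      thus ?thesis using that(2) unfolding good_matrix_def B_def by simp
    qed
    have "1 = measure ?p (sign_matrices m d)"
      unfolding sign_matrix_pmf_eq measure_pmf_of_set[OF sign_matrices_nonempty finite_sign_matrices]
      using sign_matrices_nonempty[of m d] by simp
    also have "\<dots> \<le> measure ?p (?G \<union> (?A \<union> ?B))"
      by (rule measure_pmf.finite_measure_mono) (use good in auto)
    also have "\<dots> \<le> measure ?p ?G + measure ?p (?A \<union> ?B)"
      by (rule measure_Un_le) auto
    also have "measure ?p (?A \<union> ?B) \<le> measure ?p ?A + measure ?p ?B"
      by (rule measure_Un_le) auto
    also have "measure ?p ?A = sign_prob m d A"
      by (rule prob_sign_matrix[OF bij_scaled_rows[OF m'(4)]])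
    also have "\<dots> \<le> exp (- h2 * real m)"
      unfolding A_def by (rule R[OF m'(2) d k kc])
    also have "\<dots> \<le> exp (- (2 * h) * real m)" using mult_right_mono[OF h(3), of "real m"] by simp
    also have "measure ?p ?B = sign_prob d m (\<lambda>\<omega>. \<not> B \<omega>)"
      by (rule prob_sign_matrix[OF bij_scaled_columns[OF m'(4)]])
    also have "\<dots> \<le> exp (- h1 * real m)"
      unfolding B_def by (rule Q[OF m'(1) d ld])
    also have "\<dots> \<le> exp (- (2 * h) * real m)" using mult_right_mono[OF h(2), of "real m"] by simp
    finally have "1 \<le> measure ?p ?G + 2 * exp (- (2 * h) * real m)" by simp
    thus ?thesis using M3[OF m'(3)] by linarith
  qed
  show ?thesis
    by (rule exI[of _ C], rule conjI, rule C, rule exI[of _ c], rule conjI, rule c,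
        rule exI[of _ h], rule conjI, rule h(1), rule exI[of _ "max (max M1 M2) (max M3 1)"])
       (use main in blast)
qed

subsection \<open>From gradients to the ridge function\<close>

text \<open>For two unit vectors the distance from a to the line of \<open>ahat\<close> equals the
  distance from \<open>ahat\<close> to the line of a, and the latter is at most the distance to the
  particular point (t/l) a. Lines are compared because t may be negative, in which case
  \<open>ahat\<close> is close to - a.\<close>

lemma direction_error:
  assumes a: "L2_set a {..<d} = 1" and l: "0 < L2_set x {..<d}" "r \<le> L2_set x {..<d}" "0 < r"
    and x: "L2_set (\<lambda>i. x i - t * a i) {..<d} \<le> \<nu>"
    and ahat: "ahat = (\<lambda>i\<in>{..<d}. x i / L2_set x {..<d})"
  shows "L2_set ahat {..<d} = 1"
    "L2_set (\<lambda>i. a i - dot d a ahat * ahat i) {..<d} \<le> \<nu> / r"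
proof -
  define l where "l = L2_set x {..<d}"
  have l0: "l > 0" using l by (simp add: l_def)
  have "L2_set ahat {..<d} = L2_set (\<lambda>i. inverse l * x i) {..<d}"
    unfolding ahat l_def[symmetric] by (rule L2_set_cong) (auto simp: divide_inverse)
  thus ah: "L2_set ahat {..<d} = 1" using l0 by (simp add: L2_set_scale l_def[symmetric])
  have sq: "(L2_set v {..<d})\<^sup>2 = dot d v v" for v
    by (simp add: L2_set_def sum_nonneg dot_def power2_eq_square)
  have aa: "dot d a a = 1" "dot d ahat ahat = 1" using sq[of a] sq[of ahat] a ah by auto
  define c where "c = dot d a ahat"
  have ex: "dot d (\<lambda>i. v i - s * w i) (\<lambda>i. v i - s * w i) = dot d v v - 2 * s * dot d v w + s\<^sup>2 * dot d w w" for v w s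
  proof -
    have "dot d (\<lambda>i. v i - s * w i) (\<lambda>i. v i - s * w i) = (\<Sum>i<d. v i * v i - 2 * s * (v i * w i) + s\<^sup>2 * (w i * w i))"
      unfolding dot_def by (intro sum.cong) (auto simp: algebra_simps power2_eq_square)
    also have "\<dots> = dot d v v - 2 * s * dot d v w + s\<^sup>2 * dot d w w"
      by (simp add: dot_def sum.distrib sum_subtractf sum_distrib_left)
    finally show ?thesis .
  qed
  have "(L2_set (\<lambda>i. a i - c * ahat i) {..<d})\<^sup>2 = 1 - c\<^sup>2"
    unfolding sq ex aa c_def[symmetric] by (simp add: power2_eq_square)
  also have "\<dots> \<le> 1 - 2 * (t / l) * c + (t / l)\<^sup>2"
    using zero_le_power2[of "t / l - c"] by (simp add: power2_diff)
  also have "\<dots> = (L2_set (\<lambda>i. ahat i - t / l * a i) {..<d})\<^sup>2"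
    unfolding sq ex aa by (simp add: c_def dot_commute)
  finally have "L2_set (\<lambda>i. a i - c * ahat i) {..<d} \<le> L2_set (\<lambda>i. ahat i - t / l * a i) {..<d}"
    by (rule power2_le_imp_le) simp
  also have "\<dots> = L2_set (\<lambda>i. inverse l * (x i - t * a i)) {..<d}"
    by (rule L2_set_cong) (auto simp: ahat l_def[symmetric] divide_inverse algebra_simps)
  also have "\<dots> = L2_set (\<lambda>i. x i - t * a i) {..<d} / l"
    unfolding L2_set_scale using l0 by (simp add: divide_inverse mult.commute)
  also have "\<dots> \<le> \<nu> / l" using x l0 by (intro divide_right_mono) auto
  also have "\<dots> \<le> \<nu> / r"
  proof -
    have "0 \<le> \<nu>" using x L2_set_nonneg[of "\<lambda>i. x i - t * a i" "{..<d}"] by linarith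
    thus ?thesis using l l0 by (intro divide_left_mono) (auto simp: l_def)
  qed
  finally show "L2_set (\<lambda>i. a i - dot d a ahat * ahat i) {..<d} \<le> \<nu> / r" by (simp add: c_def)
qed

section \<open>One-variable estimates and ridge functions\<close>

lemma derivative_bound_imp_lipschitz:
  fixes G G' :: "real \<Rightarrow> real"
  assumes "\<And>t. t \<in> {l..u} \<Longrightarrow> (G has_real_derivative G' t) (at t within {l..u})"
    and "\<And>t. t \<in> {l..u} \<Longrightarrow> \<bar>G' t\<bar> \<le> B" and "s \<in> {l..u}" "t \<in> {l..u}"
  shows "\<bar>G s - G t\<bar> \<le> B * \<bar>s - t\<bar>"
  using field_differentiable_bound[of "{l..u}" G G' B s t] assms by simp

text \<open>The tangent part is subtracted and the mean value bound is used twice on the interval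
  between s and s + h. This needs derivatives within the interval only, and gives the constant
  B.\<close>

lemma taylor_error:
  fixes g g' g'' :: "real \<Rightarrow> real"
  assumes g: "\<And>t. t \<in> {l..u} \<Longrightarrow> (g has_real_derivative g' t) (at t within {l..u})"
    and g': "\<And>t. t \<in> {l..u} \<Longrightarrow> (g' has_real_derivative g'' t) (at t within {l..u})"
    and bound: "\<And>t. t \<in> {l..u} \<Longrightarrow> \<bar>g'' t\<bar> \<le> B" and s: "s \<in> {l..u}" "s + h \<in> {l..u}"
  shows "\<bar>g (s + h) - g s - g' s * h\<bar> \<le> B * h\<^sup>2"
proof -
  define I where "I = {min s (s + h)..max s (s + h)}"
  have I: "I \<subseteq> {l..u}" using s by (auto simp: I_def)
  have sI: "s \<in> I" "s + h \<in> I" by (auto simp: I_def)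
  have "\<bar>(g (s + h) - g' s * (s + h)) - (g s - g' s * s)\<bar> \<le> (B * \<bar>h\<bar>) * \<bar>(s + h) - s\<bar>"
  proof (rule derivative_bound_imp_lipschitz[where l = "min s (s + h)" and u = "max s (s + h)"
        and G = "\<lambda>t. g t - g' s * t" and G' = "\<lambda>t. g' t - g' s"], unfold I_def[symmetric])
    fix t assume t: "t \<in> I"
    have "(g has_real_derivative g' t) (at t within I)"
      using g[of t] t I by (intro DERIV_subset[OF _ I]) auto
    thus "((\<lambda>t. g t - g' s * t) has_real_derivative g' t - g' s) (at t within I)"
      by (auto intro!: derivative_eq_intros)
    have "\<bar>g' t - g' s\<bar> \<le> B * \<bar>t - s\<bar>"
      by (rule derivative_bound_imp_lipschitz[of l u g' g'']) (use g' bound I t s in auto)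
    also have "\<dots> \<le> B * \<bar>h\<bar>"
    proof (rule mult_left_mono)
      show "\<bar>t - s\<bar> \<le> \<bar>h\<bar>" using t by (auto simp: I_def)
      show "0 \<le> B" using bound[OF s(1)] by linarith
    qed
    finally show "\<bar>g' t - g' s\<bar> \<le> B * \<bar>h\<bar>" .
  qed (use sI in auto)
  thus ?thesis by (simp add: algebra_simps power2_eq_square abs_mult)
qed

text \<open>The derivatives are one-sided at the ends of the interval, and f is prescribed on the
  ball alone; every use of f therefore has to show that its argument stays in the ball.\<close>

locale ridge_function =
  fixes d :: nat and a :: "nat \<Rightarrow> real" and g g' g'' :: "real \<Rightarrow> real" and f :: "(nat \<Rightarrow> real) \<Rightarrow> real"
    and epsbar C2 :: real
  assumes epsbar: "0 < epsbar" and a: "a \<in> vectors d" "L2_set a {..<d} = 1" and C2: "0 < C2"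
    and g: "\<And>t. t \<in> {- 1 - epsbar .. 1 + epsbar} \<Longrightarrow>
             (g has_real_derivative g' t) (at t within {- 1 - epsbar .. 1 + epsbar})"
    and g': "\<And>t. t \<in> {- 1 - epsbar .. 1 + epsbar} \<Longrightarrow>
             (g' has_real_derivative g'' t) (at t within {- 1 - epsbar .. 1 + epsbar})"
    and bound': "\<And>t. t \<in> {- 1 - epsbar .. 1 + epsbar} \<Longrightarrow> \<bar>g' t\<bar> \<le> C2"
    and bound'': "\<And>t. t \<in> {- 1 - epsbar .. 1 + epsbar} \<Longrightarrow> \<bar>g'' t\<bar> \<le> C2"
    and f: "\<And>x. x \<in> euclidean_ball d (1 + epsbar) \<Longrightarrow> f x = g (dot d a x)"
begin

lemma dot_in_interval:
  assumes "x \<in> euclidean_ball d (1 + epsbar)"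
  shows "dot d a x \<in> {- 1 - epsbar .. 1 + epsbar}"
proof -
  have "L2_set x {..<d} \<le> 1 + epsbar" using assms by (simp add: euclidean_ball_def lp_norm_2)
  hence "\<bar>dot d a x\<bar> \<le> 1 + epsbar" using abs_dot_le[of d a x] a(2) by simp
  thus ?thesis by auto
qed

text \<open>The estimate \<open>fhat\<close> evaluates f at the projection p of x onto the line of
  \<open>ahat\<close>, which stays in the ball. Now <a, x - p> is the product of x with the
  component of a orthogonal to \<open>ahat\<close>, and g is Lipschitz with constant
  \<open>C2\<close>.\<close>

lemma approximation_error:
  assumes ahat: "L2_set ahat {..<d} = 1" and e: "L2_set (\<lambda>i. a i - dot d a ahat * ahat i) {..<d} \<le> e"
    and x: "x \<in> euclidean_ball d (1 + epsbar)"
  shows "\<bar>f x - fhat d f ahat x\<bar> \<le> C2 * (e * (1 + epsbar))"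
proof -
  define p where "p = (\<lambda>i\<in>{..<d}. ahat i * dot d ahat x)"
  have Lx: "L2_set x {..<d} \<le> 1 + epsbar" using x by (simp add: euclidean_ball_def lp_norm_2)
  have "L2_set p {..<d} = L2_set (\<lambda>i. dot d ahat x * ahat i) {..<d}"
    by (rule L2_set_cong) (auto simp: p_def)
  also have "\<dots> = \<bar>dot d ahat x\<bar>" unfolding L2_set_scale by (simp add: ahat)
  also have "\<dots> \<le> 1 + epsbar" using abs_dot_le[of d ahat x] ahat Lx by simp
  finally have p: "p \<in> euclidean_ball d (1 + epsbar)"
    by (simp add: euclidean_ball_def lp_norm_2 p_def vectors_def)
  have fh: "fhat d f ahat x = g (dot d a p)"
    unfolding fhat_def ghat_def p_def[symmetric] by (rule f[OF p])
  have "dot d a p = dot d a (\<lambda>i. dot d ahat x * ahat i)"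
    by (rule dot_cong) (auto simp: p_def)
  also have "\<dots> = dot d ahat x * dot d a ahat" by (rule dot_scale_right)
  also have "\<dots> = dot d (\<lambda>i. dot d a ahat * ahat i) x"
    by (subst (2) dot_commute) (simp add: dot_scale_right dot_commute)
  finally have "dot d a x - dot d a p = dot d (\<lambda>i. a i - dot d a ahat * ahat i) x"
    by (simp add: dot_commute[of d _ x] dot_diff_right)
  hence "\<bar>dot d a x - dot d a p\<bar> \<le> L2_set (\<lambda>i. a i - dot d a ahat * ahat i) {..<d} * L2_set x {..<d}"
    using abs_dot_le by simp
  also have "\<dots> \<le> e * (1 + epsbar)"
    using e Lx order_trans[OF L2_set_nonneg e] by (intro mult_mono) auto
  finally have "\<bar>dot d a x - dot d a p\<bar> \<le> e * (1 + epsbar)" .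
  moreover have "\<bar>f x - fhat d f ahat x\<bar> \<le> C2 * \<bar>dot d a x - dot d a p\<bar>"
    unfolding fh f[OF x]
    by (rule derivative_bound_imp_lipschitz[OF g bound']) (use dot_in_interval x p in auto)
  ultimately show ?thesis using C2 by (meson mult_left_mono order_trans less_imp_le)
qed

lemma shifted_point_in_ball:
  assumes m: "1 \<le> m" and eps: "0 < \<epsilon>" "\<epsilon> * sqrt (real d / real m) \<le> epsbar"
    and \<Phi>: "\<Phi> \<in> sign_matrices m d" and x: "x \<in> unit_sphere d" and i: "i < m"
  shows "shifted_point d \<epsilon> \<Phi> x i \<in> euclidean_ball d (1 + epsbar)"
proof -
  have "L2_set (shifted_point d \<epsilon> \<Phi> x i) {..<d} = L2_set (\<lambda>k. x k + \<epsilon> * \<Phi> (i, k)) {..<d}"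
    by (rule L2_set_cong) (auto simp: shifted_point_def)
  also have "\<dots> \<le> L2_set x {..<d} + L2_set (\<lambda>k. \<epsilon> * \<Phi> (i, k)) {..<d}"
    by (rule L2_set_triangle_ineq)
  also have "L2_set x {..<d} = 1" using x by (simp add: unit_sphere_def lp_norm_2)
  also have "L2_set (\<lambda>k. \<epsilon> * \<Phi> (i, k)) {..<d} = \<epsilon> * L2_set (\<lambda>k. \<Phi> (i, k)) {..<d}"
    using eps by (simp add: L2_set_scale)
  also have "L2_set (\<lambda>k. \<Phi> (i, k)) {..<d} = sqrt (real d / real m)"
  proof -
    have "(\<Phi> (i, k))\<^sup>2 = 1 / real m" if "k \<in> {..<d}" for k
      using sign_matrices_entry[OF \<Phi> i, of k] that by (auto simp: power_divide)
    thus ?thesis by (simp add: L2_set_def)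
  qed
  finally have "L2_set (shifted_point d \<epsilon> \<Phi> x i) {..<d} \<le> 1 + epsbar" using eps by linarith
  moreover have "shifted_point d \<epsilon> \<Phi> x i \<in> vectors d" by (simp add: shifted_point_def vectors_def)
  ultimately show ?thesis by (simp add: euclidean_ball_def lp_norm_2)
qed

lemma sphere_in_ball: "x \<in> unit_sphere d \<Longrightarrow> x \<in> euclidean_ball d (1 + epsbar)"
  using epsbar by (simp add: unit_sphere_def euclidean_ball_def)

text \<open>The Taylor remainder is quadratic in b = <a, \<phi>_i>. Since a has bounded l1-norm and
  the entries of \<phi>_i have modulus 1/sqrt m, b^2 is of order 1/m, where the Euclidean norms
  alone would give d/m.\<close>

lemma difference_quotient_error:
  assumes m: "1 \<le> m" and eps: "0 < \<epsilon>" "\<epsilon> * sqrt (real d / real m) \<le> epsbar"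
    and \<Phi>: "\<Phi> \<in> sign_matrices m d" and x: "x \<in> unit_sphere d" and i: "i < m"
    and a1: "(\<Sum>k<d. \<bar>a k\<bar>) \<le> A"
  shows "\<bar>difference_quotient d \<epsilon> f \<Phi> x i - (\<Sum>k<d. \<Phi> (i, k) * (g' (dot d a x) * a k))\<bar> \<le> C2 * A\<^sup>2 * \<epsilon> / real m"
proof -
  let ?s = "dot d a x"
  define b where "b = dot d a (\<lambda>k. \<Phi> (i, k))"
  have "dot d a (shifted_point d \<epsilon> \<Phi> x i) = dot d a (\<lambda>k. x k + \<epsilon> * \<Phi> (i, k))"
    by (rule dot_cong) (auto simp: shifted_point_def)
  also have "\<dots> = ?s + \<epsilon> * b" by (simp add: dot_add_right dot_scale_right b_def)
  finally have sh: "dot d a (shifted_point d \<epsilon> \<Phi> x i) = ?s + \<epsilon> * b" .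
  note pb = shifted_point_in_ball[OF m eps \<Phi> x i] and xb = sphere_in_ball[OF x]
  have "\<bar>g (?s + \<epsilon> * b) - g ?s - g' ?s * (\<epsilon> * b)\<bar> \<le> C2 * (\<epsilon> * b)\<^sup>2"
    by (rule taylor_error[OF g g' bound'']) (use dot_in_interval[OF pb] dot_in_interval[OF xb] sh in auto)
  moreover have "difference_quotient d \<epsilon> f \<Phi> x i - g' ?s * b = (g (?s + \<epsilon> * b) - g ?s - g' ?s * (\<epsilon> * b)) / \<epsilon>"
    unfolding difference_quotient_def f[OF pb] f[OF xb] sh using eps by (simp add: field_simps)
  ultimately have "\<bar>difference_quotient d \<epsilon> f \<Phi> x i - g' ?s * b\<bar> \<le> C2 * (\<epsilon> * b)\<^sup>2 / \<epsilon>"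
    using eps by (simp add: abs_div divide_right_mono)
  also have "\<dots> = C2 * \<epsilon> * b\<^sup>2" using eps by (simp add: power2_eq_square)
  also have "\<dots> \<le> C2 * \<epsilon> * (A\<^sup>2 / real m)"
  proof (intro mult_left_mono)
    have "\<bar>b\<bar> \<le> (\<Sum>k<d. \<bar>a k * \<Phi> (i, k)\<bar>)" unfolding b_def dot_def by (rule sum_abs)
    also have "\<dots> = (\<Sum>k<d. \<bar>a k\<bar> * (1 / sqrt (real m)))"
    proof (intro sum.cong refl)
      fix k assume "k \<in> {..<d}"
      hence "\<bar>\<Phi> (i, k)\<bar> = 1 / sqrt (real m)" using sign_matrices_entry[OF \<Phi> i, of k] by auto
      thus "\<bar>a k * \<Phi> (i, k)\<bar> = \<bar>a k\<bar> * (1 / sqrt (real m))" by (simp add: abs_mult)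
    qed
    also have "\<dots> \<le> A * (1 / sqrt (real m))"
      unfolding sum_distrib_right[symmetric] using a1 by (intro mult_right_mono) auto
    finally have "\<bar>b\<bar>\<^sup>2 \<le> (A * (1 / sqrt (real m)))\<^sup>2" by (intro power_mono) auto
    thus "b\<^sup>2 \<le> A\<^sup>2 / real m" by (simp add: power_mult_distrib power_divide)
  qed (use C2 eps in auto)
  also have "C2 * \<epsilon> * (A\<^sup>2 / real m) = C2 * A\<^sup>2 * \<epsilon> / real m" by simp
  finally have "\<bar>difference_quotient d \<epsilon> f \<Phi> x i - g' ?s * b\<bar> \<le> C2 * A\<^sup>2 * \<epsilon> / real m" .
  moreover have "(\<Sum>k<d. \<Phi> (i, k) * (g' ?s * a k)) = g' ?s * b"
    unfolding b_def dot_def sum_distrib_left by (intro sum.cong) auto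
  ultimately show ?thesis by simp
qed

text \<open>The index j1 with a large gradient forces the selected minimizer to have norm at least r
  - \<nu>. Its own recovery error is at most \<nu> whatever its gradient, so the angle estimate
  applies to it, although it may belong to another index.\<close>

lemma directions_error:
  assumes \<nu>: "\<nu> < r" and mX: "1 \<le> mX"
    and rec: "\<And>j z. j < mX \<Longrightarrow> z \<in> l1_minimizers d m \<Phi> (difference_quotient d \<epsilon> f \<Phi> (\<xi> j)) \<Longrightarrow>
          L2_set (\<lambda>i. z i - g' (dot d a (\<xi> j)) * a i) {..<d} \<le> \<nu>"
    and ne: "\<And>j. j < mX \<Longrightarrow> l1_minimizers d m \<Phi> (difference_quotient d \<epsilon> f \<Phi> (\<xi> j)) \<noteq> {}"
    and big: "j1 < mX" "r \<le> \<bar>g' (dot d a (\<xi> j1))\<bar>"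
  shows "alg_directions d m mX \<epsilon> f \<Phi> \<xi> \<noteq> {}"
    "\<And>ahat. ahat \<in> alg_directions d m mX \<epsilon> f \<Phi> \<xi> \<Longrightarrow>
       sup_norm (euclidean_ball d (1 + epsbar)) (\<lambda>x. f x - fhat d f ahat x)
         \<le> ereal (2 * C2 * (1 + epsbar) * (\<nu> / (r - \<nu>)))"
proof -
  let ?min = "\<lambda>j. l1_minimizers d m \<Phi> (difference_quotient d \<epsilon> f \<Phi> (\<xi> j))"
  have low: "r - \<nu> \<le> L2_set z {..<d}" if "z \<in> ?min j1" for z
  proof -
    let ?t = "g' (dot d a (\<xi> j1))"
    have "r \<le> L2_set (\<lambda>i. ?t * a i) {..<d}" unfolding L2_set_scale using big(2) a(2) by simp
    also have "\<dots> \<le> L2_set z {..<d} + L2_set (\<lambda>i. - (z i - ?t * a i)) {..<d}"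
      by (rule order_trans[OF _ L2_set_triangle_ineq]) simp
    also have "L2_set (\<lambda>i. - (z i - ?t * a i)) {..<d} = L2_set (\<lambda>i. z i - ?t * a i) {..<d}"
      by (simp add: L2_set_def power2_commute)
    also have "\<dots> \<le> \<nu>" by (rule rec[OF big(1) that])
    finally show ?thesis by simp
  qed
  show "alg_directions d m mX \<epsilon> f \<Phi> \<xi> \<noteq> {}"
  proof -
    define xh where "xh = (\<lambda>j. SOME z. z \<in> ?min j)"
    have xh: "xh j \<in> ?min j" if "j < mX" for j
      unfolding xh_def using ne[OF that] by (simp add: some_in_eq)
    let ?V = "(\<lambda>j. lp_norm d 2 (xh j)) ` {..<mX}"
    have V: "finite ?V" "?V \<noteq> {}" using mX by (auto simp: lessThan_empty_iff)
    from Max_in[OF V] obtain j0 where j0: "j0 < mX" "Max ?V = lp_norm d 2 (xh j0)" by auto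
    have max: "lp_norm d 2 (xh j) \<le> lp_norm d 2 (xh j0)" if "j < mX" for j
      unfolding j0(2)[symmetric] using that V by (intro Max_ge) auto
    have "r - \<nu> \<le> lp_norm d 2 (xh j1)" using low[OF xh[OF big(1)]] by (simp add: lp_norm_2)
    also have "\<dots> \<le> lp_norm d 2 (xh j0)" by (rule max[OF big(1)])
    finally have "lp_norm d 2 (xh j0) \<noteq> 0" using \<nu> by simp
    hence "(\<lambda>i\<in>{..<d}. xh j0 i / lp_norm d 2 (xh j0)) \<in> alg_directions d m mX \<epsilon> f \<Phi> \<xi>"
      unfolding alg_directions_def using xh j0 max by blast
    thus ?thesis by blast
  qed
  fix ahat assume "ahat \<in> alg_directions d m mX \<epsilon> f \<Phi> \<xi>"
  then obtain xh j0 where xh: "\<And>j. j < mX \<Longrightarrow> xh j \<in> ?min j" and j0: "j0 < mX"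
    and max: "\<And>j. j < mX \<Longrightarrow> lp_norm d 2 (xh j) \<le> lp_norm d 2 (xh j0)" and nz: "lp_norm d 2 (xh j0) \<noteq> 0"
    and ahat: "ahat = (\<lambda>i\<in>{..<d}. xh j0 i / lp_norm d 2 (xh j0))"
    unfolding alg_directions_def by blast
  have "r - \<nu> \<le> lp_norm d 2 (xh j1)" using low[OF xh[OF big(1)]] by (simp add: lp_norm_2)
  also have "\<dots> \<le> lp_norm d 2 (xh j0)" by (rule max[OF big(1)])
  finally have l: "r - \<nu> \<le> L2_set (xh j0) {..<d}" by (simp add: lp_norm_2)
  have pos: "0 < r - \<nu>" using \<nu> by simp
  hence l0: "0 < L2_set (xh j0) {..<d}" using l by linarith
  note de = direction_error[OF a(2) l0 l pos rec[OF j0 xh[OF j0]] ahat[unfolded lp_norm_2]]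
  have \<nu>0: "0 \<le> \<nu>" using order_trans[OF L2_set_nonneg rec[OF j0 xh[OF j0]]] .
  show "sup_norm (euclidean_ball d (1 + epsbar)) (\<lambda>x. f x - fhat d f ahat x)
         \<le> ereal (2 * C2 * (1 + epsbar) * (\<nu> / (r - \<nu>)))"
    unfolding sup_norm_def
  proof (rule SUP_least)
    fix x assume x: "x \<in> euclidean_ball d (1 + epsbar)"
    have "\<bar>f x - fhat d f ahat x\<bar> \<le> C2 * (\<nu> / (r - \<nu>) * (1 + epsbar))"
      by (rule approximation_error[OF de x])
    also have "\<dots> \<le> 2 * C2 * (1 + epsbar) * (\<nu> / (r - \<nu>))"
    proof -
      have "0 \<le> C2 * (\<nu> / (r - \<nu>) * (1 + epsbar))" using C2 \<nu>0 pos epsbar by (intro mult_nonneg_nonneg divide_nonneg_nonneg) auto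
      moreover have "2 * C2 * (1 + epsbar) * (\<nu> / (r - \<nu>)) = 2 * (C2 * (\<nu> / (r - \<nu>) * (1 + epsbar)))"
        by (simp only: mult_ac)
      ultimately show ?thesis by linarith
    qed
    finally show "ereal \<bar>f x - fhat d f ahat x\<bar> \<le> ereal (2 * C2 * (1 + epsbar) * (\<nu> / (r - \<nu>)))" by simp
  qed
qed

end

text \<open>With k of order \<kappa>, the tail of a is of order \<kappa>^(1 - 1/q) and the noise
  representation of order \<epsilon> sqrt(\<kappa>/m). Division by sqrt k gives the two terms of
  \<open>nu1\<close>. Here 644 = 4 * 161, 322 = 2 * 161, and 32 = 2 * 16 because k is at least half
  of c \<kappa>.\<close>

lemma (in ridge_function) recovery_rate:
  assumes q: "0 < q" "q \<le> 1" and C1: "0 < C1" "lp_norm d q a \<le> C1"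
    and m: "1 \<le> m" and eps: "0 < \<epsilon>" "\<epsilon> * sqrt (real d / real m) \<le> epsbar"
    and \<Phi>: "\<Phi> \<in> sign_matrices m d" and good: "good_matrix d m k C \<Phi>" and C: "0 < C"
    and x: "x \<in> unit_sphere d" and c: "0 < c"
    and \<kappa>: "\<kappa> = real m / ln (real d / real m)" "0 < \<kappa>" and k: "1 \<le> k" "c * \<kappa> / 2 \<le> real k"
  defines "A \<equiv> C1 * (1 / 2) powr (1 - 1 / q)"
  shows "l1_minimizers d m \<Phi> (difference_quotient d \<epsilon> f \<Phi> x) \<noteq> {}"
    "\<And>z. z \<in> l1_minimizers d m \<Phi> (difference_quotient d \<epsilon> f \<Phi> x) \<Longrightarrow>
       L2_set (\<lambda>i. z i - g' (dot d a x) * a i) {..<d} \<le>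
         (644 * C2 * C1 * (c / (32 * 161\<^sup>2)) powr (1 - 1 / q) * sqrt (2 / c)) * \<kappa> powr (1 / 2 - 1 / q) +
         (C2 * A\<^sup>2 * (40 + 322 * C * sqrt (2 / c))) * (\<epsilon> / sqrt (real m))"
proof -
  let ?y = "difference_quotient d \<epsilon> f \<Phi> x"
  define t where "t = g' (dot d a x)"
  define \<beta> where "\<beta> = C2 * A\<^sup>2 * \<epsilon>"
  have \<beta>: "0 \<le> \<beta>" using C2 eps by (simp add: \<beta>_def)
  have tC: "\<bar>t\<bar> \<le> C2"
    unfolding t_def by (rule bound') (rule dot_in_interval[OF sphere_in_ball[OF x]])
  have a1: "(\<Sum>i<d. \<bar>a i\<bar>) \<le> A"
  proof -
    \<comment> \<open>At K = 1/2 the exceptional set has fewer than one element, so the tail is the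
      whole l1-norm.\<close>
    obtain S where S: "S \<subseteq> {..<d}" "real (card S) \<le> 1 / 2" "(\<Sum>i\<in>{..<d} - S. \<bar>a i\<bar>) \<le> C1 * (1 / 2) powr (1 - 1 / q)"
      by (rule tail_of_lq_bounded[OF q C1(1) _ C1(2), of "1 / 2"]) auto
    have "card S = 0" using S(2) by linarith
    hence "S = {}" using S(1) finite_subset[OF S(1)] by simp
    thus ?thesis using S(3) by (simp add: A_def)
  qed
  have noise: "\<bar>?y i - (\<Sum>l<d. \<Phi> (i, l) * (t * a l))\<bar> \<le> \<beta> / real m" if "i < m" for i
    using difference_quotient_error[OF m eps \<Phi> x that a1] by (simp add: \<beta>_def t_def)
  show "l1_minimizers d m \<Phi> ?y \<noteq> {}"
  proof -
    obtain u where u: "\<And>i. i < m \<Longrightarrow> (\<Sum>l<d. \<Phi> (i, l) * u l) = ?y i - (\<Sum>l<d. \<Phi> (i, l) * (t * a l))"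
      by (rule good_matrix_absorbs_noise[OF m good \<beta>, of "\<lambda>i. ?y i - (\<Sum>l<d. \<Phi> (i, l) * (t * a l))"]) (use noise in auto)
    show ?thesis
    proof (rule l1_minimizers_nonempty)
      fix i assume "i < m"
      thus "(\<Sum>l<d. \<Phi> (i, l) * (t * a l + u l)) = ?y i"
        using u[of i] by (simp add: distrib_left sum.distrib)
    qed
  qed
  fix z assume z: "z \<in> l1_minimizers d m \<Phi> ?y"
  define K where "K = real k / (16 * 161\<^sup>2)"
  have K: "K > 0" using k by (simp add: K_def)
  obtain S where S: "S \<subseteq> {..<d}" "real (card S) \<le> K" "(\<Sum>i\<in>{..<d} - S. \<bar>a i\<bar>) \<le> C1 * K powr (1 - 1 / q)"
    by (rule tail_of_lq_bounded[OF q C1(1) K C1(2)])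
  let ?\<sigma> = "\<Sum>i\<in>{..<d} - S. \<bar>t * a i\<bar>"
  let ?b = "\<beta> / sqrt (real m)"
  have "L2_set (\<lambda>i. z i - t * a i) {..<d} \<le> 40 * ?b + 161 * ((4 * ?\<sigma> + 2 * (?b * (C * sqrt \<kappa>))) / sqrt (real k))"
    using l1_recovery[OF m k(1) good \<beta> noise z S(1) S(2)[unfolded K_def]] unfolding \<kappa>(1) .
  also have "\<dots> = 40 * ?b + (644 * ?\<sigma> + 322 * (?b * (C * sqrt \<kappa>))) * (1 / sqrt (real k))"
    by (simp add: field_simps)
  also have "\<dots> \<le> 40 * ?b + (644 * (C2 * (C1 * ((c / (32 * 161\<^sup>2)) powr (1 - 1 / q) * \<kappa> powr (1 - 1 / q)))) + 322 * (?b * (C * sqrt \<kappa>))) * (sqrt (2 / c) * (1 / sqrt \<kappa>))"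
  proof (intro add_left_mono mult_mono add_right_mono mult_left_mono)
    have "?\<sigma> = \<bar>t\<bar> * (\<Sum>i\<in>{..<d} - S. \<bar>a i\<bar>)" by (simp add: abs_mult sum_distrib_left)
    also have "\<dots> \<le> C2 * (C1 * K powr (1 - 1 / q))"
      using tC S(3) C2 by (intro mult_mono) (auto intro!: sum_nonneg)
    also have "K powr (1 - 1 / q) \<le> (c / (32 * 161\<^sup>2) * \<kappa>) powr (1 - 1 / q)"
      using k(2) c \<kappa>(2) q by (intro powr_mono2') (auto simp: K_def field_simps)
    also have "\<dots> = (c / (32 * 161\<^sup>2)) powr (1 - 1 / q) * \<kappa> powr (1 - 1 / q)"
      by (rule powr_mult)
    finally show "?\<sigma> \<le> C2 * (C1 * ((c / (32 * 161\<^sup>2)) powr (1 - 1 / q) * \<kappa> powr (1 - 1 / q)))"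
      using C2 C1 by (simp add: mult_left_mono)
    have "sqrt (c * \<kappa> / 2) \<le> sqrt (real k)" using k by simp
    hence "1 / sqrt (real k) \<le> 1 / sqrt (c * \<kappa> / 2)"
      using c \<kappa>(2) k(1) by (intro divide_left_mono mult_pos_pos) auto
    also have "\<dots> = sqrt (2 / c) * (1 / sqrt \<kappa>)"
      by (simp add: real_sqrt_divide real_sqrt_mult)
    finally show "1 / sqrt (real k) \<le> sqrt (2 / c) * (1 / sqrt \<kappa>)" .
  qed (use C1 C2 C \<beta> \<kappa>(2) in \<open>auto intro!: add_nonneg_nonneg mult_nonneg_nonneg\<close>)
  also have "\<dots> = (644 * C2 * C1 * (c / (32 * 161\<^sup>2)) powr (1 - 1 / q) * sqrt (2 / c)) * (\<kappa> powr (1 - 1 / q) * (1 / sqrt \<kappa>))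
      + ?b * (40 + 322 * C * sqrt (2 / c) * (sqrt \<kappa> * (1 / sqrt \<kappa>)))"
    by (simp only: distrib_left distrib_right mult_ac)
  also have "\<kappa> powr (1 - 1 / q) * (1 / sqrt \<kappa>) = \<kappa> powr (1 / 2 - 1 / q)"
  proof -
    have "1 / sqrt \<kappa> = \<kappa> powr (- (1 / 2))" using \<kappa>(2) by (simp add: powr_minus_divide powr_half_sqrt)
    hence "\<kappa> powr (1 - 1 / q) * (1 / sqrt \<kappa>) = \<kappa> powr ((1 - 1 / q) + - (1 / 2))"
      by (simp only: powr_add)
    thus ?thesis by (simp add: algebra_simps)
  qed
  also have "sqrt \<kappa> * (1 / sqrt \<kappa>) = 1" using \<kappa>(2) by simp
  also have "?b * (40 + 322 * C * sqrt (2 / c) * 1) = (C2 * A\<^sup>2 * (40 + 322 * C * sqrt (2 / c))) * (\<epsilon> / sqrt (real m))"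
    by (simp add: \<beta>_def)
  finally show "L2_set (\<lambda>i. z i - g' (dot d a x) * a i) {..<d} \<le>
         (644 * C2 * C1 * (c / (32 * 161\<^sup>2)) powr (1 - 1 / q) * sqrt (2 / c)) * \<kappa> powr (1 / 2 - 1 / q) +
         (C2 * A\<^sup>2 * (40 + 322 * C * sqrt (2 / c))) * (\<epsilon> / sqrt (real m))"
    by (simp add: t_def)
qed

lemma (in ridge_function) gradient_measurable:
  assumes "uniform_sphere_measure d \<mu>"
  shows "space \<mu> = unit_sphere d" "(\<lambda>x. \<bar>g' (dot d a x)\<bar>\<^sup>2) \<in> borel_measurable \<mu>"
proof -
  have sets: "sets \<mu> = sets (restrict_space (Pi\<^sub>M {..<d} (\<lambda>_. borel)) (unit_sphere d))"
    using assms by (simp add: uniform_sphere_measure_def)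
  have sub: "unit_sphere d \<subseteq> space (Pi\<^sub>M {..<d} (\<lambda>_. borel))"
    by (auto simp: unit_sphere_def vectors_def space_PiM)
  show sp: "space \<mu> = unit_sphere d"
    using sets_eq_imp_space_eq[OF sets] sub by (auto simp: space_restrict_space)
  \<comment> \<open>Outside the interval g' is arbitrary, hence possibly not measurable. Clipping
    the argument gives a continuous function that agrees with g' at the products with points of the
    sphere.\<close>
  define cl where "cl = (\<lambda>t. max (- 1 - epsbar) (min (1 + epsbar) t))"
  have "continuous_on {- 1 - epsbar .. 1 + epsbar} g'"
    using g' by (rule DERIV_continuous_on)
  hence "continuous_on UNIV (\<lambda>t. g' (cl t))"
    by (rule continuous_on_compose2) (use epsbar in \<open>auto simp: cl_def intro!: continuous_intros\<close>)
  hence gm: "(\<lambda>t. g' (cl t)) \<in> borel_measurable borel" by (rule borel_measurable_continuous_onI)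
  have "dot d a \<in> borel_measurable (Pi\<^sub>M {..<d} (\<lambda>_. borel))"
    unfolding dot_def[abs_def]
    by (intro borel_measurable_sum borel_measurable_times borel_measurable_const measurable_component_singleton)
  hence "dot d a \<in> borel_measurable (restrict_space (Pi\<^sub>M {..<d} (\<lambda>_. borel)) (unit_sphere d))"
    by (rule measurable_restrict_space1)
  hence dm: "dot d a \<in> borel_measurable \<mu>"
    using measurable_cong_sets[OF sets refl] by blast
  have "(\<lambda>x. \<bar>g' (cl (dot d a x))\<bar>\<^sup>2) \<in> borel_measurable \<mu>"
    using measurable_compose[OF dm gm] by measurable
  moreover have "\<bar>g' (cl (dot d a x))\<bar>\<^sup>2 = \<bar>g' (dot d a x)\<bar>\<^sup>2" if "x \<in> space \<mu>" for x
    using dot_in_interval[OF sphere_in_ball[of x]] that by (simp add: sp cl_def)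
  ultimately show "(\<lambda>x. \<bar>g' (dot d a x)\<bar>\<^sup>2) \<in> borel_measurable \<mu>"
    using measurable_cong[of \<mu> "\<lambda>x. \<bar>g' (cl (dot d a x))\<bar>\<^sup>2" "\<lambda>x. \<bar>g' (dot d a x)\<bar>\<^sup>2" borel] by simp
qed

text \<open>Gives the count of function evaluations its meaning: the values at the listed points
  determine the output of the algorithm, and all of these points lie in the domain of f.\<close>

lemma (in ridge_function) evaluation_points:
  assumes m: "1 \<le> m" and eps: "0 < \<epsilon>" "\<epsilon> * sqrt (real d / real m) \<le> epsbar"
    and \<Phi>: "\<Phi> \<in> sign_matrices m d" and \<xi>: "\<xi> \<in> {..<mX} \<rightarrow>\<^sub>E unit_sphere d"
  shows "length (eval_points d m mX \<epsilon> \<Phi> \<xi>) = mX * (m + 1)"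
    "set (eval_points d m mX \<epsilon> \<Phi> \<xi>) \<subseteq> euclidean_ball d (1 + epsbar)"
    "(\<And>x. x \<in> set (eval_points d m mX \<epsilon> \<Phi> \<xi>) \<Longrightarrow> F x = f x) \<Longrightarrow>
       alg_directions d m mX \<epsilon> F \<Phi> \<xi> = alg_directions d m mX \<epsilon> f \<Phi> \<xi>"
proof -
  have \<xi>j: "\<xi> j \<in> unit_sphere d" if "j < mX" for j using PiE_mem[OF \<xi>] that by simp
  show "length (eval_points d m mX \<epsilon> \<Phi> \<xi>) = mX * (m + 1)"
    unfolding eval_points_def length_concat map_map o_def
    by (simp add: sum_list_triv)
  have set: "set (eval_points d m mX \<epsilon> \<Phi> \<xi>) = (\<Union>j<mX. insert (\<xi> j) (shifted_point d \<epsilon> \<Phi> (\<xi> j) ` {..<m}))"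
    by (simp add: eval_points_def atLeast0LessThan)
  show "set (eval_points d m mX \<epsilon> \<Phi> \<xi>) \<subseteq> euclidean_ball d (1 + epsbar)"
  proof
    fix p assume "p \<in> set (eval_points d m mX \<epsilon> \<Phi> \<xi>)"
    then obtain j where j: "j < mX" "p = \<xi> j \<or> (\<exists>i<m. p = shifted_point d \<epsilon> \<Phi> (\<xi> j) i)"
      unfolding set by blast
    thus "p \<in> euclidean_ball d (1 + epsbar)"
      using sphere_in_ball[OF \<xi>j[OF j(1)]] shifted_point_in_ball[OF m eps \<Phi> \<xi>j[OF j(1)]] by blast
  qed
  assume F: "\<And>x. x \<in> set (eval_points d m mX \<epsilon> \<Phi> \<xi>) \<Longrightarrow> F x = f x"
  have "l1_minimizers d m \<Phi> (difference_quotient d \<epsilon> F \<Phi> (\<xi> j)) = l1_minimizers d m \<Phi> (difference_quotient d \<epsilon> f \<Phi> (\<xi> j))"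
    if j: "j < mX" for j
  proof -
    have "difference_quotient d \<epsilon> F \<Phi> (\<xi> j) i = difference_quotient d \<epsilon> f \<Phi> (\<xi> j) i" if "i < m" for i
    proof -
      have "F (\<xi> j) = f (\<xi> j)" using j by (intro F) (auto simp: set)
      moreover have "F (shifted_point d \<epsilon> \<Phi> (\<xi> j) i) = f (shifted_point d \<epsilon> \<Phi> (\<xi> j) i)"
        using j that by (intro F) (auto simp: set)
      ultimately show ?thesis by (simp add: difference_quotient_def)
    qed
    hence "{z \<in> vectors d. \<forall>i<m. (\<Sum>k<d. \<Phi> (i, k) * z k) = difference_quotient d \<epsilon> F \<Phi> (\<xi> j) i} =
        {z \<in> vectors d. \<forall>i<m. (\<Sum>k<d. \<Phi> (i, k) * z k) = difference_quotient d \<epsilon> f \<Phi> (\<xi> j) i}"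
      by simp
    thus ?thesis unfolding l1_minimizers_def by (simp only:)
  qed
  hence "(\<forall>j<mX. xhat j \<in> l1_minimizers d m \<Phi> (difference_quotient d \<epsilon> F \<Phi> (\<xi> j))) \<longleftrightarrow>
      (\<forall>j<mX. xhat j \<in> l1_minimizers d m \<Phi> (difference_quotient d \<epsilon> f \<Phi> (\<xi> j)))" for xhat
    by blast
  thus "alg_directions d m mX \<epsilon> F \<Phi> \<xi> = alg_directions d m mX \<epsilon> f \<Phi> \<xi>"
    unfolding alg_directions_def by (simp only:)
qed

theorem theorem3p1:
  "\<exists>c\<^sub>1' > (0 :: real). \<forall>q :: real. 0 < q \<longrightarrow> q \<le> 1 \<longrightarrow>
    (\<forall>(C\<^sub>1 :: real) (C\<^sub>2 :: real). 0 < C\<^sub>1 \<longrightarrow> 0 < C\<^sub>2 \<longrightarrow>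
      (\<exists>C' > (0 :: real).
        \<forall>(d :: nat) (m\<^sub>X :: nat) (m\<^sub>\<Phi> :: nat) (\<mu> :: (nat \<Rightarrow> real) measure)
          (epsbar :: real) (\<epsilon> :: real) (\<alpha> :: real) (s :: real) (a :: nat \<Rightarrow> real)
          (g :: real \<Rightarrow> real) (g' :: real \<Rightarrow> real) (g'' :: real \<Rightarrow> real)
          (f :: (nat \<Rightarrow> real) \<Rightarrow> real).
          uniform_sphere_measure d \<mu> \<longrightarrow>
          0 < epsbar \<longrightarrow>
          a \<in> vectors d \<longrightarrow> lp_norm d 2 a = 1 \<longrightarrow> lp_norm d q a \<le> C\<^sub>1 \<longrightarrow>
          (\<forall>t \<in> {- 1 - epsbar .. 1 + epsbar}.
             (g has_real_derivative g' t) (at t within {- 1 - epsbar .. 1 + epsbar})) \<longrightarrow>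
          (\<forall>t \<in> {- 1 - epsbar .. 1 + epsbar}.
             (g' has_real_derivative g'' t) (at t within {- 1 - epsbar .. 1 + epsbar})) \<longrightarrow>
          continuous_on {- 1 - epsbar .. 1 + epsbar} g'' \<longrightarrow>
          (\<forall>h \<in> {g, g', g''}. sup_norm {- 1 - epsbar .. 1 + epsbar} h \<le> ereal C\<^sub>2) \<longrightarrow>
          (\<forall>x \<in> euclidean_ball d (1 + epsbar). f x = g (dot d a x)) \<longrightarrow>
          0 < \<alpha> \<longrightarrow>
          \<alpha> \<le> (\<integral>x. \<bar>g' (dot d a x)\<bar>\<^sup>2 \<partial>\<mu>) \<longrightarrow>
          0 < s \<longrightarrow> s < 1 \<longrightarrow>
          1 \<le> m\<^sub>X \<longrightarrow> 1 \<le> m\<^sub>\<Phi> \<longrightarrow>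
          ln (real d) \<le> real m\<^sub>\<Phi> \<longrightarrow> real m\<^sub>\<Phi> \<le> real d / (ln 6)\<^sup>2 \<longrightarrow>
          0 < \<epsilon> \<longrightarrow> \<epsilon> * sqrt (real d / real m\<^sub>\<Phi>) \<le> epsbar \<longrightarrow>
          nu1 C' q d m\<^sub>\<Phi> \<epsilon> < sqrt (\<alpha> * (1 - s)) \<longrightarrow>
          (\<forall>\<Phi> \<in> set_pmf (sign_matrix_pmf m\<^sub>\<Phi> d). \<forall>\<xi> \<in> {..<m\<^sub>X} \<rightarrow>\<^sub>E unit_sphere d.
             length (eval_points d m\<^sub>\<Phi> m\<^sub>X \<epsilon> \<Phi> \<xi>) = m\<^sub>X * (m\<^sub>\<Phi> + 1) \<and>
             set (eval_points d m\<^sub>\<Phi> m\<^sub>X \<epsilon> \<Phi> \<xi>) \<subseteq> euclidean_ball d (1 + epsbar) \<and>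
             (\<forall>f'. (\<forall>x \<in> set (eval_points d m\<^sub>\<Phi> m\<^sub>X \<epsilon> \<Phi> \<xi>). f' x = f x) \<longrightarrow>
                alg_directions d m\<^sub>\<Phi> m\<^sub>X \<epsilon> f' \<Phi> \<xi> = alg_directions d m\<^sub>\<Phi> m\<^sub>X \<epsilon> f \<Phi> \<xi>)) \<and>
          (\<exists>E \<in> sets (draw_measure d m\<^sub>\<Phi> m\<^sub>X \<mu>).
             measure (draw_measure d m\<^sub>\<Phi> m\<^sub>X \<mu>) E
               \<ge> 1 - (exp (- c\<^sub>1' * real m\<^sub>\<Phi>) + exp (- sqrt (real m\<^sub>\<Phi> * real d))
                      + 2 * exp (- (2 * real m\<^sub>X * s\<^sup>2 * \<alpha>\<^sup>2 / C\<^sub>2 ^ 4))) \<and>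
             (\<forall>(\<Phi>, \<xi>) \<in> E.
                alg_directions d m\<^sub>\<Phi> m\<^sub>X \<epsilon> f \<Phi> \<xi> \<noteq> {} \<and>
                (\<forall>ahat \<in> alg_directions d m\<^sub>\<Phi> m\<^sub>X \<epsilon> f \<Phi> \<xi>.
                   sup_norm (euclidean_ball d (1 + epsbar)) (\<lambda>x. f x - fhat d f ahat x)
                     \<le> ereal (2 * C\<^sub>2 * (1 + epsbar) * (nu1 C' q d m\<^sub>\<Phi> \<epsilon>
                               / (sqrt (\<alpha> * (1 - s)) - nu1 C' q d m\<^sub>\<Phi> \<epsilon>)))))))) "
proof -
  obtain C c h M where C: "C > 0" and c: "c > 0" and h: "h > 0" and likely: "\<And>m d k. m \<ge> M \<Longrightarrow> d \<ge> 2 * m \<Longrightarrow>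
     ln (real d) \<le> real m \<Longrightarrow> 1 \<le> k \<Longrightarrow> real k \<le> c * (real m / ln (real d / real m)) \<Longrightarrow>
     measure (measure_pmf (sign_matrix_pmf m d)) {\<Phi> \<in> sign_matrices m d. good_matrix d m k C \<Phi>} \<ge> 1 - exp (- h * real m)"
    using good_matrix_likely by blast
  \<comment> \<open>The rate h depends on the random matrices alone and is fixed before q and the
    bounds, so it is absolute.\<close>
  show ?thesis
  proof (rule exI[of _ h], intro conjI h allI impI)
    fix q C1 C2 :: real
    assume q: "0 < q" "q \<le> 1" and C1: "0 < C1" and C2: "0 < C2"
    define A where "A = C1 * (1 / 2) powr (1 - 1 / q)"
    define S0 where "S0 = 644 * C2 * C1 * (c / (32 * 161\<^sup>2)) powr (1 - 1 / q) * sqrt (2 / c)"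
    define T0 where "T0 = C2 * A\<^sup>2 * (40 + 322 * C * sqrt (2 / c))"
    define e where "e = 1 / 2 - 1 / q"
    have e: "e < 0" using q by (simp add: e_def field_simps)
    \<comment> \<open>A threshold for \<kappa> = m / ln(d/m): at 2/c the sparsity level c \<kappa>
      reaches 2, and at M / ln 2 the number m is at least M because ln(d/m) \<ge> ln 2.\<close>
    define K0 where "K0 = max (2 / c) (real M / ln 2)"
    have K0: "K0 > 0" "2 / c \<le> K0" "real M / ln 2 \<le> K0" using c by (auto simp: K0_def less_max_iff_disj)
    \<comment> \<open>S0 and T0 are the coefficients of the recovery error. The last entry makes
      \<nu> at least C2 whenever \<kappa> < K0, which contradicts \<nu> < sqrt(\<alpha> (1 - s))
      \<le> C2.\<close>
    define C' where "C' = max (max S0 T0) (C2 * K0 powr (- e))"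
    have C': "C' > 0" "S0 \<le> C'" "T0 \<le> C'" "C2 * K0 powr (- e) \<le> C'"
      using C2 K0 by (auto simp: C'_def less_max_iff_disj)
    show "\<exists>C' > (0 :: real).
        \<forall>(d :: nat) (m\<^sub>X :: nat) (m\<^sub>\<Phi> :: nat) (\<mu> :: (nat \<Rightarrow> real) measure)
          (epsbar :: real) (\<epsilon> :: real) (\<alpha> :: real) (s :: real) (a :: nat \<Rightarrow> real)
          (g :: real \<Rightarrow> real) (g' :: real \<Rightarrow> real) (g'' :: real \<Rightarrow> real)
          (f :: (nat \<Rightarrow> real) \<Rightarrow> real).
          uniform_sphere_measure d \<mu> \<longrightarrow>
          0 < epsbar \<longrightarrow>
          a \<in> vectors d \<longrightarrow> lp_norm d 2 a = 1 \<longrightarrow> lp_norm d q a \<le> C1 \<longrightarrow>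
          (\<forall>t \<in> {- 1 - epsbar .. 1 + epsbar}.
             (g has_real_derivative g' t) (at t within {- 1 - epsbar .. 1 + epsbar})) \<longrightarrow>
          (\<forall>t \<in> {- 1 - epsbar .. 1 + epsbar}.
             (g' has_real_derivative g'' t) (at t within {- 1 - epsbar .. 1 + epsbar})) \<longrightarrow>
          continuous_on {- 1 - epsbar .. 1 + epsbar} g'' \<longrightarrow>
          (\<forall>h \<in> {g, g', g''}. sup_norm {- 1 - epsbar .. 1 + epsbar} h \<le> ereal C2) \<longrightarrow>
          (\<forall>x \<in> euclidean_ball d (1 + epsbar). f x = g (dot d a x)) \<longrightarrow>
          0 < \<alpha> \<longrightarrow>
          \<alpha> \<le> (\<integral>x. \<bar>g' (dot d a x)\<bar>\<^sup>2 \<partial>\<mu>) \<longrightarrow>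
          0 < s \<longrightarrow> s < 1 \<longrightarrow>
          1 \<le> m\<^sub>X \<longrightarrow> 1 \<le> m\<^sub>\<Phi> \<longrightarrow>
          ln (real d) \<le> real m\<^sub>\<Phi> \<longrightarrow> real m\<^sub>\<Phi> \<le> real d / (ln 6)\<^sup>2 \<longrightarrow>
          0 < \<epsilon> \<longrightarrow> \<epsilon> * sqrt (real d / real m\<^sub>\<Phi>) \<le> epsbar \<longrightarrow>
          nu1 C' q d m\<^sub>\<Phi> \<epsilon> < sqrt (\<alpha> * (1 - s)) \<longrightarrow>
          (\<forall>\<Phi> \<in> set_pmf (sign_matrix_pmf m\<^sub>\<Phi> d). \<forall>\<xi> \<in> {..<m\<^sub>X} \<rightarrow>\<^sub>E unit_sphere d.
             length (eval_points d m\<^sub>\<Phi> m\<^sub>X \<epsilon> \<Phi> \<xi>) = m\<^sub>X * (m\<^sub>\<Phi> + 1) \<and>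
             set (eval_points d m\<^sub>\<Phi> m\<^sub>X \<epsilon> \<Phi> \<xi>) \<subseteq> euclidean_ball d (1 + epsbar) \<and>
             (\<forall>f'. (\<forall>x \<in> set (eval_points d m\<^sub>\<Phi> m\<^sub>X \<epsilon> \<Phi> \<xi>). f' x = f x) \<longrightarrow>
                alg_directions d m\<^sub>\<Phi> m\<^sub>X \<epsilon> f' \<Phi> \<xi> = alg_directions d m\<^sub>\<Phi> m\<^sub>X \<epsilon> f \<Phi> \<xi>)) \<and>
          (\<exists>E \<in> sets (draw_measure d m\<^sub>\<Phi> m\<^sub>X \<mu>).
             measure (draw_measure d m\<^sub>\<Phi> m\<^sub>X \<mu>) E
               \<ge> 1 - (exp (- h * real m\<^sub>\<Phi>) + exp (- sqrt (real m\<^sub>\<Phi> * real d))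
                      + 2 * exp (- (2 * real m\<^sub>X * s\<^sup>2 * \<alpha>\<^sup>2 / C2 ^ 4))) \<and>
             (\<forall>(\<Phi>, \<xi>) \<in> E.
                alg_directions d m\<^sub>\<Phi> m\<^sub>X \<epsilon> f \<Phi> \<xi> \<noteq> {} \<and>
                (\<forall>ahat \<in> alg_directions d m\<^sub>\<Phi> m\<^sub>X \<epsilon> f \<Phi> \<xi>.
                   sup_norm (euclidean_ball d (1 + epsbar)) (\<lambda>x. f x - fhat d f ahat x)
                     \<le> ereal (2 * C2 * (1 + epsbar) * (nu1 C' q d m\<^sub>\<Phi> \<epsilon>
                               / (sqrt (\<alpha> * (1 - s)) - nu1 C' q d m\<^sub>\<Phi> \<epsilon>))))))"
    proof (rule exI[of _ C'], intro conjI C'(1) allI impI)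
      fix d mX m :: nat and \<mu> :: "(nat \<Rightarrow> real) measure" and epsbar \<epsilon> \<alpha> s :: real
        and a :: "nat \<Rightarrow> real" and g g' g'' :: "real \<Rightarrow> real" and f :: "(nat \<Rightarrow> real) \<Rightarrow> real"
      assume \<mu>: "uniform_sphere_measure d \<mu>" and epsbar: "0 < epsbar"
        and norms: "a \<in> vectors d" "lp_norm d 2 a = 1" "lp_norm d q a \<le> C1"
        and g: "\<forall>t \<in> {- 1 - epsbar .. 1 + epsbar}.
             (g has_real_derivative g' t) (at t within {- 1 - epsbar .. 1 + epsbar})"
        and g': "\<forall>t \<in> {- 1 - epsbar .. 1 + epsbar}.
             (g' has_real_derivative g'' t) (at t within {- 1 - epsbar .. 1 + epsbar})"
        and "continuous_on {- 1 - epsbar .. 1 + epsbar} g''"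
        and sup: "\<forall>h \<in> {g, g', g''}. sup_norm {- 1 - epsbar .. 1 + epsbar} h \<le> ereal C2"
        and f: "\<forall>x \<in> euclidean_ball d (1 + epsbar). f x = g (dot d a x)"
        and \<alpha>: "0 < \<alpha>" "\<alpha> \<le> (\<integral>x. \<bar>g' (dot d a x)\<bar>\<^sup>2 \<partial>\<mu>)" and s: "0 < s" "s < 1"
        and mX: "1 \<le> mX" and m: "1 \<le> m" "ln (real d) \<le> real m" "real m \<le> real d / (ln 6)\<^sup>2"
        and eps: "0 < \<epsilon>" "\<epsilon> * sqrt (real d / real m) \<le> epsbar"
        and nu: "nu1 C' q d m \<epsilon> < sqrt (\<alpha> * (1 - s))"
      have sup_le: "\<bar>H t\<bar> \<le> C2" if "sup_norm {- 1 - epsbar .. 1 + epsbar} H \<le> ereal C2" "t \<in> {- 1 - epsbar .. 1 + epsbar}" for H t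
        using that unfolding sup_norm_def by (simp add: SUP_le_iff)
      interpret ridge_function d a g g' g'' f epsbar C2
      proof
        show "\<bar>g' t\<bar> \<le> C2" if "t \<in> {- 1 - epsbar .. 1 + epsbar}" for t
          using sup_le[of g' t] sup that by simp
        show "\<bar>g'' t\<bar> \<le> C2" if "t \<in> {- 1 - epsbar .. 1 + epsbar}" for t
          using sup_le[of g'' t] sup that by simp
      qed (use epsbar norms C2 g g' f in \<open>auto simp: lp_norm_2\<close>)
      interpret prob_space \<mu> using \<mu> by (simp add: uniform_sphere_measure_def)
      note space_\<mu> = gradient_measurable(1)[OF \<mu>] and meas = gradient_measurable(2)[OF \<mu>]
      define H where "H = (\<lambda>x. \<bar>g' (dot d a x)\<bar>\<^sup>2)"
      have H: "0 \<le> H x \<and> H x \<le> C2\<^sup>2" if "x \<in> space \<mu>" for x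
      proof -
        have "x \<in> unit_sphere d" using that space_\<mu> by simp
        hence "\<bar>g' (dot d a x)\<bar> \<le> C2" by (intro bound' dot_in_interval sphere_in_ball)
        from power_mono[OF this abs_ge_zero, of 2] show ?thesis by (simp add: H_def)
      qed
      have "(\<integral>x. H x \<partial>\<mu>) \<le> (\<integral>x. C2\<^sup>2 \<partial>\<mu>)"
      proof (rule integral_mono)
        show "integrable \<mu> H"
          by (rule integrable_const_bound[of _ "C2\<^sup>2"]) (use H meas in \<open>auto simp: H_def\<close>)
      qed (use H in auto)
      hence "\<alpha> \<le> C2\<^sup>2" using \<alpha> by (simp add: H_def prob_space)
      hence r: "sqrt (\<alpha> * (1 - s)) \<le> C2"
        using \<alpha> s C2 mult_mono[of \<alpha> "C2\<^sup>2" "1 - s" 1] by (intro real_le_lsqrt) auto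
      \<comment> \<open>From e^3 \<le> 27 \<le> 36 one gets ln 6 \<ge> 3/2, and (3/2)^2 exceeds the
        aspect ratio 2 required of the matrix.\<close>
      have ln6: "(ln 6)\<^sup>2 \<ge> (2 :: real)"
      proof -
        have "exp (3 / 2) \<le> (6 :: real)"
        proof (rule power2_le_imp_le)
          have "(exp (3 / 2))\<^sup>2 = exp (1 :: real) ^ 3"
            by (simp add: exp_double[symmetric] exp_of_nat_mult[symmetric])
          also have "\<dots> \<le> 3 ^ 3" using exp_le by (intro power_mono) auto
          finally show "(exp (3 / 2))\<^sup>2 \<le> (6 :: real)\<^sup>2" by simp
        qed simp
        hence "3 / 2 \<le> ln (6 :: real)" by (subst ln_ge_iff) auto
        hence "(3 / 2)\<^sup>2 \<le> (ln (6 :: real))\<^sup>2" by (intro power_mono) auto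
        thus ?thesis by (simp add: power2_eq_square)
      qed
      have d2m: "2 * m \<le> d"
      proof -
        have "2 * real m \<le> (ln 6)\<^sup>2 * real m" using ln6 by (intro mult_right_mono) auto
        also have "\<dots> \<le> real d" using m(3) ln6 by (simp add: field_simps)
        finally show ?thesis by linarith
      qed
      define \<kappa> where "\<kappa> = real m / ln (real d / real m)"
      have "2 \<le> real d / real m" using d2m m(1) by (simp add: field_simps)
      hence L: "ln 2 \<le> ln (real d / real m)" by simp
      hence Lpos: "0 < ln (real d / real m)" using ln_gt_zero[of "2 :: real"] by linarith
      have \<kappa>: "0 < \<kappa>" using m(1) Lpos by (simp add: \<kappa>_def)
      define \<nu> where "\<nu> = nu1 C' q d m \<epsilon>"
      have \<nu>: "\<nu> = C' * (\<kappa> powr e + \<epsilon> / sqrt (real m))" by (simp add: \<nu>_def nu1_def \<kappa>_def e_def)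
      have \<kappa>K: "K0 \<le> \<kappa>"
      proof (rule ccontr)
        assume "\<not> K0 \<le> \<kappa>"
        hence "K0 powr e \<le> \<kappa> powr e" using e \<kappa> by (intro powr_mono2') auto
        hence "C2 * K0 powr (- e) * K0 powr e \<le> C' * \<kappa> powr e"
          using C' by (intro mult_mono) auto
        also have "\<dots> \<le> \<nu>" unfolding \<nu> using C'(1) eps by (intro mult_left_mono) auto
        also have "\<dots> < C2" using nu r by (simp add: \<nu>_def)
        finally show False using K0 by (simp add: mult.assoc powr_add[symmetric])
      qed
      have mM: "M \<le> m"
      proof -
        have "real M = real M / ln 2 * ln 2" by simp
        also have "\<dots> \<le> \<kappa> * ln (real d / real m)"
          using K0 \<kappa>K L by (intro mult_mono) auto
        also have "\<dots> = real m" using Lpos by (simp add: \<kappa>_def)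
        finally show ?thesis by simp
      qed
      \<comment> \<open>As c \<kappa> \<ge> 2, rounding down loses at most half.\<close>
      define k where "k = nat \<lfloor>c * \<kappa>\<rfloor>"
      have "2 / c \<le> \<kappa>" using K0(2) \<kappa>K by linarith
      hence "2 \<le> c * \<kappa>" using c by (simp add: field_simps)
      hence k: "1 \<le> k" "real k \<le> c * \<kappa>" "c * \<kappa> / 2 \<le> real k" unfolding k_def by linarith+
      define G where "G = {\<Phi> \<in> sign_matrices m d. good_matrix d m k C \<Phi>}"
      let ?P = "Pi\<^sub>M {..<mX} (\<lambda>_. \<mu>)"
      define X where "X = {\<xi> \<in> space ?P. real mX * (\<alpha> * (1 - s)) \<le> (\<Sum>j<mX. H (\<xi> j))}"
      have PG: "measure (measure_pmf (sign_matrix_pmf m d)) G \<ge> 1 - exp (- h * real m)"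
        unfolding G_def by (rule likely[OF mM d2m m(2) k(1) k(2)[unfolded \<kappa>_def]])
      have PX: "measure ?P X \<ge> 1 - exp (- (2 * real mX * s\<^sup>2 * \<alpha>\<^sup>2 / C2 ^ 4))"
        using sample_mean_lower_bound[OF prob_space_axioms _ H _ mX \<alpha>(1) _ s(1)] \<alpha>(2) meas C2
        unfolding X_def by (simp add: H_def)
      interpret P: prob_space ?P by (rule prob_space_PiM) (rule prob_space_axioms)
      have mH: "(\<lambda>\<xi>. \<Sum>j<mX. H (\<xi> j)) \<in> borel_measurable ?P"
      proof -
        have Hm: "H \<in> borel_measurable \<mu>" unfolding H_def by (rule meas)
        show ?thesis
          by (intro borel_measurable_sum measurable_compose[OF _ Hm] measurable_component_singleton)
      qed
      have setX: "X \<in> sets ?P" unfolding X_def using mH by measurable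
      show "(\<forall>\<Phi> \<in> set_pmf (sign_matrix_pmf m d). \<forall>\<xi> \<in> {..<mX} \<rightarrow>\<^sub>E unit_sphere d.
             length (eval_points d m mX \<epsilon> \<Phi> \<xi>) = mX * (m + 1) \<and>
             set (eval_points d m mX \<epsilon> \<Phi> \<xi>) \<subseteq> euclidean_ball d (1 + epsbar) \<and>
             (\<forall>f'. (\<forall>x \<in> set (eval_points d m mX \<epsilon> \<Phi> \<xi>). f' x = f x) \<longrightarrow>
                alg_directions d m mX \<epsilon> f' \<Phi> \<xi> = alg_directions d m mX \<epsilon> f \<Phi> \<xi>))"
        unfolding set_pmf_sign_matrix
      proof (intro ballI conjI allI impI)
        fix \<Phi> \<xi> F assume pt: "\<Phi> \<in> sign_matrices m d" "\<xi> \<in> {..<mX} \<rightarrow>\<^sub>E unit_sphere d"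
        note ev = evaluation_points[OF m(1) eps pt]
        show "length (eval_points d m mX \<epsilon> \<Phi> \<xi>) = mX * (m + 1)" by (rule ev(1))
        show "set (eval_points d m mX \<epsilon> \<Phi> \<xi>) \<subseteq> euclidean_ball d (1 + epsbar)" by (rule ev(2))
        assume "\<forall>x \<in> set (eval_points d m mX \<epsilon> \<Phi> \<xi>). F x = f x"
        thus "alg_directions d m mX \<epsilon> F \<Phi> \<xi> = alg_directions d m mX \<epsilon> f \<Phi> \<xi>" by (intro ev(3)) blast
      qed
      show "\<exists>E \<in> sets (draw_measure d m mX \<mu>).
             measure (draw_measure d m mX \<mu>) E
               \<ge> 1 - (exp (- h * real m) + exp (- sqrt (real m * real d))
                      + 2 * exp (- (2 * real mX * s\<^sup>2 * \<alpha>\<^sup>2 / C2 ^ 4))) \<and>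
             (\<forall>(\<Phi>, \<xi>) \<in> E.
                alg_directions d m mX \<epsilon> f \<Phi> \<xi> \<noteq> {} \<and>
                (\<forall>ahat \<in> alg_directions d m mX \<epsilon> f \<Phi> \<xi>.
                   sup_norm (euclidean_ball d (1 + epsbar)) (\<lambda>x. f x - fhat d f ahat x)
                     \<le> ereal (2 * C2 * (1 + epsbar) * (nu1 C' q d m \<epsilon>
                               / (sqrt (\<alpha> * (1 - s)) - nu1 C' q d m \<epsilon>)))))"
      \<comment> \<open>A measurable rectangle inside the set of successful draws suffices, so that
        set itself need not be shown measurable.\<close>
      proof (rule bexI[of _ "G \<times> X"], intro conjI)
        show "G \<times> X \<in> sets (draw_measure d m mX \<mu>)"
          unfolding draw_measure_def using setX by (intro pair_measureI) auto
        have "emeasure (draw_measure d m mX \<mu>) (G \<times> X)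
            = emeasure (measure_pmf (sign_matrix_pmf m d)) G * emeasure ?P X"
          unfolding draw_measure_def using setX by (intro P.emeasure_pair_measure_Times) auto
        hence prod: "measure (draw_measure d m mX \<mu>) (G \<times> X)
            = measure (measure_pmf (sign_matrix_pmf m d)) G * measure ?P X"
          by (simp add: measure_def enn2real_mult)
        \<comment> \<open>By independence the probability is a product, and x y \<ge> x + y - 1 for
          x and y in [0, 1].\<close>
        have "0 \<le> (1 - measure (measure_pmf (sign_matrix_pmf m d)) G) * (1 - measure ?P X)"
          by (intro mult_nonneg_nonneg) auto
        hence "measure (measure_pmf (sign_matrix_pmf m d)) G + measure ?P X - 1 \<le> measure (draw_measure d m mX \<mu>) (G \<times> X)"
          unfolding prod by (simp add: algebra_simps)
        moreover have "0 < exp (- sqrt (real m * real d))" "0 < exp (- (2 * real mX * s\<^sup>2 * \<alpha>\<^sup>2 / C2 ^ 4))" by auto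
        ultimately show "measure (draw_measure d m mX \<mu>) (G \<times> X)
               \<ge> 1 - (exp (- h * real m) + exp (- sqrt (real m * real d))
                      + 2 * exp (- (2 * real mX * s\<^sup>2 * \<alpha>\<^sup>2 / C2 ^ 4)))"
          using PG PX by linarith
        show "\<forall>(\<Phi>, \<xi>) \<in> G \<times> X.
                alg_directions d m mX \<epsilon> f \<Phi> \<xi> \<noteq> {} \<and>
                (\<forall>ahat \<in> alg_directions d m mX \<epsilon> f \<Phi> \<xi>.
                   sup_norm (euclidean_ball d (1 + epsbar)) (\<lambda>x. f x - fhat d f ahat x)
                     \<le> ereal (2 * C2 * (1 + epsbar) * (nu1 C' q d m \<epsilon>
                               / (sqrt (\<alpha> * (1 - s)) - nu1 C' q d m \<epsilon>))))"
        proof (clarify)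
          fix \<Phi> \<xi> assume \<Phi>: "\<Phi> \<in> G" and \<xi>: "\<xi> \<in> X"
          have \<Phi>': "\<Phi> \<in> sign_matrices m d" "good_matrix d m k C \<Phi>" using \<Phi> by (auto simp: G_def)
          have \<xi>j: "\<xi> j \<in> unit_sphere d" if "j < mX" for j
          proof -
            have "\<xi> \<in> {..<mX} \<rightarrow>\<^sub>E unit_sphere d" using \<xi> by (simp add: X_def space_PiM space_\<mu>)
            thus ?thesis by (rule PiE_mem) (simp add: that)
          qed
          have rate: "S0 * \<kappa> powr e + T0 * (\<epsilon> / sqrt (real m)) \<le> nu1 C' q d m \<epsilon>"
            unfolding \<nu>_def[symmetric] \<nu> distrib_left
            using C' eps by (intro add_mono mult_right_mono) auto
          note rr = recovery_rate[OF q C1 norms(3) m(1) eps \<Phi>' C _ c \<kappa>_def \<kappa> k(1,3)]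
          have "\<exists>j<mX. \<alpha> * (1 - s) \<le> H (\<xi> j)"
          proof (rule ccontr)
            assume "\<not> (\<exists>j<mX. \<alpha> * (1 - s) \<le> H (\<xi> j))"
            hence "(\<Sum>j<mX. H (\<xi> j)) < (\<Sum>j<mX. \<alpha> * (1 - s))"
              using mX by (intro sum_strict_mono) (auto simp: not_le lessThan_empty_iff)
            thus False using \<xi> by (simp add: X_def)
          qed
          then obtain j1 where j1: "j1 < mX" "\<alpha> * (1 - s) \<le> H (\<xi> j1)" by blast
          have big: "sqrt (\<alpha> * (1 - s)) \<le> \<bar>g' (dot d a (\<xi> j1))\<bar>"
            using real_sqrt_le_mono[OF j1(2)] by (simp add: H_def)
          have rec: "L2_set (\<lambda>i. z i - g' (dot d a (\<xi> j)) * a i) {..<d} \<le> nu1 C' q d m \<epsilon>"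
            if "j < mX" "z \<in> l1_minimizers d m \<Phi> (difference_quotient d \<epsilon> f \<Phi> (\<xi> j))" for j z
            using rr(2)[OF \<xi>j[OF that(1)] that(2)] rate
            unfolding S0_def T0_def A_def e_def by linarith
          have ne: "l1_minimizers d m \<Phi> (difference_quotient d \<epsilon> f \<Phi> (\<xi> j)) \<noteq> {}" if "j < mX" for j
            by (rule rr(1)[OF \<xi>j[OF that]])
          note de = directions_error[of "nu1 C' q d m \<epsilon>" "sqrt (\<alpha> * (1 - s))" mX m \<Phi> \<epsilon> \<xi> j1, OF nu mX rec ne j1(1) big]
          show "alg_directions d m mX \<epsilon> f \<Phi> \<xi> \<noteq> {} \<and>
                (\<forall>ahat \<in> alg_directions d m mX \<epsilon> f \<Phi> \<xi>.
                   sup_norm (euclidean_ball d (1 + epsbar)) (\<lambda>x. f x - fhat d f ahat x)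
                     \<le> ereal (2 * C2 * (1 + epsbar) * (nu1 C' q d m \<epsilon>
                               / (sqrt (\<alpha> * (1 - s)) - nu1 C' q d m \<epsilon>))))"
            using de by blast
        qed
      qed
    qed
  qed
qed

end
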